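(* Let an integer $m\ge0$ be fixed and let $h\to+\infty$. Let $\mu_0=m+\tfrac12$ and let $\mu_1,\mu_2,\dots$ be the constants (depending only on $m$) determined by the recursion in the context. Then for every integer $n\ge1$, as $h\to\infty$, $$a_m=-2h^2+4h\sum_{s=0}^n\frac{\mu_s}{h^s}+\mathcal O(h^{-n}),\qquad b_{m+1}=-2h^2+4h\sum_{s=0}^n\frac{\mu_s}{h^s}+\mathcal O(h^{-n}).$$ The first coefficients are $$\mu_0=m+\tfrac12,\qquad\mu_1=-\tfrac1{16}\left(1+2m+2m^2\right),\qquad\mu_2=-\tfrac1{128}\left(1+3m+3m^2+2m^3\right).$$
   Context: **Mathieu eigenvalues.** Mathieu's equation is $w''(z)+(\lambda-2h^2\cos2z)w(z)=0$ with real $\lambda$ and $h$. For $m=0,1,2,\dots$, $a_m=a_m(h)$ is the value of $\lambda$ for which there is a nontrivial solution with $w'(0)=w'(\pi)=0$ having exactly $m$ zeros in $(0,\pi)$; $b_{m+1}=b_{m+1}(h)$ is the value of $\lambda$ for which there is a nontrivial solution with $w(0)=w(\pi)=0$ having exactly $m$ zeros in $(0,\pi)$. **Coefficients.** Put $\tilde t=\tfrac14t^2-m-\tfrac12$. Set $A_0(t)=1$, $B_0(t)=0$. For $s\ge1$, the even polynomial $A_s(t)$ with $A_s(0)=0$, the odd polynomial $B_s(t)$ and the constant $\mu_s$ are determined recursively by the two identities in $t$ $$2A_s'+B_s''-\tfrac t4\big(2tA_{s-1}'+A_{s-1}+tB_{s-1}''+B_{s-1}'+\tilde t\,tB_{s-1}\big)+\sum_{j=1}^s\mu_jB_{s-j}=0,$$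 $$A_s''+2\tilde tB_s'+\tfrac t2B_s+\sum_{j=1}^s\mu_jA_{s-j}-\tfrac t4\Big(tA_{s-1}''+A_{s-1}'+\tfrac{t^2}2B_{s-1}+\tilde t\,(tA_{s-1}+2tB_{s-1}'+B_{s-1})\Big)=0.$$ (These express that, with $t=2\sqrt h\cos z$ and $\lambda=-2h^2+4h\sum_{s\ge0}\mu_sh^{-s}$, the formal series $D_m(t)\sum_sA_s(t)h^{-s}+D_m'(t)\sum_sB_s(t)h^{-s}$, with $D_m(t)=e^{-t^2/4}\mathrm{He}_m(t)$ the parabolic cylinder function, formally satisfies Mathieu's equation, the coefficients of $D_m$ and $D_m'$ vanishing separately.) *)

theory Defs
  imports
    Complex_Main
    "HOL-Computational_Algebra.Polynomial"
    "HOL-Library.Landau_Symbols"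
begin

definition mathieu_solution ::
    "real \<Rightarrow> real \<Rightarrow> (real \<Rightarrow> real) \<Rightarrow> (real \<Rightarrow> real) \<Rightarrow> (real \<Rightarrow> real) \<Rightarrow> bool" where
  "mathieu_solution l h w w' w'' \<longleftrightarrow>
     (\<forall>z. (w has_real_derivative w' z) (at z)) \<and>
     (\<forall>z. (w' has_real_derivative w'' z) (at z)) \<and>
     (\<forall>z. w'' z + (l - 2 * h\<^sup>2 * cos (2 * z)) * w z = 0)"

definition has_exactly_zeros :: "nat \<Rightarrow> (real \<Rightarrow> real) \<Rightarrow> bool" where
  "has_exactly_zeros k w \<longleftrightarrow>
     finite {z \<in> {0<..<pi}. w z = 0} \<and> card {z \<in> {0<..<pi}. w z = 0} = k"

definition mathieu_a :: "nat \<Rightarrow> real \<Rightarrow> real" where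
  "mathieu_a m h = (THE l. \<exists>w w' w''. mathieu_solution l h w w' w'' \<and> (\<exists>z. w z \<noteq> 0) \<and>
     w' 0 = 0 \<and> w' pi = 0 \<and> has_exactly_zeros m w)"

(* The index of b starts at 1: b_k has an eigenfunction with k - 1 interior zeros.
   The value at k = 0 is unspecified. *)
definition mathieu_b :: "nat \<Rightarrow> real \<Rightarrow> real" where
  "mathieu_b k h = (THE l. \<exists>m w w' w''. k = m + 1 \<and> mathieu_solution l h w w' w'' \<and>
     (\<exists>z. w z \<noteq> 0) \<and> w 0 = 0 \<and> w pi = 0 \<and> has_exactly_zeros m w)"

definition ttilde :: "nat \<Rightarrow> real \<Rightarrow> real" where
  "ttilde m t = t\<^sup>2 / 4 - real m - 1 / 2"

definition mathieu_recursion ::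
    "nat \<Rightarrow> (nat \<Rightarrow> real poly) \<Rightarrow> (nat \<Rightarrow> real poly) \<Rightarrow> (nat \<Rightarrow> real) \<Rightarrow> bool" where
  "mathieu_recursion m A B \<mu> \<longleftrightarrow>
     A 0 = 1 \<and> B 0 = 0 \<and> \<mu> 0 = real m + 1 / 2 \<and>
     (\<forall>s\<ge>1.
        (\<forall>t. poly (A s) (- t) = poly (A s) t) \<and>
        poly (A s) 0 = 0 \<and>
        (\<forall>t. poly (B s) (- t) = - poly (B s) t) \<and>
        (\<forall>t. 2 * poly (pderiv (A s)) t + poly (pderiv (pderiv (B s))) t
           - t / 4 * (2 * t * poly (pderiv (A (s - 1))) t + poly (A (s - 1)) t
                      + t * poly (pderiv (pderiv (B (s - 1)))) t + poly (pderiv (B (s - 1))) t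
                      + ttilde m t * t * poly (B (s - 1)) t)
           + (\<Sum>j=1..s. \<mu> j * poly (B (s - j)) t) = 0) \<and>
        (\<forall>t. poly (pderiv (pderiv (A s))) t + 2 * ttilde m t * poly (pderiv (B s)) t
           + t / 2 * poly (B s) t
           + (\<Sum>j=1..s. \<mu> j * poly (A (s - j)) t)
           - t / 4 * (t * poly (pderiv (pderiv (A (s - 1)))) t + poly (pderiv (A (s - 1))) t
                      + t\<^sup>2 / 2 * poly (B (s - 1)) t
                      + ttilde m t * (t * poly (A (s - 1)) t
                                      + 2 * t * poly (pderiv (B (s - 1))) t
                                      + poly (B (s - 1)) t)) = 0))"

(* The recursion has exactly one solution (A, B, \<mu>): eliminating A_s leaves, for B_s, an operator
   that maps odd polynomials of degree k to even ones of degree k + 1, and \<mu>_s takes up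
   the remaining constant term. *)
definition mathieu_mu :: "nat \<Rightarrow> nat \<Rightarrow> real" where
  "mathieu_mu m = (THE \<mu>. \<exists>A B. mathieu_recursion m A B \<mu>)"

end

theory Submission
  imports Defs "HOL-Analysis.Analysis"
begin

text \<open>With \<open>r = sqrt h\<close>, \<open>s = r (z - pi / 2)\<close> and \<open>\<lambda> = - 2 h\<^sup>2 + h e\<close>, Mathieu's equation becomes
  \<open>u'' = (t\<^sup>2 - e) u\<close> with \<open>t = 2 r sin (s / r)\<close>, a confining well, and every eigenfunction is even or odd in
  \<open>s\<close>. For a fixed number of zeros, the solution \<open>u\<close> with parity data at \<open>0\<close> is
  controlled uniformly in \<open>r\<close>: \<open>e\<close> is bounded by Sturm comparison, Gronwall's inequality
  works up to the turning point, and \<open>u\<^sup>2\<close> decreases from there to the end of the interval.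

  Let \<open>D\<close> be the parabolic cylinder function. Integrating by parts \<open>u\<close> against the truncated
  formal series \<open>W = \<Sum> h\<^sup>-\<^sup>s (A\<^sub>s D + B\<^sub>s D')\<close>, whose residual is \<open>O(h\<^sup>-\<^sup>n\<^sup>-\<^sup>1)\<close>, gives
  \<open>(e / 4 - \<Sum> \<mu>\<^sub>s h\<^sup>-\<^sup>s) \<integral> W u = O(h\<^sup>-\<^sup>n\<^sup>-\<^sup>1)\<close>; no cut-off is needed because \<open>dt / ds\<close> vanishes
  at the end point. It remains to bound \<open>\<integral> W u\<close> away from \<open>0\<close>. The polynomial
  \<open>p(t) = t\<^sup>m mod 2 \<Prod> (t\<^sup>2 - t\<^sub>i\<^sup>2)\<close> with the nodes \<open>t\<^sub>i\<close> of \<open>u\<close> has the same sign pattern as \<open>u\<close>, so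
  \<open>\<integral> p exp (- t\<^sup>2 / 4) u\<close> is bounded below; and by the same integration by parts the moments of \<open>u\<close>
  of degree below \<open>m\<close> are \<open>O(1 / h)\<close>, because \<open>e / 4\<close> stays away from the levels \<open>a + 1 / 2\<close> with
  \<open>a < m\<close>, \<open>a \<equiv> m (mod 2)\<close>. The latter follows by induction from \<open>m - 2\<close> to \<open>m\<close>:
  two modes of equal parity whose numbers of nodes differ by one lie in opposite quadrants of the phase plane at the
  turning point, so their parameters cannot be close.\<close>


text \<open>Eigenvalues and coefficients are both given by \<open>THE\<close>, so each needs
  existence and uniqueness before any asymptotics. For eigenvalues, existence is a shooting argument
  on half the interval at fixed \<open>r \<ge> 1\<close>, and uniqueness is Sturm comparison. For
  the coefficients, existence is algebra, but uniqueness is taken from the analysis: any two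
  solutions of the recursion expand the parameter of the same modes, and asymptotic coefficients are
  unique. This also reduces the values of the first coefficients to checking explicit polynomials.
  The expansions of a_m and b_(m+1) agree because the condition at the end point enters only through
  \<open>u'\<close> there, multiplied by a factor of size exp(- h) up to powers of h. No convergence
  of \<open>u\<close> to a parabolic cylinder function is proved; one moment bounded away from 0
  replaces it.\<close>

section \<open>Gronwall inequalities, signs and one-sided limits\<close>

lemma gronwall_upper:
  fixes f :: "real \<Rightarrow> real"
  assumes "\<And>s. 0 \<le> s \<Longrightarrow> s \<le> S \<Longrightarrow> (f has_real_derivative f' s) (at s)"
    and "\<And>s. 0 \<le> s \<Longrightarrow> s \<le> S \<Longrightarrow> f' s \<le> K * f s"
    and "0 \<le> s0" "s0 \<le> S"
  shows "f s0 \<le> f 0 * exp (K * s0)"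
proof -
  have "f s0 * exp (- K * s0) \<le> f 0 * exp (- K * 0)"
  proof (rule DERIV_nonpos_imp_nonincreasing[OF \<open>0 \<le> s0\<close>])
    fix x assume "0 \<le> x" "x \<le> s0"
    then have x: "0 \<le> x" "x \<le> S" using assms by auto
    have "((\<lambda>s. f s * exp (- K * s)) has_real_derivative (f' x - K * f x) * exp (- K * x)) (at x)"
      by (rule derivative_eq_intros assms(1)[OF x] refl | simp add: algebra_simps)+
    moreover have "(f' x - K * f x) * exp (- K * x) \<le> 0"
      using assms(2)[OF x] by (intro mult_nonpos_nonneg) auto
    ultimately show "\<exists>y. ((\<lambda>s. f s * exp (- K * s)) has_real_derivative y) (at x) \<and> y \<le> 0"
      by blast
  qed
  then have "f s0 * exp (- K * s0) * exp (K * s0) \<le> f 0 * exp (K * s0)"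
    by (simp add: mult_right_mono)
  then show ?thesis by (simp add: mult.assoc flip: exp_add)
qed

lemma gronwall_lower:
  fixes f :: "real \<Rightarrow> real"
  assumes "\<And>s. 0 \<le> s \<Longrightarrow> s \<le> S \<Longrightarrow> (f has_real_derivative f' s) (at s)"
    and "\<And>s. 0 \<le> s \<Longrightarrow> s \<le> S \<Longrightarrow> - K * f s \<le> f' s"
    and "0 \<le> s0" "s0 \<le> S"
  shows "f 0 * exp (- K * s0) \<le> f s0"
proof -
  have "- f s0 \<le> - f 0 * exp (- K * s0)"
    by (rule gronwall_upper[where f' = "\<lambda>s. - f' s" and S = S])
      (use assms(1,3,4) minus_le_iff assms(2) in \<open>fastforce intro!: derivative_eq_intros\<close>)+
  then show ?thesis by simp
qed

lemma nonzero_imp_constant_sign: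
  fixes f :: "real \<Rightarrow> real"
  assumes "continuous_on {a<..<b} f" "\<And>x. x \<in> {a<..<b} \<Longrightarrow> f x \<noteq> 0"
  shows "(\<forall>x\<in>{a<..<b}. f x > 0) \<or> (\<forall>x\<in>{a<..<b}. f x < 0)"
proof (rule ccontr)
  assume "\<not> ?thesis"
  then obtain x y where xy: "x \<in> {a<..<b}" "y \<in> {a<..<b}" "f x < 0" "f y > 0"
    using assms(2) by (meson linorder_neqE_linordered_idom)
  have "connected (f ` {a<..<b})"
    using assms(1) by (intro connected_continuous_image) auto
  then have "0 \<in> f ` {a<..<b}"
    unfolding connected_iff_interval using xy
    by (meson image_eqI less_eq_real_def)
  then show False using assms(2) by force
qed

lemma deriv_at_left_zero_nonneg:
  fixes f :: "real \<Rightarrow> real"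
  assumes "(f has_real_derivative d) (at a)" "f a = 0" "\<And>x. x \<in> {a<..<b} \<Longrightarrow> f x > 0" "a < b"
  shows "d \<ge> 0"
proof (rule ccontr)
  assume "\<not> d \<ge> 0"
  then obtain e where e: "e > 0" "\<And>h. 0 < h \<Longrightarrow> h < e \<Longrightarrow> f (a + h) < f a"
    using DERIV_neg_dec_right[OF assms(1)] by auto
  define h where "h = min (e / 2) ((b - a) / 2)"
  have "0 < h" "h < e" "a + h < b" using e assms(4) by (auto simp: h_def min_def field_simps)
  then show False using e(2)[of h] assms(2) assms(3)[of "a + h"] by auto
qed

lemma deriv_at_right_zero_nonpos:
  fixes f :: "real \<Rightarrow> real"
  assumes "(f has_real_derivative d) (at b)" "f b = 0" "\<And>x. x \<in> {a<..<b} \<Longrightarrow> f x > 0" "a < b"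
  shows "d \<le> 0"
proof (rule ccontr)
  assume "\<not> d \<le> 0"
  then obtain e where e: "e > 0" "\<And>h. 0 < h \<Longrightarrow> h < e \<Longrightarrow> f (b - h) < f b"
    using DERIV_pos_inc_left[OF assms(1)] by auto
  define h where "h = min (e / 2) ((b - a) / 2)"
  have "0 < h" "h < e" "a < b - h" using e assms(4) by (auto simp: h_def min_def field_simps)
  then show False using e(2)[of h] assms(2) assms(3)[of "b - h"] by auto
qed

lemma left_endpoint_nonneg:
  fixes f :: "real \<Rightarrow> real"
  assumes "isCont f a" "\<And>x. x \<in> {a<..<b} \<Longrightarrow> f x \<ge> 0" "a < b"
  shows "f a \<ge> 0"
proof -
  have "(f \<longlongrightarrow> f a) (at_right a)"
    using assms(1) by (simp add: isCont_def filterlim_at_split)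
  moreover have "\<forall>\<^sub>F x in at_right a. f x \<ge> 0"
    unfolding eventually_at_right[OF assms(3)] using assms by (intro exI[of _ b]) auto
  ultimately show ?thesis
    by (intro tendsto_lowerbound[of f "f a" "at_right a"]) auto
qed

lemma right_endpoint_nonneg:
  fixes f :: "real \<Rightarrow> real"
  assumes "isCont f b" "\<And>x. x \<in> {a<..<b} \<Longrightarrow> f x \<ge> 0" "a < b"
  shows "f b \<ge> 0"
proof -
  have "(f \<longlongrightarrow> f b) (at_left b)"
    using assms(1) by (simp add: isCont_def filterlim_at_split)
  moreover have "\<forall>\<^sub>F x in at_left b. f x \<ge> 0"
    unfolding eventually_at_left[OF assms(3)] using assms by (intro exI[of _ a]) auto
  ultimately show ?thesis
    by (intro tendsto_lowerbound[of f "f b" "at_left b"]) auto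
qed

lemma deriv_zero_if_zero_near:
  fixes f :: "real \<Rightarrow> real"
  assumes "(f has_real_derivative d) (at x)" "x \<in> {a<..<b}" "\<And>y. y \<in> {a<..<b} \<Longrightarrow> f y = 0"
  shows "d = 0"
proof -
  have "\<forall>\<^sub>F y in nhds x. y \<in> {a<..<b}" using assms(2) by (intro eventually_nhds_in_open) auto
  then have "\<forall>\<^sub>F y in nhds x. f y = (\<lambda>_. 0) y" by eventually_elim (rule assms(3))
  then have "((\<lambda>_. 0) has_real_derivative d) (at x)"
    using assms(1) by (subst (asm) DERIV_cong_ev[OF refl _ refl])
  then show ?thesis using DERIV_unique DERIV_const by blast
qed

text \<open>Source of the thresholds \<open>1 + D / c\<close>: with \<open>r\<^sup>2 = h\<close>, an
  error \<open>D / h\<close> drops below a prescribed \<open>c\<close>.\<close>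

lemma divide_square_le:
  fixes r :: real
  assumes "D \<ge> 0" "c > 0" "r \<ge> 1 + D / c"
  shows "D / r\<^sup>2 \<le> c"
proof -
  have "D / c \<ge> 0" using assms by simp
  then have r: "1 \<le> r" "D / c \<le> r" using assms by linarith+
  from r(1) have "r \<le> r\<^sup>2" by (simp add: power2_eq_square)
  then have "D / c \<le> r\<^sup>2" using r by linarith
  then show ?thesis using r assms by (simp add: field_simps)
qed

section \<open>Second-order linear equations and Sturm comparison\<close>

text \<open>The derivative is carried as a second function, so Cauchy data, Wronskians and
  phase-plane arguments need no derivative operator. With the sign convention
  \<open>u'' = q u\<close>, a smaller \<open>q\<close> oscillates faster.\<close>

definition ode2 :: "(real \<Rightarrow> real) \<Rightarrow> (real \<Rightarrow> real) \<Rightarrow> (real \<Rightarrow> real) \<Rightarrow> bool" where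
  "ode2 q u u' \<longleftrightarrow> (\<forall>x. (u has_real_derivative u' x) (at x)) \<and>
     (\<forall>x. (u' has_real_derivative q x * u x) (at x))"

lemma ode2_scale: "ode2 q u u' \<Longrightarrow> ode2 q (\<lambda>x. c * u x) (\<lambda>x. c * u' x)"
  unfolding ode2_def by (auto intro!: derivative_eq_intros)

lemma ode2_isCont: "ode2 q u u' \<Longrightarrow> isCont u x" "ode2 q u u' \<Longrightarrow> isCont u' x"
  unfolding ode2_def using DERIV_isCont by blast+

lemma ode2_continuous_on: "ode2 q u u' \<Longrightarrow> continuous_on S u" "ode2 q u u' \<Longrightarrow> continuous_on S u'"
  by (simp_all add: continuous_at_imp_continuous_on ode2_isCont)

text \<open>The Wronskian \<open>W\<close> has derivative \<open>(q2 - q1) * u * v < 0\<close>,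
  while the conditions at the ends force \<open>W a \<le> 0 \<le> W b\<close>. Each end condition is
  a disjunction, so that one lemma serves both a node of \<open>u\<close> and an end where
  \<open>u\<close> and \<open>v\<close> share a boundary condition, which makes \<open>W\<close>
  vanish.\<close>

lemma sturm_positive:
  assumes u: "ode2 q1 u u'" and v: "ode2 q2 v v'" and ab: "a < b"
    and q: "\<And>x. x \<in> {a<..<b} \<Longrightarrow> q2 x < q1 x"
    and bca: "u a = 0 \<or> u a * v' a = u' a * v a"
    and bcb: "u b = 0 \<or> u b * v' b = u' b * v b"
    and up: "\<And>x. x \<in> {a<..<b} \<Longrightarrow> u x > 0"
    and vp: "\<And>x. x \<in> {a<..<b} \<Longrightarrow> v x > 0"
  shows False
proof -
  define W where "W x = u x * v' x - u' x * v x" for x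
  have W': "(W has_real_derivative (q2 x - q1 x) * (u x * v x)) (at x)" for x
    unfolding W_def using u v unfolding ode2_def
    by (auto intro!: derivative_eq_intros simp: algebra_simps)
  have "W b < W a"
  proof (rule DERIV_neg_imp_decreasing_open[OF ab])
    show "\<exists>y. (W has_real_derivative y) (at x) \<and> y < 0" if "a < x" "x < b" for x
      using W'[of x] q[of x] up[of x] vp[of x] that
      by (intro exI[of _ "(q2 x - q1 x) * (u x * v x)"]) (auto simp: mult_neg_pos)
    show "continuous_on {a..b} W"
      using W' by (intro continuous_at_imp_continuous_on) (auto intro: DERIV_isCont)
  qed
  have "u a = 0 \<Longrightarrow> 0 \<le> u' a"
    using deriv_at_left_zero_nonneg[of u "u' a" a b] u up ab unfolding ode2_def by auto
  moreover have "v a \<ge> 0" using left_endpoint_nonneg[OF ode2_isCont(1)[OF v] _ ab] vp by (auto intro: less_imp_le)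
  ultimately have "W a \<le> 0" using bca by (auto simp: W_def)
  have "u b = 0 \<Longrightarrow> u' b \<le> 0"
    using deriv_at_right_zero_nonpos[of u "u' b" b a] u up ab unfolding ode2_def by auto
  moreover have "v b \<ge> 0" using right_endpoint_nonneg[OF ode2_isCont(1)[OF v] _ ab] vp by (auto intro: less_imp_le)
  ultimately have "W b \<ge> 0" using bcb by (auto simp: W_def mult_nonpos_nonneg)
  show False using \<open>W b < W a\<close> \<open>W a \<le> 0\<close> \<open>0 \<le> W b\<close> by simp
qed

lemma sturm_zero:
  assumes u: "ode2 q1 u u'" and v: "ode2 q2 v v'" and ab: "a < b"
    and q: "\<And>x. x \<in> {a<..<b} \<Longrightarrow> q2 x < q1 x"
    and bca: "u a = 0 \<or> u a * v' a = u' a * v a"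
    and bcb: "u b = 0 \<or> u b * v' b = u' b * v b"
    and un: "\<And>x. x \<in> {a<..<b} \<Longrightarrow> u x \<noteq> 0"
  shows "\<exists>x\<in>{a<..<b}. v x = 0"
proof (rule ccontr)
  assume "\<not> ?thesis"
  then have vn: "\<And>x. x \<in> {a<..<b} \<Longrightarrow> v x \<noteq> 0" by auto
  obtain c :: real where c: "c \<noteq> 0" "\<And>x. x \<in> {a<..<b} \<Longrightarrow> c * u x > 0"
    using nonzero_imp_constant_sign[of a b u, OF ode2_continuous_on(1)[OF u] un] that[of 1] that[of "-1"]
    by auto
  obtain d :: real where d: "d \<noteq> 0" "\<And>x. x \<in> {a<..<b} \<Longrightarrow> d * v x > 0"
    using nonzero_imp_constant_sign[of a b v, OF ode2_continuous_on(1)[OF v] vn] that[of 1] that[of "-1"]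
    by auto
  show False
    by (rule sturm_positive[OF ode2_scale[OF u, of c] ode2_scale[OF v, of d] ab q])
      (use c d bca bcb in \<open>auto simp: algebra_simps\<close>)
qed

text \<open>The \<open>k\<close> zeros of \<open>u\<close> cut the interval into
  \<open>k + 1\<close> pieces, and each piece contains a zero of \<open>v\<close>.\<close>

lemma sturm_count:
  assumes u: "ode2 q1 u u'" and v: "ode2 q2 v v'" and ab: "a < b"
    and q: "\<And>x. x \<in> {a<..<b} \<Longrightarrow> q2 x < q1 x"
    and bca: "u a = 0 \<or> u a * v' a = u' a * v a"
    and bcb: "u b = 0 \<or> u b * v' b = u' b * v b"
    and fu: "finite {x\<in>{a<..<b}. u x = 0}" and fv: "finite {x\<in>{a<..<b}. v x = 0}"
  shows "card {x\<in>{a<..<b}. u x = 0} < card {x\<in>{a<..<b}. v x = 0}"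
  using ab q bca bcb fu fv
proof (induction "card {x\<in>{a<..<b}. u x = 0}" arbitrary: b rule: less_induct)
  case (less b)
  show ?case
  proof (cases "{x\<in>{a<..<b}. u x = 0} = {}")
    case True
    then have "\<exists>x\<in>{a<..<b}. v x = 0"
      using less.prems by (intro sturm_zero[OF u v]) auto
    then have "{x\<in>{a<..<b}. v x = 0} \<noteq> {}" by auto
    then show ?thesis using less.prems(6) unfolding True by (simp only: card.empty card_gt_0_iff simp_thms not_False_eq_True)
  next
    case False
    \<comment> \<open>Cutting at the last zero keeps the left end and its condition fixed, so the
      induction varies only \<open>b\<close>.\<close>
    define c where "c = Max {x\<in>{a<..<b}. u x = 0}"
    have c: "c \<in> {x\<in>{a<..<b}. u x = 0}"
      unfolding c_def using less.prems False by (intro Max_in) auto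
    have cmax: "x \<le> c" if "x \<in> {a<..<b}" "u x = 0" for x
      unfolding c_def using that less.prems by (intro Max_ge) auto
    have eq: "{x\<in>{a<..<b}. u x = 0} = insert c {x\<in>{a<..<c}. u x = 0}"
      using c cmax by force
    have fin: "finite {x\<in>{a<..<c}. u x = 0}" "finite {x\<in>{a<..<c}. v x = 0}"
      by (rule finite_subset[OF _ less.prems(5)], use c in force) (rule finite_subset[OF _ less.prems(6)], use c in force)
    have card: "card {x\<in>{a<..<b}. u x = 0} = Suc (card {x\<in>{a<..<c}. u x = 0})"
      unfolding eq using fin by simp
    have 1: "card {x\<in>{a<..<c}. u x = 0} < card {x\<in>{a<..<c}. v x = 0}"
      using c less.prems fin card by (intro less.hyps) auto
    have "\<exists>x\<in>{c<..<b}. v x = 0"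
    proof (rule sturm_zero[OF u v])
      show "u x \<noteq> 0" if "x \<in> {c<..<b}" for x using cmax[of x] c that by auto
      show "q2 x < q1 x" if "x \<in> {c<..<b}" for x using less.prems(2)[of x] c that by auto
    qed (use c less.prems(4) in auto)
    then obtain d where d: "d \<in> {c<..<b}" "v d = 0" by blast
    have "card (insert d {x\<in>{a<..<c}. v x = 0}) \<le> card {x\<in>{a<..<b}. v x = 0}"
      using d c less.prems by (intro card_mono) auto
    moreover have "card (insert d {x\<in>{a<..<c}. v x = 0}) = Suc (card {x\<in>{a<..<c}. v x = 0})"
      using fin d by simp
    ultimately show ?thesis using 1 card by linarith
  qed
qed

text \<open>Each simple zero is divided out; the quotient extends continuously by the derivative.\<close>

lemma simple_zeros_constant_sign:
  fixes f :: "real \<Rightarrow> real"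
  assumes "finite Z" "continuous_on {a<..<b} f" "Z = {x\<in>{a<..<b}. f x = 0}"
    "\<And>z. z \<in> Z \<Longrightarrow> \<exists>d. d \<noteq> 0 \<and> (f has_real_derivative d) (at z)"
  shows "(\<forall>x\<in>{a<..<b}. f x * (\<Prod>z\<in>Z. x - z) \<ge> 0) \<or> (\<forall>x\<in>{a<..<b}. f x * (\<Prod>z\<in>Z. x - z) \<le> 0)"
  using assms
proof (induction Z arbitrary: f rule: finite_induct)
  case empty
  then show ?case using nonzero_imp_constant_sign[of a b f] by (force intro: less_imp_le)
next
  case (insert c Z f)
  obtain d where d: "d \<noteq> 0" "(f has_real_derivative d) (at c)" using insert.prems by blast
  have c: "c \<in> {a<..<b}" "f c = 0" using insert.prems by auto
  define g where "g x = (if x = c then d else f x / (x - c))" for x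
  have fg: "f x = g x * (x - c)" for x using c by (auto simp: g_def)
  have fcont: "isCont f x" if "x \<in> {a<..<b}" for x
    using insert.prems(1) that by (simp add: continuous_on_eq_continuous_at)
  have "isCont g x" if "x \<in> {a<..<b}" for x
  proof (cases "x = c")
    case True
    have "((\<lambda>x. f x / (x - c)) \<longlongrightarrow> d) (at c)"
      using d(2) c unfolding has_field_derivative_iff by simp
    then have "(g \<longlongrightarrow> d) (at c)"
      by (rule Lim_transform_eventually) (auto simp: g_def eventually_at_filter)
    then show ?thesis using True by (simp add: isCont_def g_def)
  next
    case False
    have "\<forall>\<^sub>F y in nhds x. y \<in> - {c}"
      using False by (intro eventually_nhds_in_open) auto
    then have "\<forall>\<^sub>F y in nhds x. g y = f y / (y - c)"
      by eventually_elim (auto simp: g_def)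
    moreover have "isCont (\<lambda>y. f y / (y - c)) x" using fcont[OF that] False by (auto intro!: continuous_intros)
    ultimately show ?thesis using isCont_cong[of g "\<lambda>y. f y / (y - c)" x] by simp
  qed
  then have 1: "continuous_on {a<..<b} g" by (simp add: continuous_on_eq_continuous_at)
  have 2: "Z = {x\<in>{a<..<b}. g x = 0}"
    using insert.prems(2) insert.hyps d(1) by (auto simp: g_def split: if_splits)
  have 3: "\<exists>d. d \<noteq> 0 \<and> (g has_real_derivative d) (at z)" if "z \<in> Z" for z
  proof -
    have zc: "z \<noteq> c" using that insert.hyps by auto
    have fz: "f z = 0" using that insert.prems(2) by auto
    obtain d' where d': "d' \<noteq> 0" "(f has_real_derivative d') (at z)" using insert.prems(3)[of z] \<open>z \<in> Z\<close> by auto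
    have "((\<lambda>y. f y / (y - c)) has_real_derivative (d' * (z - c) - f z * 1) / ((z - c) * (z - c))) (at z)"
      by (rule DERIV_divide) (use d' zc in \<open>auto intro!: derivative_eq_intros\<close>)
    then have "((\<lambda>y. f y / (y - c)) has_real_derivative d' / (z - c)) (at z)"
      using zc fz by simp
    moreover have "\<forall>\<^sub>F y in nhds z. y \<in> - {c}"
      using zc by (intro eventually_nhds_in_open) auto
    then have "\<forall>\<^sub>F y in nhds z. g y = f y / (y - c)"
      by eventually_elim (auto simp: g_def)
    ultimately have "(g has_real_derivative d' / (z - c)) (at z)"
      by (subst DERIV_cong_ev[OF refl _ refl])
    then show ?thesis using d' zc by (intro exI[of _ "d' / (z - c)"]) auto
  qed
  \<comment> \<open>The new factor is a square, so the constant sign for \<open>g\<close> passes to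
    \<open>f\<close>.\<close>
  have eq: "f x * (\<Prod>z\<in>insert c Z. x - z) = (g x * (\<Prod>z\<in>Z. x - z)) * (x - c)\<^sup>2" for x
    using insert.hyps by (simp add: fg power2_eq_square mult_ac)
  show ?case using insert.IH[OF 1 2 3] unfolding eq
    by (auto intro: mult_nonneg_nonneg mult_nonpos_nonneg)
qed

section \<open>Existence, energy and parameter dependence of solutions\<close>

lemma antiderivative_on_reals:
  fixes f :: "real \<Rightarrow> real"
  assumes "\<And>x. isCont f x"
  shows "\<exists>F. F 0 = 0 \<and> (\<forall>x. (F has_real_derivative f x) (at x))"
proof -
  obtain F where F: "\<And>x. (F has_vector_derivative f x) (at x)"
    using einterval_antiderivative[of "-\<infinity>" "\<infinity>" f] assms by auto
  then have "((\<lambda>x. F x - F 0) has_real_derivative f x) (at x)" for x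
    using F[of x] by (auto intro!: derivative_eq_intros simp: has_real_derivative_iff_has_vector_derivative)
  then show ?thesis by (intro exI[of _ "\<lambda>x. F x - F 0"]) auto
qed

text \<open>One integration in Picard's iteration gains a power of \<open>s\<close> and a
  denominator. The case of negative \<open>s\<close> is reduced to the other by reflection.\<close>

lemma abs_le_integrated_power:
  fixes F :: "real \<Rightarrow> real"
  assumes F: "\<And>s. (F has_real_derivative g s) (at s)" and F0: "F 0 = 0"
    and g: "\<And>s. \<bar>g s\<bar> \<le> c * \<bar>s\<bar> ^ j"
  shows "\<bar>F s\<bar> \<le> c * \<bar>s\<bar> ^ Suc j / real (Suc j)"
proof -
  have nonneg: "G s \<le> c * s ^ Suc j / real (Suc j)"
    if "\<And>s. (G has_real_derivative k s) (at s)" "G 0 = 0" "\<And>s. k s \<le> c * \<bar>s\<bar> ^ j" "s \<ge> 0"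
    for G k :: "real \<Rightarrow> real" and s
  proof -
    have "c * 0 ^ Suc j / real (Suc j) - G 0 \<le> c * s ^ Suc j / real (Suc j) - G s"
    proof (rule DERIV_nonneg_imp_nondecreasing[OF \<open>s \<ge> 0\<close>])
      fix x :: real assume x: "0 \<le> x" "x \<le> s"
      have "((\<lambda>x. x ^ Suc j) has_real_derivative real (Suc j) * x ^ j) (at x)"
        using DERIV_pow[of "Suc j" x] by simp
      then have "((\<lambda>x. c * x ^ Suc j / real (Suc j) - G x) has_real_derivative
          c * (real (Suc j) * x ^ j) / real (Suc j) - k x) (at x)"
        by (intro DERIV_diff DERIV_cdivide DERIV_cmult that(1))
      moreover have "c * (real (Suc j) * x ^ j) / real (Suc j) - k x \<ge> 0"
        using that(3)[of x] x by (simp del: of_nat_Suc)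
      ultimately show "\<exists>y. ((\<lambda>x. c * x ^ Suc j / real (Suc j) - G x) has_real_derivative y) (at x) \<and> 0 \<le> y"
        by blast
    qed
    then show ?thesis using that(2) by simp
  qed
  have F': "((\<lambda>s. F (- s)) has_real_derivative - g (- s)) (at s)" for s
    using F[of "- s"] by (simp add: DERIV_mirror)
  have g': "g s \<le> c * \<bar>s\<bar> ^ j" "- g s \<le> c * \<bar>s\<bar> ^ j"
     "- g (- s) \<le> c * \<bar>s\<bar> ^ j" "g (- s) \<le> c * \<bar>s\<bar> ^ j" for s
    using g[of s] g[of "- s"] by auto
  show ?thesis
  proof (cases "s \<ge> 0")
    case True
    have "F s \<le> c * s ^ Suc j / real (Suc j)"
      by (rule nonneg[OF F F0 g'(1) True])
    moreover have "- F s \<le> c * s ^ Suc j / real (Suc j)"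
      by (rule nonneg[of "\<lambda>s. - F s" "\<lambda>s. - g s", OF DERIV_minus[OF F] _ g'(2) True]) (simp add: F0)
    ultimately show ?thesis using True by (simp add: abs_le_iff)
  next
    case False
    then have s: "- s \<ge> 0" by simp
    have "F (- (- s)) \<le> c * (- s) ^ Suc j / real (Suc j)"
      by (rule nonneg[of "\<lambda>s. F (- s)" "\<lambda>s. - g (- s)", OF F' _ g'(3) s]) (simp add: F0)
    moreover have "- F (- (- s)) \<le> c * (- s) ^ Suc j / real (Suc j)"
      by (rule nonneg[of "\<lambda>s. - F (- s)" "\<lambda>s. g (- s)", OF _ _ g'(4) s])
        (use DERIV_minus[OF F'] in \<open>auto simp: F0\<close>)
    moreover have "\<bar>s\<bar> = - s" using False by simp
    ultimately show ?thesis by (simp only: abs_le_iff minus_minus)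
  qed
qed

text \<open>Both cases are normalised to \<open>u\<^sup>2 + u'\<^sup>2 = 1\<close> at 0, which fixes
  the scale of every later energy bound.\<close>

definition parity_data :: "nat \<Rightarrow> (real \<Rightarrow> real) \<Rightarrow> (real \<Rightarrow> real) \<Rightarrow> bool" where
  "parity_data m u u' \<longleftrightarrow> (if even m then u 0 = 1 \<and> u' 0 = 0 else u 0 = 0 \<and> u' 0 = 1)"

text \<open>Picard iteration written as a series: boundedness of \<open>q\<close> gives majorants
  that converge on every interval, for the terms and for their first two derivatives, so termwise
  differentiation is allowed on the whole line.\<close>

lemma ode2_exists:
  assumes qc: "\<And>x. isCont q x" and qb: "\<And>x. \<bar>q x\<bar> \<le> Q"
  shows "\<exists>u u'. ode2 q u u' \<and> parity_data m u u'"
proof -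
  define p :: nat where "p = m mod 2"
  have p: "p = 0 \<or> p = 1" by (auto simp: p_def)
  have Q: "Q \<ge> 0" using qb[of 0] by linarith
  have "\<exists>F G. F 0 = 0 \<and> G 0 = 0 \<and> (\<forall>x. (F has_real_derivative G x) (at x)) \<and>
      (\<forall>x. (G has_real_derivative q x * f x) (at x))" if fc: "\<And>x. isCont f x" for f
  proof -
    obtain G where G: "G 0 = 0" "\<And>x. (G has_real_derivative q x * f x) (at x)"
      using antiderivative_on_reals[of "\<lambda>x. q x * f x", OF isCont_mult[OF qc fc]] by blast
    obtain F where F: "F 0 = 0" "\<And>x. (F has_real_derivative G x) (at x)"
      using antiderivative_on_reals[of G] G(2) DERIV_isCont by blast
    show ?thesis using F G by blast
  qed
  then obtain T S where TS: "T f 0 = 0 \<and> S f 0 = 0 \<and> (\<forall>x. (T f has_real_derivative S f x) (at x)) \<and>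
      (\<forall>x. (S f has_real_derivative q x * f x) (at x))" if "\<forall>x. isCont f x" for f
    by metis
  \<comment> \<open>\<open>T\<close> integrates \<open>q * f\<close> twice from 0. The seed
    \<open>s ^ p\<close>, with derivative \<open>p\<close>, carries the initial data;
    \<open>0 ^ 0 = 1\<close> gives the even case.\<close>
  define F where "F n = (T ^^ n) (\<lambda>s. s ^ p)" for n
  define G where "G n = (case n of 0 \<Rightarrow> (\<lambda>s. real p) | Suc n \<Rightarrow> S (F n))" for n
  define H where "H n x = (case n of 0 \<Rightarrow> 0 | Suc n \<Rightarrow> q x * F n x)" for n x
  have FSuc: "F (Suc n) = T (F n)" for n by (simp add: F_def)
  have Fcont: "\<forall>x. isCont (F n) x" for n
  proof (induction n)
    case 0 show ?case by (auto simp: F_def intro!: continuous_intros)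
  next
    case (Suc n) then show ?case unfolding FSuc using TS[of "F n"] DERIV_isCont by blast
  qed
  have FG: "(F n has_real_derivative G n x) (at x)" for n x
  proof (cases n)
    case 0 then show ?thesis using p by (auto simp: F_def G_def intro!: derivative_eq_intros)
  next
    case (Suc k) then show ?thesis using TS[OF Fcont[of k]] by (simp add: FSuc G_def)
  qed
  have GH: "(G n has_real_derivative H n x) (at x)" for n x
    using TS[OF Fcont] by (cases n) (auto simp: G_def H_def)
  have F0: "F n 0 = (if n = 0 then 0 ^ p else 0)" for n
    using TS[OF Fcont[of "n - 1"]] by (cases n) (auto simp: FSuc F_def[of 0])
  have G0: "G n 0 = (if n = 0 then real p else 0)" for n
    using TS[OF Fcont[of "n - 1"]] by (cases n) (auto simp: G_def)
  \<comment> \<open>Repeated integration would yield the denominator (2 n + p)!; keeping only n!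
    suffices, since the majorant is then an exponential series in
    \<open>Q * R\<^sup>2\<close>.\<close>
  have bounds: "(\<forall>s. \<bar>F n s\<bar> \<le> Q ^ n / fact n * \<bar>s\<bar> ^ (2 * n + p)) \<and>
      (\<forall>s. \<bar>G (Suc n) s\<bar> \<le> Q ^ Suc n / fact n * \<bar>s\<bar> ^ Suc (2 * n + p))" for n
  proof (induction n rule: nat_induct)
    have step: "(\<forall>s. \<bar>G (Suc n) s\<bar> \<le> Q ^ Suc n / fact n * \<bar>s\<bar> ^ Suc (2 * n + p))"
      if Fn: "\<And>s. \<bar>F n s\<bar> \<le> Q ^ n / fact n * \<bar>s\<bar> ^ (2 * n + p)" for n
    proof
      fix s
      have "\<bar>q s * F n s\<bar> \<le> Q ^ Suc n / fact n * \<bar>s\<bar> ^ (2 * n + p)" for s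
        using mult_mono[OF qb[of s] Fn[of s] Q] by (simp add: abs_mult mult_ac)
      then have "\<bar>G (Suc n) s\<bar> \<le> Q ^ Suc n / fact n * \<bar>s\<bar> ^ Suc (2 * n + p) / real (Suc (2 * n + p))"
        using GH[of "Suc n"] G0 by (intro abs_le_integrated_power[where g = "\<lambda>s. q s * F n s"]) (auto simp: H_def)
      also have "\<dots> \<le> Q ^ Suc n / fact n * \<bar>s\<bar> ^ Suc (2 * n + p) / 1"
        using Q by (intro divide_left_mono) auto
      finally show "\<bar>G (Suc n) s\<bar> \<le> Q ^ Suc n / fact n * \<bar>s\<bar> ^ Suc (2 * n + p)" by simp
    qed
    {
      case 0
      show ?case using step[of 0] by (auto simp: F_def power_abs)
    next
      case (Suc n)
      have "\<bar>F (Suc n) s\<bar> \<le> Q ^ Suc n / fact n * \<bar>s\<bar> ^ Suc (Suc (2 * n + p)) / real (Suc (Suc (2 * n + p)))" for s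
        using Suc FG[of "Suc n"] F0 by (intro abs_le_integrated_power[where g = "G (Suc n)"]) auto
      also have "\<dots> s \<le> Q ^ Suc n / fact n * \<bar>s\<bar> ^ Suc (Suc (2 * n + p)) / real (Suc n)" for s
        using Q by (intro divide_left_mono) auto
      finally have "\<bar>F (Suc n) s\<bar> \<le> Q ^ Suc n / fact (Suc n) * \<bar>s\<bar> ^ (2 * Suc n + p)" for s
        by (simp add: mult_ac)
      then show ?case using step[of "Suc n"] by blast
    }
  qed
  define M where "M R n = R * ((Q * R\<^sup>2) ^ n / fact n)" for R :: real and n
  have sumM: "summable (M R)" for R
    unfolding M_def by (intro summable_mult) (use summable_exp[of "Q * R\<^sup>2"] in \<open>simp add: divide_inverse mult.commute\<close>)
  have Fb: "\<bar>F n s\<bar> \<le> M R n" if "\<bar>s\<bar> \<le> R" "R \<ge> 1" for n s R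
  proof -
    have "\<bar>F n s\<bar> \<le> Q ^ n / fact n * \<bar>s\<bar> ^ (2 * n + p)" using bounds by blast
    also have "\<dots> \<le> Q ^ n / fact n * R ^ (2 * n + p)"
      using that Q by (intro mult_left_mono power_mono) auto
    also have "\<dots> \<le> Q ^ n / fact n * R ^ (2 * n + 1)"
      using that Q p by (intro mult_left_mono power_increasing) auto
    also have "\<dots> = M R n" by (simp add: M_def power_mult_distrib flip: power_mult)
    finally show ?thesis .
  qed
  have Gb: "\<bar>G (Suc n) s\<bar> \<le> Q * R * M R n" if "\<bar>s\<bar> \<le> R" "R \<ge> 1" for n s R
  proof -
    have "\<bar>G (Suc n) s\<bar> \<le> Q ^ Suc n / fact n * \<bar>s\<bar> ^ Suc (2 * n + p)" using bounds by blast
    also have "\<dots> \<le> Q ^ Suc n / fact n * R ^ Suc (2 * n + p)"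
      using that Q by (intro mult_left_mono power_mono) auto
    also have "\<dots> \<le> Q ^ Suc n / fact n * R ^ (2 * n + 2)"
      using that Q p by (intro mult_left_mono power_increasing) auto
    also have "\<dots> = Q * R * M R n"
      by (simp add: M_def power_mult_distrib power2_eq_square flip: power_mult mult.assoc)
        (simp add: mult_2 mult_2_right power_add mult_ac)
    finally show ?thesis .
  qed
  define MG where "MG R n = (case n of 0 \<Rightarrow> 1 | Suc n \<Rightarrow> Q * R * M R n)" for R n
  have sumMG: "summable (MG R)" for R
    by (subst summable_Suc_iff[symmetric]) (simp add: MG_def summable_mult sumM)
  define MH where "MH R n = (case n of 0 \<Rightarrow> 0 | Suc n \<Rightarrow> Q * M R n)" for R n
  have sumMH: "summable (MH R)" for R
    by (subst summable_Suc_iff[symmetric]) (simp add: MH_def summable_mult sumM)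
  have Gb': "\<bar>G n s\<bar> \<le> MG R n" if "\<bar>s\<bar> \<le> R" "R \<ge> 1" for n s R
    using Gb[OF that] p by (cases n) (auto simp: MG_def G_def[of 0])
  have Hb: "\<bar>H n s\<bar> \<le> MH R n" if "\<bar>s\<bar> \<le> R" "R \<ge> 1" for n s R
    using mult_mono[OF qb[of s] Fb[OF that] Q] by (cases n) (auto simp: MH_def H_def abs_mult)
  define u where "u x = (\<Sum>n. F n x)" for x
  define u' where "u' x = (\<Sum>n. G n x)" for x
  have sF: "summable (\<lambda>n. F n x)" for x
    by (rule summable_comparison_test[OF _ sumM[of "\<bar>x\<bar> + 1"]]) (use Fb[of x "\<bar>x\<bar> + 1"] in auto)
  have sG: "summable (\<lambda>n. G n x)" for x
    by (rule summable_comparison_test[OF _ sumMG[of "\<bar>x\<bar> + 1"]]) (use Gb'[of x "\<bar>x\<bar> + 1"] in auto)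
  have du: "(u has_real_derivative u' x) (at x)" for x
    unfolding u_def u'_def
  proof (rule has_field_derivative_series'(2)[of "{- (\<bar>x\<bar> + 1) .. \<bar>x\<bar> + 1}"])
    show "uniformly_convergent_on {- (\<bar>x\<bar> + 1)..\<bar>x\<bar> + 1} (\<lambda>n x. \<Sum>i<n. G i x)"
      by (rule Weierstrass_m_test'[OF _ sumMG[of "\<bar>x\<bar> + 1"]]) (auto intro!: Gb')
  qed (use FG sF in \<open>auto intro: has_field_derivative_at_within\<close>)
  have "(u' has_real_derivative (\<Sum>n. H n x)) (at x)" for x
    unfolding u'_def
  proof (rule has_field_derivative_series'(2)[of "{- (\<bar>x\<bar> + 1) .. \<bar>x\<bar> + 1}"])
    show "uniformly_convergent_on {- (\<bar>x\<bar> + 1)..\<bar>x\<bar> + 1} (\<lambda>n x. \<Sum>i<n. H i x)"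
      by (rule Weierstrass_m_test'[OF _ sumMH[of "\<bar>x\<bar> + 1"]]) (auto intro!: Hb)
  qed (use GH sG in \<open>auto intro: has_field_derivative_at_within\<close>)
  moreover have "(\<Sum>n. H n x) = q x * u x" for x
  proof -
    have "(\<lambda>n. H (Suc n) x) sums (q x * u x)"
      unfolding u_def H_def using sF by (auto intro!: sums_mult summable_sums)
    then have "(\<lambda>n. H n x) sums (q x * u x + H 0 x)" by (subst (asm) sums_Suc_iff) auto
    then show ?thesis by (simp add: sums_iff H_def)
  qed
  ultimately have ode: "ode2 q u u'" using du by (simp add: ode2_def)
  have "u 0 = (\<Sum>n\<in>{0::nat}. if n = 0 then 0 ^ p else 0)"
    unfolding u_def F0 by (rule suminf_finite) auto
  moreover have "u' 0 = (\<Sum>n\<in>{0::nat}. if n = 0 then real p else 0)"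
    unfolding u'_def G0 by (rule suminf_finite) auto
  ultimately have "parity_data m u u'" by (auto simp: parity_data_def p_def odd_iff_mod_2_eq_one)
  with ode show ?thesis by blast
qed

text \<open>The derivative of \<open>u\<^sup>2 + u'\<^sup>2\<close> is
  \<open>2 * (1 + q) * u * u'\<close>, at most \<open>1 + Q\<close> times the energy in absolute
  value. The lower bound is a quantitative form of uniqueness: \<open>u\<close> and
  \<open>u'\<close> cannot be small together.\<close>

lemma energy_bounds:
  assumes u: "ode2 q u u'" and q: "\<And>s. 0 \<le> s \<Longrightarrow> s \<le> S \<Longrightarrow> \<bar>q s\<bar> \<le> Q" and s: "0 \<le> s" "s \<le> S"
  shows "(u s)\<^sup>2 + (u' s)\<^sup>2 \<le> ((u 0)\<^sup>2 + (u' 0)\<^sup>2) * exp ((1 + Q) * s)"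
    "((u 0)\<^sup>2 + (u' 0)\<^sup>2) * exp (- (1 + Q) * s) \<le> (u s)\<^sup>2 + (u' s)\<^sup>2"
proof -
  define E where "E s = (u s)\<^sup>2 + (u' s)\<^sup>2" for s
  define E' where "E' s = (1 + q s) * (2 * u s * u' s)" for s
  have d: "(E has_real_derivative E' s) (at s)" for s
    unfolding E_def E'_def using u unfolding ode2_def
    by (auto intro!: derivative_eq_intros simp: algebra_simps)
  have b: "\<bar>E' s\<bar> \<le> (1 + Q) * E s" if "0 \<le> s" "s \<le> S" for s
  proof -
    have "\<bar>2 * u s * u' s\<bar> \<le> E s"
      using sum_squares_bound[of "u s" "u' s"] sum_squares_bound[of "- u s" "u' s"]
      by (auto simp: E_def abs_le_iff)
    moreover have "\<bar>1 + q s\<bar> \<le> 1 + Q" using q[OF that] by linarith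
    ultimately show ?thesis unfolding E'_def abs_mult by (intro mult_mono) auto
  qed
  have "E s \<le> E 0 * exp ((1 + Q) * s)"
    by (rule gronwall_upper[OF d _ s]) (use b in \<open>auto dest: abs_le_D1\<close>)
  then show "(u s)\<^sup>2 + (u' s)\<^sup>2 \<le> ((u 0)\<^sup>2 + (u' 0)\<^sup>2) * exp ((1 + Q) * s)" by (simp add: E_def)
  have "E 0 * exp (- (1 + Q) * s) \<le> E s"
  proof (rule gronwall_lower[OF d _ s])
    show "- (1 + Q) * E s \<le> E' s" if "0 \<le> s" "s \<le> S" for s
      using abs_le_D2[OF b[OF that]] by (simp add: algebra_simps)
  qed
  then show "((u 0)\<^sup>2 + (u' 0)\<^sup>2) * exp (- (1 + Q) * s) \<le> (u s)\<^sup>2 + (u' s)\<^sup>2" by (simp add: E_def)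
qed

lemma parameter_dependence:
  assumes u: "ode2 q1 u u'" and v: "ode2 q2 v v'"
    and q: "\<And>s. 0 \<le> s \<Longrightarrow> s \<le> S \<Longrightarrow> \<bar>q2 s\<bar> \<le> Q" "\<And>s. q2 s - q1 s = \<delta>"
    and uB: "\<And>s. 0 \<le> s \<Longrightarrow> s \<le> S \<Longrightarrow> (u s)\<^sup>2 \<le> B"
    and init: "u 0 = v 0" "u' 0 = v' 0" and s: "0 \<le> s" "s \<le> S"
  shows "(v s - u s)\<^sup>2 + (v' s - u' s)\<^sup>2 \<le> \<delta>\<^sup>2 * B * exp ((2 + Q) * s)"
proof -
  \<comment> \<open>The added constant absorbs the inhomogeneous term \<open>\<delta> * u\<close>,
    so the homogeneous Gronwall inequality applies.\<close>
  define E where "E s = (v s - u s)\<^sup>2 + (v' s - u' s)\<^sup>2 + \<delta>\<^sup>2 * B" for s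
  define E' where "E' s = 2 * (v s - u s) * (v' s - u' s) + 2 * (v' s - u' s) * (q2 s * v s - q1 s * u s)" for s
  have d: "(E has_real_derivative E' s) (at s)" for s
    unfolding E_def E'_def using u v unfolding ode2_def
    by (auto intro!: derivative_eq_intros simp: algebra_simps)
  have Q: "Q \<ge> 0" using q(1)[OF s] by linarith
  have B: "B \<ge> 0" using uB[OF s] by (meson order_trans zero_le_power2)
  have b: "E' s \<le> (2 + Q) * E s" if "0 \<le> s" "s \<le> S" for s
  proof -
    define x y where "x = v s - u s" and "y = v' s - u' s"
    have "E' s = (1 + q2 s) * (2 * x * y) + 2 * y * (\<delta> * u s)"
      using q(2)[of s] by (simp add: E'_def x_def y_def algebra_simps)
    also have "2 * y * (\<delta> * u s) \<le> y\<^sup>2 + \<delta>\<^sup>2 * B"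
      using sum_squares_bound[of y "\<delta> * u s"] mult_left_mono[OF uB[OF that], of "\<delta>\<^sup>2"]
      by (simp add: power_mult_distrib)
    also have "(1 + q2 s) * (2 * x * y) \<le> (1 + Q) * (x\<^sup>2 + y\<^sup>2)"
    proof -
      have "\<bar>2 * x * y\<bar> \<le> x\<^sup>2 + y\<^sup>2"
        using sum_squares_bound[of x y] sum_squares_bound[of "- x" y] by (auto simp: abs_le_iff)
      moreover have "\<bar>1 + q2 s\<bar> \<le> 1 + Q" using q(1)[OF that] by linarith
      ultimately have "\<bar>(1 + q2 s) * (2 * x * y)\<bar> \<le> (1 + Q) * (x\<^sup>2 + y\<^sup>2)"
        unfolding abs_mult[of "1 + q2 s"] by (intro mult_mono) auto
      then show ?thesis by linarith
    qed
    also have "(1 + Q) * (x\<^sup>2 + y\<^sup>2) + (y\<^sup>2 + \<delta>\<^sup>2 * B) \<le> (2 + Q) * (x\<^sup>2 + y\<^sup>2 + \<delta>\<^sup>2 * B)"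
    proof -
      have "0 \<le> x\<^sup>2 + (1 + Q) * (\<delta>\<^sup>2 * B)" using Q B by auto
      then show ?thesis by (simp add: algebra_simps)
    qed
    finally show ?thesis by (simp add: E_def x_def y_def)
  qed
  have "E s \<le> E 0 * exp ((2 + Q) * s)"
    by (rule gronwall_upper[OF d b s])
  moreover have "0 \<le> \<delta>\<^sup>2 * B" using B by simp
  ultimately show ?thesis using init unfolding E_def by simp
qed

lemma ode2_zero_data:
  assumes "ode2 q u u'" "\<And>s. \<bar>q s\<bar> \<le> Q" "u 0 = 0" "u' 0 = 0" "s \<ge> 0"
  shows "u s = 0"
  using energy_bounds(1)[OF assms(1), of s Q s] assms by (simp add: sum_power2_le_zero_iff)

text \<open>Since \<open>q\<close> is even, the difference of \<open>u\<close> and its signed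
  reflection solves the same equation with zero Cauchy data.\<close>

lemma ode2_parity:
  assumes u: "ode2 q u u'" and qb: "\<And>s. \<bar>q s\<bar> \<le> Q" and qe: "\<And>s. q (- s) = q s"
    and p: "parity_data m u u'"
  shows "u (- s) = (- 1) ^ m * u s"
proof -
  have "u s - (- 1) ^ m * u (- s) = 0" if "s \<ge> 0" for s
  proof (rule ode2_zero_data[OF _ qb _ _ that])
    have 1: "((\<lambda>s. u (- s)) has_real_derivative - u' (- s)) (at s)" for s
      using u unfolding ode2_def by (simp add: DERIV_mirror[symmetric])
    have 2: "((\<lambda>s. u' (- s)) has_real_derivative - (q s * u (- s))) (at s)" for s
      using u unfolding ode2_def by (metis DERIV_mirror qe)
    show "ode2 q (\<lambda>s. u s - (- 1) ^ m * u (- s)) (\<lambda>s. u' s + (- 1) ^ m * u' (- s))"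
      using u unfolding ode2_def
      by (auto intro!: derivative_eq_intros 1 2 simp: algebra_simps)
    show "u 0 - (- 1) ^ m * u (- 0) = 0" "u' 0 + (- 1) ^ m * u' (- 0) = 0"
      using p by (auto simp: parity_data_def split: if_splits)
  qed
  from this[of s] this[of "- s"] show ?thesis
    by (cases "s \<ge> 0"; cases "even m") auto
qed

subsection \<open>Existence of eigenvalues with a prescribed number of zeros\<close>

text \<open>Otherwise \<open>g\<close> would be positive somewhere after \<open>a\<close> and have a
  first zero beyond that point. Just before this zero \<open>g\<close> is negative, so the
  intermediate value theorem yields a still earlier zero.\<close>

lemma upward_crossing:
  fixes g :: "real \<Rightarrow> real"
  assumes g: "continuous_on {l..r} g"
    and right: "\<And>s. s \<in> {l..r} \<Longrightarrow> g s = 0 \<Longrightarrow> \<exists>\<delta>>0. \<forall>x\<in>{l..r}. s < x \<and> x < s + \<delta> \<longrightarrow> g x > 0"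
    and left: "\<And>s. s \<in> {l..r} \<Longrightarrow> g s = 0 \<Longrightarrow> \<exists>\<delta>>0. \<forall>x\<in>{l..r}. s - \<delta> < x \<and> x < s \<longrightarrow> g x < 0"
    and ab: "l \<le> a" "a < b" "b \<le> r" "g a \<ge> 0"
  shows "g b > 0"
proof (rule ccontr)
  assume "\<not> g b > 0"
  then have gb: "g b \<le> 0" by simp
  obtain a' where a': "a \<le> a'" "a' < b" "g a' > 0"
  proof (cases "g a = 0")
    case True
    then obtain \<delta> where \<delta>: "\<delta> > 0" "\<forall>x\<in>{l..r}. a < x \<and> x < a + \<delta> \<longrightarrow> g x > 0"
      using right[of a] ab by auto
    define x where "x = min (a + \<delta> / 2) ((a + b) / 2)"
    have "a < x" "x < a + \<delta>" "x < b" using \<delta>(1) ab by (auto simp: x_def min_def field_simps)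
    then show thesis using that[of x] \<delta>(2) ab by auto
  qed (use ab that in force)
  have cont: "continuous_on {a'..b} g"
    by (rule continuous_on_subset[OF g]) (use a' ab in auto)
  define Z where "Z = {s\<in>{a'..b}. g s = 0}"
  have "Z \<noteq> {}"
    using IVT2'[of g b 0 a'] a' gb cont by (auto simp: Z_def)
  moreover have "compact Z"
  proof -
    have "Z = {a'..b} \<inter> g -` {0}" by (auto simp: Z_def)
    then show ?thesis using continuous_closed_preimage[OF cont, of "{0}"]
      by (auto simp: compact_eq_bounded_closed intro: bounded_subset[OF bounded_closed_interval])
  qed
  ultimately obtain c where c: "c \<in> Z" "\<And>z. z \<in> Z \<Longrightarrow> c \<le> z"
    using compact_attains_inf[of Z] by blast
  have c': "a' < c" "c \<le> b" "g c = 0" using c(1) a' by (auto simp: Z_def less_le)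
  obtain \<delta> where \<delta>: "\<delta> > 0" "\<forall>x\<in>{l..r}. c - \<delta> < x \<and> x < c \<longrightarrow> g x < 0"
    using left[of c] c' a' ab by auto
  define x where "x = max (c - \<delta> / 2) ((a' + c) / 2)"
  have x: "a' < x" "x < c" "c - \<delta> < x" using \<delta>(1) c' by (auto simp: x_def max_def field_simps)
  then have "g x < 0" using \<delta>(2) a' ab c' by auto
  then have "\<exists>y\<ge>a'. y \<le> x \<and> g y = 0"
    using a' x c' by (intro IVT2') (auto intro: continuous_on_subset[OF cont])
  then obtain y where "y \<ge> a'" "y \<le> x" "g y = 0" by blast
  then have "y \<in> Z" using x c' by (auto simp: Z_def)
  then show False using c(2)[of y] \<open>y \<le> x\<close> x by simp
qed

lemma cos_int_pi_sq: "cos (of_int j * pi) * cos (of_int j * pi) = (1::real)"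
  using sin_cos_squared_add[of "of_int j * pi"] by (simp add: sin_int_times_real power2_eq_square mult.commute)

text \<open>Polar coordinates in the phase plane. Only continuity of the angle is assumed, because
  it will come from a continuous logarithm; no differential equation for it is used.\<close>

locale pruefer =
  fixes q u u' \<theta> \<rho> :: "real \<Rightarrow> real" and L :: real
  assumes u: "ode2 q u u'" and L: "L > 0" and cont: "continuous_on {0..L} \<theta>"
    and pos: "\<And>s. s \<in> {0..L} \<Longrightarrow> \<rho> s > 0"
    and u_eq: "\<And>s. s \<in> {0..L} \<Longrightarrow> u s = \<rho> s * sin (\<theta> s)"
    and u'_eq: "\<And>s. s \<in> {0..L} \<Longrightarrow> u' s = \<rho> s * cos (\<theta> s)"
begin

text \<open>At an angle \<open>J\<close>, a multiple of pi, \<open>u\<close> vanishes and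
  \<open>cos J * u'\<close> equals the radius, which is positive. Hence \<open>cos J * u\<close>
  increases through 0, and the angle passes the level upwards.\<close>

lemma level_crossing:
  assumes "0 \<le> a" "a < b" "b \<le> L" "\<theta> a \<ge> of_int j * pi"
  shows "\<theta> b > of_int j * pi"
proof -
  define J where "J = of_int j * pi"
  define v where "v s = cos J * u s" for s
  have v: "v s = \<rho> s * sin (\<theta> s - J)" if "s \<in> {0..L}" for s
    using that by (simp add: v_def u_eq sin_diff J_def sin_int_times_real mult.commute[of _ pi])
  have vd: "(v has_real_derivative cos J * u' s) (at s)" for s
    unfolding v_def using u unfolding ode2_def by (auto intro!: derivative_eq_intros)
  \<comment> \<open>Within distance pi of \<open>J\<close>, the sign of
    \<open>sin (\<theta> x - J)\<close> determines the sign of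
    \<open>\<theta> x - J\<close>.\<close>
  have near: "\<exists>\<delta>>0. \<forall>x\<in>{0..L}. \<bar>x - s\<bar> < \<delta> \<longrightarrow> \<bar>\<theta> x - J\<bar> < pi" if "s \<in> {0..L}" "\<theta> s = J" for s
    using cont that pi_gt_zero unfolding continuous_on_iff dist_real_def by metis
  have dpos: "cos J * u' s > 0" if "s \<in> {0..L}" "\<theta> s = J" for s
  proof -
    have "cos J * u' s = \<rho> s * (cos J * cos J)" using that u'_eq by simp
    then show ?thesis using pos that cos_int_pi_sq[of j] by (simp add: J_def)
  qed
  have "\<theta> b - J > 0"
  proof (rule upward_crossing[of 0 L "\<lambda>s. \<theta> s - J" a b])
    show "continuous_on {0..L} (\<lambda>s. \<theta> s - J)" by (intro continuous_intros cont)
    fix s assume s: "s \<in> {0..L}" "\<theta> s - J = 0"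
    then have s': "\<theta> s = J" by simp
    have v0: "v s = 0" using v[OF s(1)] s by simp
    obtain \<delta>1 where \<delta>1: "\<delta>1 > 0" "\<forall>x\<in>{0..L}. \<bar>x - s\<bar> < \<delta>1 \<longrightarrow> \<bar>\<theta> x - J\<bar> < pi"
      using near[OF s(1) s'] by blast
    obtain \<delta>2 where \<delta>2: "\<delta>2 > 0" "\<And>h. 0 < h \<Longrightarrow> h < \<delta>2 \<Longrightarrow> v s < v (s + h)"
      using DERIV_pos_inc_right[OF vd dpos[OF s(1) s']] by blast
    obtain \<delta>3 where \<delta>3: "\<delta>3 > 0" "\<And>h. 0 < h \<Longrightarrow> h < \<delta>3 \<Longrightarrow> v (s - h) < v s"
      using DERIV_pos_inc_left[OF vd dpos[OF s(1) s']] by blast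
    show "\<exists>\<delta>>0. \<forall>x\<in>{0..L}. s < x \<and> x < s + \<delta> \<longrightarrow> 0 < \<theta> x - J"
    proof (intro exI[of _ "min \<delta>1 \<delta>2"] conjI ballI impI)
      fix x assume x: "x \<in> {0..L}" "s < x \<and> x < s + min \<delta>1 \<delta>2"
      have "0 < v x" using \<delta>2(2)[of "x - s"] x v0 by auto
      then have "sin (\<theta> x - J) > 0" using v[OF x(1)] pos[OF x(1)] by (simp add: zero_less_mult_iff)
      moreover have "\<bar>\<theta> x - J\<bar> < pi" using \<delta>1(2) x by auto
      ultimately show "0 < \<theta> x - J"
        using sin_ge_zero[of "J - \<theta> x"] sin_minus[of "J - \<theta> x"]
        by (smt (verit, best) minus_diff_eq)
    qed (use \<delta>1 \<delta>2 in auto)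
    show "\<exists>\<delta>>0. \<forall>x\<in>{0..L}. s - \<delta> < x \<and> x < s \<longrightarrow> \<theta> x - J < 0"
    proof (intro exI[of _ "min \<delta>1 \<delta>3"] conjI ballI impI)
      fix x assume x: "x \<in> {0..L}" "s - min \<delta>1 \<delta>3 < x \<and> x < s"
      have "v x < 0" using \<delta>3(2)[of "s - x"] x v0 by auto
      then have "sin (\<theta> x - J) < 0" using v[OF x(1)] pos[OF x(1)] by (simp add: mult_less_0_iff)
      moreover have "\<bar>\<theta> x - J\<bar> < pi" using \<delta>1(2) x by auto
      ultimately show "\<theta> x - J < 0"
        using sin_ge_zero[of "\<theta> x - J"] by linarith
    qed (use \<delta>1 \<delta>3 in auto)
  qed (use assms in \<open>auto simp: J_def\<close>)
  then show ?thesis by (simp add: J_def)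
qed

lemma zero_iff: "s \<in> {0..L} \<Longrightarrow> u s = 0 \<longleftrightarrow> (\<exists>j::int. \<theta> s = of_int j * pi)"
  using pos[of s] by (simp add: u_eq sin_zero_iff_int2)

text \<open>Upward crossing makes the angle strictly increasing along the zeros and keeps it between
  the end angles; the intermediate value theorem hits every multiple in between. The zero count thus
  depends on the two end angles alone.\<close>

lemma zeros_bij:
  "bij_betw \<theta> {s\<in>{0<..<L}. u s = 0} ((\<lambda>j::int. of_int j * pi) ` {j. \<theta> 0 < of_int j * pi \<and> of_int j * pi < \<theta> L})"
  unfolding bij_betw_def
proof
  have less: "\<theta> s < \<theta> t" if "s \<in> {0<..<L}" "u s = 0" "s < t" "t \<le> L" for s t
  proof -
    have "s \<in> {0..L}" using that by auto
    then obtain j where "\<theta> s = of_int j * pi" using zero_iff[of s] \<open>u s = 0\<close> by blast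
    then show ?thesis using level_crossing[of s t j] that by auto
  qed
  show "inj_on \<theta> {s\<in>{0<..<L}. u s = 0}"
    by (intro inj_onI) (metis (mono_tags, lifting) greaterThanLessThan_iff less less_irrefl
        linorder_neqE_linordered_idom mem_Collect_eq order_less_imp_le)
  show "\<theta> ` {s\<in>{0<..<L}. u s = 0} = (\<lambda>j::int. of_int j * pi) ` {j. \<theta> 0 < of_int j * pi \<and> of_int j * pi < \<theta> L}"
  proof (intro equalityI subsetI)
    fix y assume "y \<in> \<theta> ` {s\<in>{0<..<L}. u s = 0}"
    then obtain s where s: "s \<in> {0<..<L}" "u s = 0" "y = \<theta> s" by auto
    then have "s \<in> {0..L}" by auto
    then obtain j where j: "\<theta> s = of_int j * pi" using zero_iff[of s] s by blast
    have "of_int j * pi < \<theta> L" using level_crossing[of s L j] s j by auto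
    moreover have "\<theta> 0 < of_int j * pi" using level_crossing[of 0 s j] s j by force
    ultimately show "y \<in> (\<lambda>j::int. of_int j * pi) ` {j. \<theta> 0 < of_int j * pi \<and> of_int j * pi < \<theta> L}"
      using j s by auto
  next
    fix y assume "y \<in> (\<lambda>j::int. of_int j * pi) ` {j. \<theta> 0 < of_int j * pi \<and> of_int j * pi < \<theta> L}"
    then obtain j :: int where j: "y = of_int j * pi" "\<theta> 0 < y" "y < \<theta> L" by auto
    then obtain s where s: "0 \<le> s" "s \<le> L" "\<theta> s = y"
      using IVT'[of \<theta> 0 y L] cont L by auto
    then have "s \<noteq> 0" "s \<noteq> L" using j by auto
    then have "s \<in> {0<..<L}" using s by auto
    moreover have "u s = 0" using zero_iff[of s] s j by auto
    ultimately show "y \<in> \<theta> ` {s\<in>{0<..<L}. u s = 0}" using s by auto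
  qed
qed

lemma finite_zeros: "finite {s\<in>{0<..<L}. u s = 0}"
  and card_zeros: "card {s\<in>{0<..<L}. u s = 0} = card {j::int. \<theta> 0 < of_int j * pi \<and> of_int j * pi < \<theta> L}"
proof -
  let ?J = "{j::int. \<theta> 0 < of_int j * pi \<and> of_int j * pi < \<theta> L}"
  have "?J \<subseteq> {\<lfloor>\<theta> 0 / pi\<rfloor>..\<lceil>\<theta> L / pi\<rceil>}"
  proof
    fix j assume "j \<in> ?J"
    then have "\<theta> 0 / pi < of_int j" "of_int j < \<theta> L / pi" by (auto simp: field_simps)
    then show "j \<in> {\<lfloor>\<theta> 0 / pi\<rfloor>..\<lceil>\<theta> L / pi\<rceil>}" by (auto simp: floor_le_iff le_ceiling_iff)
  qed
  then have "finite ?J" by (rule finite_subset) auto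
  then show "finite {s\<in>{0<..<L}. u s = 0}"
    using bij_betw_finite[OF zeros_bij] by simp
  have "inj_on (\<lambda>j::int. of_int j * pi) ?J" by (auto intro!: inj_onI)
  then show "card {s\<in>{0<..<L}. u s = 0} = card ?J"
    using bij_betw_same_card[OF zeros_bij] by (simp add: card_image)
qed

end

section \<open>The rescaled equation, its modes and the shooting argument\<close>

definition tvar :: "real \<Rightarrow> real \<Rightarrow> real" where
  "tvar r s = 2 * r * sin (s / r)"

definition zeros :: "real \<Rightarrow> (real \<Rightarrow> real) \<Rightarrow> real set" where
  "zeros L u = {s\<in>{0<..<L}. u s = 0}"

text \<open>\<open>dir\<close> selects the Dirichlet problem (b_(m+1)) or the Neumann problem (a_m).
  Only zeros strictly right of the centre are counted: reflection doubles \<open>m div 2\<close>,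
  and odd \<open>m\<close> adds the zero at the centre.\<close>

definition mode :: "bool \<Rightarrow> nat \<Rightarrow> real \<Rightarrow> real \<Rightarrow> (real \<Rightarrow> real) \<Rightarrow> (real \<Rightarrow> real) \<Rightarrow> bool" where
  "mode dir m r e u u' \<longleftrightarrow> ode2 (\<lambda>s. (tvar r s)\<^sup>2 - e) u u' \<and> parity_data m u u' \<and>
     (if dir then u (r * pi / 2) = 0 else u' (r * pi / 2) = 0) \<and>
     finite (zeros (r * pi / 2) u) \<and> card (zeros (r * pi / 2) u) = m div 2"

lemma tvar_bound: assumes "r > 0" shows "\<bar>tvar r s\<bar> \<le> 2 * \<bar>s\<bar>"
  using abs_sin_x_le_abs_x[of "s / r"] assms by (simp add: tvar_def abs_mult field_simps)

lemma tvar_sq_bound: "r > 0 \<Longrightarrow> (tvar r s)\<^sup>2 \<le> 4 * s\<^sup>2"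
  using power_mono[OF tvar_bound[of r s], of 2] by (simp add: power_mult_distrib)

lemma tvar_sq_bound': "(tvar r s)\<^sup>2 \<le> 4 * r\<^sup>2"
proof -
  have "(sin (s / r))\<^sup>2 \<le> 1\<^sup>2" by (subst abs_le_square_iff[symmetric]) simp
  then show ?thesis by (simp add: tvar_def power_mult_distrib mult_left_le)
qed

lemma tvar_minus: "tvar r (- s) = - tvar r s" by (simp add: tvar_def)

lemma isCont_tvar [continuous_intros]: "r \<noteq> 0 \<Longrightarrow> isCont (tvar r) s"
  unfolding tvar_def by (intro continuous_intros) auto

lemma potential_bound: "\<bar>(tvar r s)\<^sup>2 - e\<bar> \<le> 4 * r\<^sup>2 + \<bar>e\<bar>"
  using tvar_sq_bound'[of r s] zero_le_power2[of "tvar r s"] by linarith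

text \<open>Comparison with \<open>sin (\<pi> (N + 1) s)\<close> on \<open>(0, 1)\<close>.\<close>

lemma many_zeros:
  assumes r: "r \<ge> 1" and u: "ode2 (\<lambda>s. (tvar r s)\<^sup>2 - e) u u'"
    and e: "e > 4 + (pi * real (N + 1))\<^sup>2" and fin: "finite (zeros (r * pi / 2) u)"
  shows "N < card (zeros (r * pi / 2) u)"
proof -
  define w where "w = pi * real (N + 1)"
  have w: "w > 0" by (simp add: w_def)
  have v: "ode2 (\<lambda>s. - w\<^sup>2) (\<lambda>s. sin (w * s)) (\<lambda>s. w * cos (w * s))"
    unfolding ode2_def by (auto intro!: derivative_eq_intros simp: power2_eq_square)
  have eq: "{s\<in>{0<..<1}. sin (w * s) = 0} = (\<lambda>i. real i / real (N + 1)) ` {1..N}"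
  proof (intro equalityI subsetI)
    fix s assume "s \<in> {s\<in>{0<..<1}. sin (w * s) = 0}"
    then obtain j :: int where s: "0 < s" "s < 1" and j: "w * s = of_int j * pi"
      by (auto simp: sin_zero_iff_int2)
    then have j': "real (N + 1) * s = of_int j" by (simp add: w_def mult.commute)
    have "0 < real (N + 1) * s" using s by simp
    then have "0 < j" using j' by simp
    have "real (N + 1) * s < real (N + 1)" using s by simp
    then have "j < int (N + 1)" using j' by (metis of_int_less_iff of_int_of_nat_eq)
    then show "s \<in> (\<lambda>i. real i / real (N + 1)) ` {1..N}"
      using \<open>0 < j\<close> j' by (intro image_eqI[of _ _ "nat j"]) (auto simp: field_simps)
  next
    fix s assume "s \<in> (\<lambda>i. real i / real (N + 1)) ` {1..N}"
    then obtain i where i: "i \<in> {1..N}" "s = real i / real (N + 1)" by auto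
    have "w * s = real i * pi" by (simp add: i w_def)
    then show "s \<in> {s\<in>{0<..<1}. sin (w * s) = 0}" using i by auto
  qed
  have card: "card {s\<in>{0<..<1}. sin (w * s) = 0} = N"
    unfolding eq by (subst card_image) (auto intro!: inj_onI)
  have sub: "{s\<in>{0<..<1}. u s = 0} \<subseteq> zeros (r * pi / 2) u"
    using r pi_gt3 mult_mono[of 1 r 2 pi] by (auto simp: zeros_def)
  have "card {s\<in>{0<..<1}. sin (w * s) = 0} < card {s\<in>{0<..<1}. u s = 0}"
  proof (rule sturm_count[OF v u])
    fix x :: real assume x: "x \<in> {0<..<1}"
    have "(tvar r x)\<^sup>2 \<le> 4 * x\<^sup>2" using tvar_sq_bound[of r x] r by simp
    also have "\<dots> \<le> 4 * 1" using x by (intro mult_left_mono) (auto simp: power_le_one)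
    finally show "(tvar r x)\<^sup>2 - e < - w\<^sup>2" using e by (simp add: w_def)
  next
    show "finite {s\<in>{0<..<1}. sin (w * s) = 0}" unfolding eq by simp
    show "finite {s\<in>{0<..<1}. u s = 0}" using finite_subset[OF sub fin] .
    have "sin w = 0" by (simp add: w_def mult.commute sin_zero_iff_int2) (metis of_int_of_nat_eq of_nat_Suc)
    then show "sin (w * 1) = 0 \<or> sin (w * 1) * u' 1 = w * cos (w * 1) * u 1" by simp
  qed auto
  also have "\<dots> \<le> card (zeros (r * pi / 2) u)" by (rule card_mono[OF fin sub])
  finally show ?thesis using card by simp
qed

text \<open>The potential is non-negative for \<open>e \<le> 0\<close>, so \<open>u * u'\<close>
  cannot decrease from its value 0 at the centre. This gives the lower end of the shooting argument
  and forces \<open>e > 0\<close> for every mode.\<close>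

lemma no_zeros_nonpos_parameter:
  assumes r: "r \<ge> 1" and u: "ode2 (\<lambda>s. (tvar r s)\<^sup>2 - e) u u'" and p: "parity_data m u u'"
    and e: "e \<le> 0" and s: "0 < s" "s \<le> r * pi / 2"
  shows "u s > 0 \<and> u' s > 0"
proof -
  define L where "L = r * pi / 2"
  have q: "(tvar r x)\<^sup>2 - e > 0" if "0 < x" "x \<le> L" for x
  proof -
    have "0 < x / r" "x / r \<le> pi / 2" using that r by (auto simp: L_def field_simps)
    then have "sin (x / r) > 0" by (intro sin_gt_zero) (use pi_gt_zero in linarith)+
    then have "(tvar r x)\<^sup>2 > 0" using r by (simp add: tvar_def)
    then show ?thesis using e by linarith
  qed
  have du: "(u has_real_derivative u' x) (at x)" "(u' has_real_derivative ((tvar r x)\<^sup>2 - e) * u x) (at x)" for x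
    using u by (auto simp: ode2_def)
  define P where "P x = u x * u' x" for x
  have dP: "(P has_real_derivative (u' x)\<^sup>2 + ((tvar r x)\<^sup>2 - e) * (u x)\<^sup>2) (at x)" for x
    unfolding P_def by (auto intro!: derivative_eq_intros du simp: power2_eq_square)
  have mono: "P x \<le> P y" if "0 \<le> x" "x \<le> y" for x y
  proof (rule DERIV_nonneg_imp_nondecreasing[OF that(2)])
    fix z
    have "0 \<le> (tvar r z)\<^sup>2 - e" using e zero_le_power2[of "tvar r z"] by linarith
    then have "0 \<le> (u' z)\<^sup>2 + ((tvar r z)\<^sup>2 - e) * (u z)\<^sup>2" by simp
    then show "\<exists>d. (P has_real_derivative d) (at z) \<and> 0 \<le> d" using dP by blast
  qed
  have P0: "P 0 = 0" using p by (auto simp: P_def parity_data_def split: if_splits)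
  have Ppos: "P x > 0" if x: "0 < x" "x \<le> L" for x
  proof (rule ccontr)
    assume "\<not> P x > 0"
    \<comment> \<open>Monotonicity makes \<open>P\<close> vanish on \<open>(0, x)\<close>. Its
      derivative is a sum of non-negative terms, so \<open>u\<close> and \<open>u'\<close> both
      vanish at the midpoint, against the energy bound.\<close>
    then have "P y = 0" if "y \<in> {0<..<x}" for y
      using mono[of 0 y] mono[of y x] that x P0 by auto
    then have 0: "(u' (x / 2))\<^sup>2 + ((tvar r (x / 2))\<^sup>2 - e) * (u (x / 2))\<^sup>2 = 0"
      using x by (intro deriv_zero_if_zero_near[OF dP, of _ 0 x]) auto
    have qx: "(tvar r (x / 2))\<^sup>2 - e > 0" using q[of "x / 2"] x by simp
    then have "0 \<le> ((tvar r (x / 2))\<^sup>2 - e) * (u (x / 2))\<^sup>2" by simp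
    then have "((tvar r (x / 2))\<^sup>2 - e) * (u (x / 2))\<^sup>2 = 0" "(u' (x / 2))\<^sup>2 = 0"
      using 0 zero_le_power2[of "u' (x / 2)"] by linarith+
    then have "u (x / 2) = 0" "u' (x / 2) = 0" using qx by auto
    moreover have "((u 0)\<^sup>2 + (u' 0)\<^sup>2) * exp (- (1 + (4 * r\<^sup>2 + \<bar>e\<bar>)) * (x / 2)) \<le> (u (x / 2))\<^sup>2 + (u' (x / 2))\<^sup>2"
      using \<open>0 < x\<close> by (intro energy_bounds(2)[OF u potential_bound, of "x / 2" "x / 2"]) auto
    ultimately show False using p
      by (auto simp: parity_data_def mult_le_0_iff split: if_splits)
  qed
  have ne: "u x \<noteq> 0" if "0 < x" "x \<le> L" for x using Ppos[OF that] by (auto simp: P_def)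
  have sL: "s \<le> L" using s by (simp add: L_def)
  have "u s > 0"
  proof (rule ccontr)
    assume "\<not> u s > 0"
    then have neg: "\<forall>x\<in>{0<..<s}. u x < 0"
    proof -
      have "u s < 0" using \<open>\<not> u s > 0\<close> ne[of s] s sL by auto
      have "u x < 0" if "x \<in> {0<..<s}" for x
      proof (rule ccontr)
        assume "\<not> u x < 0"
        then have "\<exists>y\<ge>x. y \<le> s \<and> u y = 0"
          using that \<open>u s < 0\<close> by (intro IVT2') (auto intro: ode2_continuous_on[OF u])
        then show False using ne that sL by force
      qed
      then show ?thesis by blast
    qed
    have "- u 0 \<ge> 0"
      by (rule left_endpoint_nonneg[where a = 0 and b = s and f = "\<lambda>x. - u x"]) (use neg s ode2_isCont[OF u] in \<open>auto intro: less_imp_le\<close>)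
    moreover have "- u' 0 \<ge> 0" if "u 0 = 0"
      by (rule deriv_at_left_zero_nonneg[where a = 0 and b = s and f = "\<lambda>x. - u x"])
        (use neg s du that in \<open>auto intro!: derivative_eq_intros\<close>)
    ultimately show False using p by (auto simp: parity_data_def split: if_splits)
  qed
  moreover have "u' s > 0" using Ppos[OF s(1) sL] \<open>u s > 0\<close> by (simp add: P_def zero_less_mult_iff)
  ultimately show ?thesis by simp
qed

text \<open>Joint continuity in the parameter and in \<open>s\<close> is what the logarithm on a
  rectangle requires.\<close>

lemma continuous_on_Times_lipschitz:
  fixes g :: "real \<Rightarrow> real \<Rightarrow> real"
  assumes lip: "\<And>e e' s. e \<in> A \<Longrightarrow> e' \<in> A \<Longrightarrow> s \<in> S \<Longrightarrow> \<bar>g e' s - g e s\<bar> \<le> C * \<bar>e' - e\<bar>"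
    and cont: "\<And>e. e \<in> A \<Longrightarrow> continuous_on S (g e)"
  shows "continuous_on (A \<times> S) (\<lambda>x. g (fst x) (snd x))"
  unfolding continuous_on_def
proof
  fix x assume x: "x \<in> A \<times> S"
  define e s where "e = fst x" and "s = snd x"
  let ?F = "at x within A \<times> S"
  have fst: "(fst \<longlongrightarrow> e) ?F" and snd: "(snd \<longlongrightarrow> s) ?F"
    unfolding e_def s_def by (auto intro!: tendsto_fst tendsto_snd tendsto_ident_at)
  have "((\<lambda>y. g e (snd y)) \<longlongrightarrow> g e s) ?F"
  proof -
    have "continuous_on (A \<times> S) (\<lambda>y. g e (snd y))"
      by (rule continuous_on_compose2[OF cont]) (use x in \<open>auto simp: e_def intro!: continuous_intros\<close>)
    then show ?thesis using x by (auto simp: continuous_on_def s_def)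
  qed
  have null: "((\<lambda>y. C * \<bar>fst y - e\<bar>) \<longlongrightarrow> 0) ?F"
    using tendsto_mult[OF tendsto_const tendsto_rabs[OF tendsto_diff[OF fst tendsto_const]], of C e]
    by simp
  have "\<forall>\<^sub>F y in ?F. \<bar>g (fst y) (snd y) - g e (snd y)\<bar> \<le> C * \<bar>fst y - e\<bar>"
    using x by (auto simp: eventually_at_filter e_def intro!: lip always_eventually)
  then have "((\<lambda>y. g (fst y) (snd y) - g e (snd y)) \<longlongrightarrow> 0) ?F"
    by (intro Lim_null_comparison[OF _ null]) simp
  from tendsto_add[OF this \<open>((\<lambda>y. g e (snd y)) \<longlongrightarrow> g e s) ?F\<close>]
  show "((\<lambda>y. g (fst y) (snd y)) \<longlongrightarrow> g (fst x) (snd x)) ?F"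
    by (simp add: e_def s_def)
qed

text \<open>Shooting in \<open>e\<close>: the angle at \<open>L\<close> depends continuously on
  \<open>e\<close>, is below pi / 2 at \<open>e = 0\<close>, and exceeds \<open>(k + 1) * pi\<close>
  at \<open>e1\<close>. The intermediate value theorem produces the angle that encodes both the
  boundary condition and the number of zeros.\<close>

lemma mode_exists:
  assumes r: "r \<ge> 1"
  shows "\<exists>e u u'. mode dir m r e u u'"
proof -
  define L where "L = r * pi / 2"
  define k where "k = m div 2"
  \<comment> \<open>Above the threshold of \<open>many_zeros\<close> for \<open>N = Suc k\<close>,
    so more than \<open>k + 1\<close> zeros are forced there.\<close>
  define e1 where "e1 = 5 + (pi * real (Suc k + 1))\<^sup>2"
  have L: "L > 0" using r by (simp add: L_def)
  have e1: "e1 > 0" unfolding e1_def by (intro add_pos_nonneg) auto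
  define q where "q e s = (tvar r s)\<^sup>2 - e" for e s
  have q_eq: "q e = (\<lambda>s. (tvar r s)\<^sup>2 - e)" for e by (simp add: q_def fun_eq_iff)
  have "\<exists>u u'. ode2 (q e) u u' \<and> parity_data m u u'" for e
    unfolding q_def using r
    by (intro ode2_exists[OF _ potential_bound]) (auto intro!: continuous_intros)
  then obtain U U' where U: "\<And>e. ode2 (q e) (U e) (U' e)" and p: "\<And>e. parity_data m (U e) (U' e)"
    by metis
  define Q where "Q = 4 * r\<^sup>2 + e1"
  have qQ: "\<bar>q e s\<bar> \<le> Q" if "e \<in> {0..e1}" for e s
    using potential_bound[of r s e] that by (auto simp: q_def Q_def)
  have init: "(U e 0)\<^sup>2 + (U' e 0)\<^sup>2 = 1" for e
    using p[of e] by (auto simp: parity_data_def split: if_splits)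
  define B where "B = exp ((1 + Q) * L)"
  define C where "C = sqrt (B * exp ((2 + Q) * L))"
  have Q: "Q \<ge> 0" using qQ[of 0 0] e1 by auto
  have dep: "(U e' s - U e s)\<^sup>2 + (U' e' s - U' e s)\<^sup>2 \<le> (C * \<bar>e' - e\<bar>)\<^sup>2"
    if "e \<in> {0..e1}" "e' \<in> {0..e1}" "s \<in> {0..L}" for e e' s
  proof -
    have "(U e' s - U e s)\<^sup>2 + (U' e' s - U' e s)\<^sup>2 \<le> (e - e')\<^sup>2 * B * exp ((2 + Q) * s)"
    proof (rule parameter_dependence[OF U U])
      show "\<bar>q e' s\<bar> \<le> Q" for s using qQ that by blast
      show "q e' s - q e s = e - e'" for s by (simp add: q_def)
      show "(U e s)\<^sup>2 \<le> B" if "0 \<le> s" "s \<le> L" for s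
      proof -
        have "(U e s)\<^sup>2 + (U' e s)\<^sup>2 \<le> 1 * exp ((1 + Q) * s)"
          using energy_bounds(1)[OF U[of e], of L Q s] qQ \<open>e \<in> {0..e1}\<close> that by (simp add: init)
        also have "exp ((1 + Q) * s) \<le> B" using that Q by (simp add: B_def mult_left_mono)
        finally show ?thesis using zero_le_power2[of "U' e s"] by linarith
      qed
    qed (use p[of e] p[of e'] that in \<open>auto simp: parity_data_def split: if_splits\<close>)
    also have "\<dots> \<le> (e - e')\<^sup>2 * B * exp ((2 + Q) * L)"
      using that Q by (intro mult_left_mono) (auto simp: B_def mult_left_mono)
    also have "\<dots> = (C * \<bar>e' - e\<bar>)\<^sup>2"
      by (simp add: C_def power_mult_distrib B_def power2_commute mult_ac)
    finally show ?thesis .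
  qed
  have C: "C \<ge> 0" by (simp add: C_def B_def)
  have lip: "\<bar>U e' s - U e s\<bar> \<le> C * \<bar>e' - e\<bar>" "\<bar>U' e' s - U' e s\<bar> \<le> C * \<bar>e' - e\<bar>"
    if "e \<in> {0..e1}" "e' \<in> {0..e1}" "s \<in> {0..L}" for e e' s
  proof -
    have "(U e' s - U e s)\<^sup>2 \<le> (C * \<bar>e' - e\<bar>)\<^sup>2" "(U' e' s - U' e s)\<^sup>2 \<le> (C * \<bar>e' - e\<bar>)\<^sup>2"
      using dep[OF that] zero_le_power2[of "U e' s - U e s"] zero_le_power2[of "U' e' s - U' e s"]
      by linarith+
    then show "\<bar>U e' s - U e s\<bar> \<le> C * \<bar>e' - e\<bar>" "\<bar>U' e' s - U' e s\<bar> \<le> C * \<bar>e' - e\<bar>"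
      using C by (simp_all flip: abs_le_square_iff add: abs_mult)
  qed
  define K where "K = {0..e1} \<times> {0..L}"
  have cU: "continuous_on K (\<lambda>x. U (fst x) (snd x))" "continuous_on K (\<lambda>x. U' (fst x) (snd x))"
    unfolding K_def by (intro continuous_on_Times_lipschitz[of _ _ _ C] lip ode2_continuous_on[OF U]; assumption)+
  have nz: "(U e s)\<^sup>2 + (U' e s)\<^sup>2 > 0" if "s \<in> {0..L}" for e s
  proof -
    have "0 < 1 * exp (- (1 + (4 * r\<^sup>2 + \<bar>e\<bar>)) * s)" by simp
    also have "\<dots> \<le> (U e s)\<^sup>2 + (U' e s)\<^sup>2"
      using energy_bounds(2)[OF U[of e], of L "4 * r\<^sup>2 + \<bar>e\<bar>" s] that potential_bound[of r _ e]
      by (simp add: init q_def)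
    finally show ?thesis .
  qed
  \<comment> \<open>A continuous logarithm of \<open>u' + i u\<close> on the contractible rectangle
    gives an angle jointly continuous in \<open>(e, s)\<close>.\<close>
  obtain g where gc: "continuous_on K g"
    and g: "\<And>x. x \<in> K \<Longrightarrow> Complex (U' (fst x) (snd x)) (U (fst x) (snd x)) = exp (g x)"
  proof (rule continuous_logarithm_on_contractible)
    show "continuous_on K (\<lambda>x. Complex (U' (fst x) (snd x)) (U (fst x) (snd x)))"
      by (intro continuous_on_Complex cU)
    show "contractible K" unfolding K_def by (intro convex_imp_contractible convex_Times) auto
    show "Complex (U' (fst x) (snd x)) (U (fst x) (snd x)) \<noteq> 0" if "x \<in> K" for x
      using nz[of "snd x" "fst x"] that by (auto simp: K_def complex_eq_iff)
  qed blast
  define \<theta>i where "\<theta>i = (if even m then pi / 2 else 0)"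
  define \<rho> where "\<rho> e s = exp (Re (g (e, s)))" for e s
  \<comment> \<open>Subtracting the initial angle makes every trajectory start at
    \<open>\<theta>i\<close>. By \<open>start\<close> below, the shift has sine 0 and cosine 1, so
    the polar representation survives.\<close>
  define \<theta> where "\<theta> e s = Im (g (e, s)) - Im (g (e, 0)) + \<theta>i" for e s
  have Uexp: "U e s = \<rho> e s * sin (Im (g (e, s)))" "U' e s = \<rho> e s * cos (Im (g (e, s)))"
    if "e \<in> {0..e1}" "s \<in> {0..L}" for e s
  proof -
    have "(e, s) \<in> K" using that by (simp add: K_def)
    from g[OF this] show "U e s = \<rho> e s * sin (Im (g (e, s)))" "U' e s = \<rho> e s * cos (Im (g (e, s)))"
      by (simp_all add: complex_eq_iff Re_exp Im_exp \<rho>_def)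
  qed
  have start: "sin (\<theta>i - Im (g (e, 0))) = 0" "cos (\<theta>i - Im (g (e, 0))) = 1" if "e \<in> {0..e1}" for e
  proof -
    define b where "b = Im (g (e, 0))"
    have 1: "U e 0 = \<rho> e 0 * sin b" "U' e 0 = \<rho> e 0 * cos b" using Uexp[of e 0] that L by (auto simp: b_def)
    have "(\<rho> e 0)\<^sup>2 = (U e 0)\<^sup>2 + (U' e 0)\<^sup>2"
      unfolding 1 by (simp add: power_mult_distrib flip: distrib_left)
    then have "(\<rho> e 0)\<^sup>2 = 1\<^sup>2" by (simp add: init)
    moreover have "\<rho> e 0 > 0" by (simp add: \<rho>_def)
    ultimately have "\<rho> e 0 = 1" by (metis less_eq_real_def power2_eq_imp_eq zero_le_one)
    then have "sin b = sin \<theta>i" "cos b = cos \<theta>i"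
      using 1 p[of e] by (auto simp: parity_data_def \<theta>i_def split: if_splits)
    then show "sin (\<theta>i - Im (g (e, 0))) = 0" "cos (\<theta>i - Im (g (e, 0))) = 1"
      by (simp_all add: sin_diff cos_diff b_def flip: power2_eq_square)
  qed
  have pr: "pruefer (q e) (U e) (U' e) (\<theta> e) (\<rho> e) L" if e: "e \<in> {0..e1}" for e
  proof
    show "continuous_on {0..L} (\<theta> e)"
    proof -
      have "continuous_on {0..L} (\<lambda>s. g (e, s))"
        by (rule continuous_on_compose2[OF gc]) (use e in \<open>auto simp: K_def intro!: continuous_intros\<close>)
      then show ?thesis unfolding \<theta>_def by (intro continuous_intros)
    qed
    fix s assume s: "s \<in> {0..L}"
    have eq: "\<theta> e s = Im (g (e, s)) + (\<theta>i - Im (g (e, 0)))" by (simp add: \<theta>_def)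
    show "U e s = \<rho> e s * sin (\<theta> e s)" "U' e s = \<rho> e s * cos (\<theta> e s)"
      unfolding eq sin_add cos_add start[OF e] using Uexp[OF e s] by auto
  qed (use U L in \<open>auto simp: \<rho>_def\<close>)
  have \<theta>i: "0 \<le> \<theta>i" "\<theta>i < pi" by (auto simp: \<theta>i_def)
  have \<theta>0: "\<theta> e 0 = \<theta>i" for e by (simp add: \<theta>_def)
  have contL: "continuous_on {0..e1} (\<lambda>e. \<theta> e L)"
  proof -
    have "continuous_on {0..e1} (\<lambda>e. g (e, s))" if "s \<in> {0..L}" for s
      by (rule continuous_on_compose2[OF gc]) (use that in \<open>auto simp: K_def intro!: continuous_intros\<close>)
    then show ?thesis unfolding \<theta>_def using L by (intro continuous_intros) auto
  qed
  have low: "\<theta> 0 L < pi / 2"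
  proof -
    interpret pruefer "q 0" "U 0" "U' 0" "\<theta> 0" "\<rho> 0" L by (rule pr) (use e1 in auto)
    have UU': "U 0 s > 0 \<and> U' 0 s > 0" if "0 < s" "s \<le> L" for s
      using no_zeros_nonpos_parameter[OF r _ p, of 0 0 s] U[of 0, unfolded q_eq] that unfolding L_def by simp
    have "\<theta> 0 L < pi"
    proof (rule ccontr)
      assume "\<not> \<theta> 0 L < pi"
      then obtain s where s: "0 \<le> s" "s \<le> L" "\<theta> 0 s = pi"
        using IVT'[of "\<theta> 0" 0 pi L] cont L \<theta>i \<theta>0 by auto
      then have "s \<noteq> 0" using \<theta>0[of 0] \<theta>i by auto
      then show False using UU'[of s] s u_eq[of s] by auto
    qed
    moreover have "cos (\<theta> 0 L) > 0"
      using UU'[of L] L u'_eq[of L] pos[of L] by (auto simp: zero_less_mult_iff)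
    ultimately show ?thesis
      using sin_ge_zero[of "\<theta> 0 L - pi / 2"] by (force simp: sin_diff)
  qed
  have high: "\<theta> e1 L > real (k + 1) * pi"
  proof (rule ccontr)
    interpret pruefer "q e1" "U e1" "U' e1" "\<theta> e1" "\<rho> e1" L by (rule pr) (use e1 in auto)
    assume neg: "\<not> \<theta> e1 L > real (k + 1) * pi"
    have "{j::int. \<theta> e1 0 < of_int j * pi \<and> of_int j * pi < \<theta> e1 L} \<subseteq> {1..int k}"
    proof
      fix j :: int assume "j \<in> {j. \<theta> e1 0 < of_int j * pi \<and> of_int j * pi < \<theta> e1 L}"
      then have "0 < of_int j * pi" "of_int j * pi < real (k + 1) * pi"
        using neg \<theta>i \<theta>0[of e1] unfolding mem_Collect_eq by linarith+
      then have "0 < real_of_int j" "real_of_int j < real (k + 1)"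
        by (metis zero_less_mult_pos2 pi_gt_zero, metis mult_less_cancel_right_pos pi_gt_zero)
      then show "j \<in> {1..int k}" by auto
    qed
    from card_mono[OF _ this] have "card {s\<in>{0<..<L}. U e1 s = 0} \<le> k" unfolding card_zeros by simp
    moreover have "Suc k < card (zeros L (U e1))"
      using many_zeros[OF r, of e1 "U e1" "U' e1" "Suc k"] U[of e1, unfolded q_eq] finite_zeros
      unfolding e1_def L_def zeros_def by auto
    ultimately show False by (simp add: zeros_def)
  qed
  \<comment> \<open>Both targets lie in \<open>(k * pi, (k + 1) * pi]\<close>, so the multiples of
    pi strictly between the end angles are exactly those from 1 to \<open>k\<close>. A zero at the
    centre or at \<open>L\<close> is excluded by strictness.\<close>
  define \<tau> where "\<tau> = (if dir then real (k + 1) * pi else real k * pi + pi / 2)"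
  have \<tau>: "real k * pi < \<tau>" "\<tau> \<le> real (k + 1) * pi" "pi / 2 \<le> \<tau>" by (auto simp: \<tau>_def algebra_simps)
  obtain e where e: "0 \<le> e" "e \<le> e1" "\<theta> e L = \<tau>"
    using IVT'[of "\<lambda>e. \<theta> e L" 0 \<tau> e1] contL low high \<tau> e1 by auto
  interpret pruefer "q e" "U e" "U' e" "\<theta> e" "\<rho> e" L by (rule pr) (use e in auto)
  have "{j::int. \<theta> e 0 < of_int j * pi \<and> of_int j * pi < \<theta> e L} = {1..int k}"
  proof (intro equalityI subsetI)
    fix j :: int assume "j \<in> {j. \<theta> e 0 < of_int j * pi \<and> of_int j * pi < \<theta> e L}"
    then have "0 < of_int j * pi" "of_int j * pi < real (k + 1) * pi"
      using \<tau> e \<theta>i \<theta>0[of e] unfolding mem_Collect_eq by linarith+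
    then have "0 < real_of_int j" "real_of_int j < real (k + 1)"
      by (metis zero_less_mult_pos2 pi_gt_zero, metis mult_less_cancel_right_pos pi_gt_zero)
    then show "j \<in> {1..int k}" by auto
  next
    fix j :: int assume "j \<in> {1..int k}"
    then have "1 * pi \<le> of_int j * pi" "of_int j * pi \<le> real k * pi" by (intro mult_right_mono; simp)+
    then show "j \<in> {j. \<theta> e 0 < of_int j * pi \<and> of_int j * pi < \<theta> e L}"
      using e \<tau> \<theta>i \<theta>0[of e] unfolding mem_Collect_eq by linarith
  qed
  then have "card (zeros L (U e)) = k" using card_zeros by (simp add: zeros_def)
  moreover have "if dir then U e L = 0 else U' e L = 0"
  proof -
    have "sin (real (k + 1) * pi) = 0" by (rule sin_npi)
    moreover have "cos (real k * pi + pi / 2) = 0" by (simp add: cos_add)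
    ultimately show ?thesis using u_eq[of L] u'_eq[of L] L e(3) by (auto simp: \<tau>_def)
  qed
  ultimately have "mode dir m r e (U e) (U' e)"
    using U[of e, unfolded q_eq] p[of e] finite_zeros unfolding mode_def L_def k_def zeros_def by auto
  then show ?thesis by blast
qed

section \<open>Bounds for modes uniform in the scaling parameter\<close>

text \<open>From \<open>y * cos y \<le> sin y\<close> at \<open>y = x / 2\<close> and the half-angle
  formulas, \<open>sin x \<ge> x * (1 + cos x) / 2\<close>. The factor 1 / 2 cancels the 2 in
  \<open>tvar\<close> and yields \<open>s \<le> t\<close>.\<close>

lemma half_le_sin:
  fixes x :: real
  assumes "0 \<le> x" "x \<le> pi / 2"
  shows "x / 2 \<le> sin x"
proof -
  have "(x / 2) * cos (x / 2) \<le> sin (x / 2)"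
  proof -
    have "sin 0 - 0 * cos 0 \<le> sin (x / 2) - (x / 2) * cos (x / 2)"
    proof (rule DERIV_nonneg_imp_nondecreasing[where f = "\<lambda>y. sin y - y * cos y"])
      fix y assume "0 \<le> y" "y \<le> x / 2"
      then have "0 \<le> y * sin y" using assms by (intro mult_nonneg_nonneg sin_ge_zero) auto
      moreover have "((\<lambda>y. sin y - y * cos y) has_real_derivative y * sin y) (at y)"
        by (auto intro!: derivative_eq_intros)
      ultimately show "\<exists>d. ((\<lambda>y. sin y - y * cos y) has_real_derivative d) (at y) \<and> 0 \<le> d" by blast
    qed (use assms in auto)
    then show ?thesis by simp
  qed
  moreover have "0 \<le> cos (x / 2)" using assms by (intro cos_ge_zero) auto
  ultimately have "(x / 2 * cos (x / 2)) * cos (x / 2) \<le> sin (x / 2) * cos (x / 2)"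
    by (rule mult_right_mono)
  moreover have "sin x = 2 * (sin (x / 2) * cos (x / 2))" using sin_double[of "x / 2"] by simp
  moreover have "x * (cos (x / 2))\<^sup>2 = (x + x * cos x) / 2"
  proof -
    have "2 * (cos (x / 2))\<^sup>2 = 1 + cos x" using cos_double_cos[of "x / 2"] by simp
    then have "x * (2 * (cos (x / 2))\<^sup>2) = x * (1 + cos x)" by (simp only:)
    then show ?thesis by (simp add: algebra_simps)
  qed
  moreover have "0 \<le> x * cos x" using assms by (intro mult_nonneg_nonneg cos_ge_zero) auto
  ultimately show ?thesis by (simp add: power2_eq_square mult_ac)
qed

lemma tvar_ge: "r > 0 \<Longrightarrow> 0 \<le> s \<Longrightarrow> s \<le> r * pi / 2 \<Longrightarrow> s \<le> tvar r s"
  using half_le_sin[of "s / r"] by (simp add: tvar_def field_simps)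

lemma tvar_less: "r > 0 \<Longrightarrow> 0 \<le> x \<Longrightarrow> x < y \<Longrightarrow> y \<le> r * pi / 2 \<Longrightarrow> tvar r x < tvar r y"
  unfolding tvar_def by (intro mult_strict_left_mono sin_monotone_2pi) (auto simp: field_simps intro: order.trans)

lemma DERIV_tvar: "r \<noteq> 0 \<Longrightarrow> (tvar r has_real_derivative 2 * cos (s / r)) (at s)"
  unfolding tvar_def by (auto intro!: derivative_eq_intros)

text \<open>\<open>turn m\<close> is at once an upper bound for the parameter \<open>e\<close> (by comparison with a sine) and a point
  beyond all turning points, since \<open>t \<ge> s > e\<^sup>1\<^sup>/\<^sup>2\<close> there.\<close>

definition turn :: "nat \<Rightarrow> real" where
  "turn m = 4 + (pi * real (m div 2 + 1))\<^sup>2"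

text \<open>Bounds \<open>\<bar>t\<^sup>2 - e\<bar>\<close> up to \<open>turn m\<close>: the first
  term comes from \<open>\<bar>t\<bar> \<le> 2 * \<bar>s\<bar>\<close>, the second from
  \<open>e \<le> turn m\<close>. Neither depends on \<open>r\<close>.\<close>

definition pot_bound :: "nat \<Rightarrow> real" where
  "pot_bound m = 4 * (turn m)\<^sup>2 + turn m"

text \<open>A Gronwall factor for the energy up to \<open>turn m\<close>; its reciprocal serves as
  the lower bound.\<close>

definition mode_bound :: "nat \<Rightarrow> real" where
  "mode_bound m = exp ((2 + pot_bound m) * turn m)"

lemma turn_ge: "turn m \<ge> 4" by (simp add: turn_def)

lemma pot_bound_ge: "pot_bound m \<ge> 4"
  using turn_ge[of m] by (simp add: pot_bound_def add_increasing)

lemma mode_bound_ge: "mode_bound m \<ge> 1"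
  using turn_ge[of m] pot_bound_ge[of m] by (simp add: mode_bound_def)

text \<open>The bound on \<open>r\<close> places \<open>turn m\<close> before the end point, so the
  oscillating and decaying ranges are separated at a point independent of \<open>r\<close>.\<close>

locale eigenmode =
  fixes dir m r e u u'
  assumes mode: "mode dir m r e u u'" and r_ge: "r \<ge> turn m"
begin

definition L where "L = r * pi / 2"
definition q where "q s = (tvar r s)\<^sup>2 - e"
definition Z where "Z = zeros L u"

lemma r_pos: "r \<ge> 4" "r > 0" using r_ge turn_ge[of m] by auto

lemma ode: "ode2 q u u'" and par: "parity_data m u u'" and
  bc: "if dir then u L = 0 else u' L = 0" and finZ: "finite Z" and cardZ: "card Z = m div 2"
  using mode unfolding mode_def L_def Z_def q_def[abs_def] by auto

lemma du: "(u has_real_derivative u' s) (at s)" "(u' has_real_derivative q s * u s) (at s)"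
  using ode by (auto simp: ode2_def)

lemma turn_less_L: "turn m < L"
proof -
  have "r * 2 < r * pi" using r_pos pi_gt3 by (intro mult_strict_left_mono) auto
  then show ?thesis using r_ge by (simp add: L_def)
qed

lemma L_pos: "L > 0" using turn_less_L turn_ge[of m] by linarith

lemma e_pos: "e > 0"
proof (rule ccontr)
  assume "\<not> e > 0"
  then have "u L > 0 \<and> u' L > 0"
    using no_zeros_nonpos_parameter[of r e u u' m L] r_pos ode par L_pos
    by (auto simp: q_def[abs_def] L_def)
  then show False using bc by (auto split: if_splits)
qed

lemma e_le: "e \<le> turn m"
proof (rule ccontr)
  assume "\<not> e \<le> turn m"
  then show False
    using many_zeros[of r e u u' "m div 2"] r_pos ode finZ cardZ
    by (auto simp: q_def[abs_def] turn_def Z_def L_def)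
qed

lemma tvar_ge': "s \<in> {0..L} \<Longrightarrow> s \<le> tvar r s"
  using tvar_ge[of r s] r_pos by (auto simp: L_def)

lemma q_pos: assumes "s \<in> {turn m..L}" shows "q s > 0"
proof -
  have t: "4 \<le> turn m" "turn m \<le> s" using assms turn_ge by auto
  have "s * 1 < s * s" using t by (intro mult_strict_left_mono) auto
  also have "s * s \<le> tvar r s * tvar r s" using tvar_ge'[of s] assms t by (intro mult_mono) auto
  finally show ?thesis using e_le t by (simp add: q_def power2_eq_square)
qed

lemma q_bound: assumes "0 \<le> s" "s \<le> turn m" shows "\<bar>q s\<bar> \<le> pot_bound m"
proof -
  have "(tvar r s)\<^sup>2 \<le> 4 * s\<^sup>2" using tvar_sq_bound r_pos by simp
  also have "\<dots> \<le> 4 * (turn m)\<^sup>2" using assms by (simp add: power_mono)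
  finally show ?thesis
    using e_pos e_le zero_le_power2[of "tvar r s"] unfolding q_def pot_bound_def by linarith
qed

lemma init: "(u 0)\<^sup>2 + (u' 0)\<^sup>2 = 1"
  using par by (auto simp: parity_data_def split: if_splits)

lemma not_both_zero: assumes "s \<ge> 0" "u s = 0" shows "u' s \<noteq> 0"
proof
  assume "u' s = 0"
  have "((u 0)\<^sup>2 + (u' 0)\<^sup>2) * exp (- (1 + (4 * r\<^sup>2 + \<bar>e\<bar>)) * s) \<le> (u s)\<^sup>2 + (u' s)\<^sup>2"
    using assms by (intro energy_bounds(2)[OF ode, of s]) (auto simp: q_def intro: potential_bound)
  then show False using assms \<open>u' s = 0\<close> by (simp add: init)
qed

text \<open>The derivative \<open>u'\<^sup>2 + q * u\<^sup>2\<close> of \<open>u * u'\<close> is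
  non-negative beyond the turning point, and \<open>u * u'\<close> is 0 at \<open>L\<close> under
  either boundary condition.\<close>

lemma decaying: assumes "s \<in> {turn m..L}" shows "u s * u' s \<le> 0"
proof -
  have "u s * u' s \<le> u L * u' L"
  proof (rule DERIV_nonneg_imp_nondecreasing[where f = "\<lambda>x. u x * u' x"])
    fix x assume "s \<le> x" "x \<le> L"
    then have "0 \<le> q x" using q_pos[of x] assms by auto
    then have "0 \<le> u' x * u' x + q x * (u x * u x)" by simp
    moreover have "((\<lambda>x. u x * u' x) has_real_derivative u' x * u' x + q x * (u x * u x)) (at x)"
      by (auto intro!: derivative_eq_intros du)
    ultimately show "\<exists>y. ((\<lambda>x. u x * u' x) has_real_derivative y) (at x) \<and> 0 \<le> y" by blast
  qed (use assms in auto)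
  then show ?thesis using bc by (auto split: if_splits)
qed

lemma sq_decreasing:
  assumes "turn m \<le> x" "x \<le> y" "y \<le> L"
  shows "(u y)\<^sup>2 \<le> (u x)\<^sup>2" "(u' y)\<^sup>2 \<le> (u' x)\<^sup>2"
proof -
  show "(u y)\<^sup>2 \<le> (u x)\<^sup>2"
  proof (rule DERIV_nonpos_imp_nonincreasing[OF assms(2)])
    fix z assume "x \<le> z" "z \<le> y"
    then have "2 * (u z * u' z) \<le> 0" using decaying[of z] assms by auto
    moreover have "((\<lambda>z. (u z)\<^sup>2) has_real_derivative 2 * (u z * u' z)) (at z)"
      by (auto intro!: derivative_eq_intros du)
    ultimately show "\<exists>d. ((\<lambda>z. (u z)\<^sup>2) has_real_derivative d) (at z) \<and> d \<le> 0" by blast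
  qed
  show "(u' y)\<^sup>2 \<le> (u' x)\<^sup>2"
  proof (rule DERIV_nonpos_imp_nonincreasing[OF assms(2)])
    fix z assume "x \<le> z" "z \<le> y"
    then have "u z * u' z \<le> 0" "q z > 0" using decaying[of z] q_pos[of z] assms by auto
    then have "2 * q z * (u z * u' z) \<le> 0" using mult_nonneg_nonpos[of "2 * q z" "u z * u' z"] by simp
    moreover have "((\<lambda>z. (u' z)\<^sup>2) has_real_derivative 2 * q z * (u z * u' z)) (at z)"
      by (auto intro!: derivative_eq_intros du)
    ultimately show "\<exists>d. ((\<lambda>z. (u' z)\<^sup>2) has_real_derivative d) (at z) \<and> d \<le> 0" by blast
  qed
qed

text \<open>A zero would, by monotonicity of \<open>u\<^sup>2\<close>, make \<open>u\<close> vanish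
  on a whole interval.\<close>

lemma nonzero_beyond_turn: assumes "turn m \<le> s" "s < L" shows "u s \<noteq> 0"
proof
  assume "u s = 0"
  have u0: "u y = 0" if "s \<le> y" "y \<le> L" for y
    using sq_decreasing(1)[of s y] assms that \<open>u s = 0\<close> by simp
  define x where "x = (s + L) / 2"
  have x: "s < x" "x < L" using assms by (auto simp: x_def)
  have "u' x = 0" by (rule deriv_zero_if_zero_near[OF du(1), of _ s L]) (use x in \<open>auto intro: u0\<close>)
  moreover have "u x = 0" using x by (intro u0) auto
  ultimately show False using not_both_zero[of x] assms x turn_ge[of m] by auto
qed

lemma Z_less_turn: "z \<in> Z \<Longrightarrow> 0 < z \<and> z < turn m \<and> z < L"
  using nonzero_beyond_turn[of z] by (force simp: Z_def zeros_def)

lemma energy: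
  assumes "0 \<le> s" "s \<le> turn m"
  shows "(u s)\<^sup>2 + (u' s)\<^sup>2 \<le> mode_bound m" "1 / mode_bound m \<le> (u s)\<^sup>2 + (u' s)\<^sup>2"
proof -
  have ex: "(1 + pot_bound m) * s \<le> (2 + pot_bound m) * turn m"
    using assms pot_bound_ge[of m] by (intro mult_mono) auto
  have "(u s)\<^sup>2 + (u' s)\<^sup>2 \<le> exp ((1 + pot_bound m) * s)"
    using energy_bounds(1)[OF ode q_bound assms] by (simp add: init)
  also have "\<dots> \<le> mode_bound m" using ex by (simp add: mode_bound_def)
  finally show "(u s)\<^sup>2 + (u' s)\<^sup>2 \<le> mode_bound m" .
  have "1 / mode_bound m \<le> exp (- (1 + pot_bound m) * s)"
    using ex by (simp add: mode_bound_def exp_minus field_simps flip: exp_add)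
  also have "\<dots> \<le> (u s)\<^sup>2 + (u' s)\<^sup>2"
    using energy_bounds(2)[OF ode q_bound assms] by (simp add: init)
  finally show "1 / mode_bound m \<le> (u s)\<^sup>2 + (u' s)\<^sup>2" .
qed

lemma sq_le_mode_bound:
  assumes "s \<in> {0..L}" shows "(u s)\<^sup>2 \<le> mode_bound m" "(u' s)\<^sup>2 \<le> mode_bound m"
proof -
  have *: "(u s)\<^sup>2 \<le> mode_bound m \<and> (u' s)\<^sup>2 \<le> mode_bound m" if "0 \<le> s" "s \<le> turn m" for s
    using energy(1)[OF that] zero_le_power2[of "u s"] zero_le_power2[of "u' s"] by linarith
  show "(u s)\<^sup>2 \<le> mode_bound m" "(u' s)\<^sup>2 \<le> mode_bound m"
    using *[of s] *[of "turn m"] sq_decreasing[of "turn m" s] assms turn_ge[of m]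
    by (cases "s \<le> turn m"; force)+
qed

lemma abs_le_mode_bound:
  assumes "s \<in> {0..L}" shows "\<bar>u s\<bar> \<le> mode_bound m" "\<bar>u' s\<bar> \<le> mode_bound m"
proof -
  have "\<bar>x\<bar> \<le> mode_bound m" if "x\<^sup>2 \<le> mode_bound m" for x
  proof -
    have "mode_bound m \<le> (mode_bound m)\<^sup>2"
      using mode_bound_ge[of m] by (intro self_le_power) auto
    then have "x\<^sup>2 \<le> (mode_bound m)\<^sup>2" using that by linarith
    then have "\<bar>x\<bar> \<le> \<bar>mode_bound m\<bar>" by (simp only: abs_le_square_iff)
    then show ?thesis using mode_bound_ge[of m] by simp
  qed
  then show "\<bar>u s\<bar> \<le> mode_bound m" "\<bar>u' s\<bar> \<le> mode_bound m"
    using sq_le_mode_bound[OF assms] by auto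
qed

text \<open>A length on which the data at 0 dominate: \<open>pot_bound m * mode_bound m\<close>
  bounds both \<open>\<bar>u'\<bar>\<close> and \<open>\<bar>u''\<bar>\<close>, so over
  \<open>\<delta>\<close> neither \<open>u\<close> nor \<open>u'\<close> moves by more than 1 / 2.
  It depends on \<open>m\<close> only.\<close>

definition \<delta> where "\<delta> = 1 / (2 * (pot_bound m * mode_bound m))"

lemma \<delta>: "0 < \<delta>" "\<delta> \<le> 1 / 8" "\<delta> < turn m" "\<delta> < L"
proof -
  have "4 * 1 \<le> pot_bound m * mode_bound m"
    using pot_bound_ge[of m] mode_bound_ge[of m] by (intro mult_mono) auto
  then show "0 < \<delta>" "\<delta> \<le> 1 / 8" by (auto simp: \<delta>_def field_simps)
  then show "\<delta> < turn m" "\<delta> < L" using turn_ge[of m] turn_less_L by linarith+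
qed

text \<open>For even \<open>m\<close>, \<open>u\<close> stays above 1 / 2; for odd \<open>m\<close>,
  \<open>u'\<close> does, so \<open>u \<ge> s / 2\<close>. The factor \<open>s ^ (m mod 2)\<close>
  puts both cases into one quadratic bound.\<close>

lemma near_zero:
  assumes s: "0 \<le> s" "s \<le> \<delta>"
  shows "s\<^sup>2 / 2 \<le> s ^ (m mod 2) * u s" "s > 0 \<Longrightarrow> u s > 0"
proof -
  have rg: "x \<in> {0..L}" "x \<le> turn m" if "0 \<le> x" "x \<le> s" for x using that s \<delta> by auto
  have s1: "s \<le> 1" using s \<delta> by linarith
  have pm: "pot_bound m * mode_bound m * \<delta> = 1 / 2"
    using pot_bound_ge[of m] mode_bound_ge[of m] by (simp add: \<delta>_def field_simps)
  have ineq: "mode_bound m * s \<le> 1 / 2" "pot_bound m * mode_bound m * s \<le> 1 / 2"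
  proof -
    have "pot_bound m * mode_bound m * s \<le> pot_bound m * mode_bound m * \<delta>"
      using s pot_bound_ge[of m] mode_bound_ge[of m] by (intro mult_left_mono) auto
    then show 1: "pot_bound m * mode_bound m * s \<le> 1 / 2" using pm by simp
    have "1 * (mode_bound m * s) \<le> pot_bound m * (mode_bound m * s)"
      using s pot_bound_ge[of m] mode_bound_ge[of m] by (intro mult_right_mono) auto
    then show "mode_bound m * s \<le> 1 / 2" using 1 by (simp add: mult.assoc)
  qed
  have sq: "s\<^sup>2 \<le> 1" "s\<^sup>2 \<le> s" using s s1 by (auto simp: power_le_one) (auto simp: power2_eq_square mult_left_le)
  have "s\<^sup>2 / 2 \<le> s ^ (m mod 2) * u s \<and> (s > 0 \<longrightarrow> u s > 0)"
  proof (cases "even m")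
    case True
    have u0: "u 0 = 1" using par True by (simp add: parity_data_def)
    have "u 0 + mode_bound m * 0 \<le> u s + mode_bound m * s"
    proof (rule DERIV_nonneg_imp_nondecreasing[OF s(1)])
      fix x assume "0 \<le> x" "x \<le> s"
      then have "0 \<le> u' x + mode_bound m" using abs_le_mode_bound(2)[of x] rg by force
      moreover have "((\<lambda>x. u x + mode_bound m * x) has_real_derivative u' x + mode_bound m) (at x)"
        by (auto intro!: derivative_eq_intros du)
      ultimately show "\<exists>y. ((\<lambda>x. u x + mode_bound m * x) has_real_derivative y) (at x) \<and> 0 \<le> y" by blast
    qed
    then have "u s \<ge> 1 / 2" using u0 ineq by simp
    then show ?thesis using True sq by auto
  next
    case False
    then have 0: "u 0 = 0" "u' 0 = 1" using par by (auto simp: parity_data_def)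
    have u'1: "u' x \<ge> 1 / 2" if x: "0 \<le> x" "x \<le> s" for x
    proof -
      let ?c = "pot_bound m * mode_bound m"
      have "u' 0 + ?c * 0 \<le> u' x + ?c * x"
      proof (rule DERIV_nonneg_imp_nondecreasing[OF x(1)])
        fix y assume y: "0 \<le> y" "y \<le> x"
        have "\<bar>q y * u y\<bar> \<le> ?c"
          unfolding abs_mult using y x rg[of y] pot_bound_ge[of m]
          by (intro mult_mono q_bound abs_le_mode_bound) auto
        then have "0 \<le> q y * u y + ?c" by linarith
        moreover have "((\<lambda>x. u' x + ?c * x) has_real_derivative q y * u y + ?c) (at y)"
          by (auto intro!: derivative_eq_intros du)
        ultimately show "\<exists>z. ((\<lambda>x. u' x + ?c * x) has_real_derivative z) (at y) \<and> 0 \<le> z" by blast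
      qed
      moreover have "?c * x \<le> ?c * s"
        using x pot_bound_ge[of m] mode_bound_ge[of m] by (intro mult_left_mono) auto
      ultimately show ?thesis using 0 ineq by simp
    qed
    have "u 0 - 0 / 2 \<le> u s - s / 2"
    proof (rule DERIV_nonneg_imp_nondecreasing[OF s(1)])
      fix x assume "0 \<le> x" "x \<le> s"
      moreover have "((\<lambda>x. u x - x / 2) has_real_derivative u' x - 1 / 2) (at x)"
        by (auto intro!: derivative_eq_intros du)
      ultimately show "\<exists>y. ((\<lambda>x. u x - x / 2) has_real_derivative y) (at x) \<and> 0 \<le> y"
        using u'1[of x] by (intro exI[of _ "u' x - 1 / 2"]) auto
    qed
    then have us: "u s \<ge> s / 2" using 0 by simp
    have "s * (s / 2) \<le> s * u s" using us s by (intro mult_left_mono) auto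
    then show ?thesis using False us by (auto simp: odd_iff_mod_2_eq_one power2_eq_square)
  qed
  then show "s\<^sup>2 / 2 \<le> s ^ (m mod 2) * u s" "s > 0 \<Longrightarrow> u s > 0" by auto
qed

lemma Z_gt_\<delta>: "z \<in> Z \<Longrightarrow> \<delta> < z"
  using near_zero(2)[of z] by (force simp: Z_def zeros_def)

text \<open>The zeros are simple, so the product has constant sign, and that sign is read off at
  \<open>\<delta>\<close>, left of all zeros.\<close>

lemma sign_pattern: assumes "s \<in> {0<..<L}" shows "u s * (\<Prod>z\<in>Z. z - s) \<ge> 0"
proof -
  have flip: "(\<Prod>z\<in>Z. s - z) = (- 1) ^ card Z * (\<Prod>z\<in>Z. z - s)" for s
  proof -
    have "(\<Prod>z\<in>Z. s - z) = (\<Prod>z\<in>Z. (- 1) * (z - s))" by (intro prod.cong) auto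
    then show ?thesis by (simp only: prod.distrib prod_constant)
  qed
  have "(\<forall>x\<in>{0<..<L}. u x * (\<Prod>z\<in>Z. x - z) \<ge> 0) \<or> (\<forall>x\<in>{0<..<L}. u x * (\<Prod>z\<in>Z. x - z) \<le> 0)"
  proof (rule simple_zeros_constant_sign[OF finZ])
    show "Z = {x \<in> {0<..<L}. u x = 0}" by (simp add: Z_def zeros_def)
    then show "\<exists>d. d \<noteq> 0 \<and> (u has_real_derivative d) (at z)" if "z \<in> Z" for z
      using not_both_zero[of z] that du(1)[of z] by auto
  qed (rule ode2_continuous_on[OF ode])
  moreover have "u \<delta> * (\<Prod>z\<in>Z. z - \<delta>) > 0"
    using near_zero(2)[of \<delta>] \<delta> Z_gt_\<delta> by (intro mult_pos_pos prod_pos) auto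
  moreover have "\<delta> \<in> {0<..<L}" using \<delta> by simp
  ultimately show ?thesis
    using assms unfolding flip
    by (cases "even (card Z)") (fastforce simp: not_less[symmetric])+
qed

text \<open>All \<open>m div 2\<close> sign changes lie to the left. This is how modes for
  \<open>m\<close> and \<open>m + 2\<close> will be told apart.\<close>

lemma sign_beyond_turn:
  assumes "turn m \<le> s" "s < L"
  shows "(- 1) ^ (m div 2) * u s > 0"
proof -
  have eq: "(\<Prod>z\<in>Z. z - s) = (- 1) ^ (m div 2) * (\<Prod>z\<in>Z. s - z)"
  proof -
    have "(\<Prod>z\<in>Z. z - s) = (\<Prod>z\<in>Z. (- 1) * (s - z))" by (intro prod.cong) auto
    then show ?thesis by (simp only: prod.distrib prod_constant cardZ)
  qed
  have P: "(\<Prod>z\<in>Z. s - z) > 0" using Z_less_turn assms by (intro prod_pos) force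
  have N: "((- 1) ^ (m div 2) * u s) * (\<Prod>z\<in>Z. s - z) \<ge> 0"
    using sign_pattern[of s] turn_ge[of m] assms unfolding eq by (simp add: mult_ac)
  have "u s \<noteq> 0" using nonzero_beyond_turn assms by simp
  then have "(- 1) ^ (m div 2) * u s \<noteq> 0" by simp
  then show ?thesis using N P mult_neg_pos by (metis linorder_neqE_linordered_idom not_le)
qed

end

section \<open>Gaussian-weighted polynomials and the integration by parts\<close>

definition gauss_poly :: "real poly \<Rightarrow> real \<Rightarrow> real" where
  "gauss_poly p t = poly p t * exp (- t\<^sup>2 / 4)"

text \<open>The polynomial factor of the derivative of \<open>p * exp (- t\<^sup>2 / 4)\<close>;
  differentiation becomes algebra on polynomials.\<close>

definition gauss_pderiv :: "real poly \<Rightarrow> real poly" where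
  "gauss_pderiv p = pderiv p - [:0, 1 / 2:] * p"

lemma DERIV_gauss_poly: "(gauss_poly p has_real_derivative gauss_poly (gauss_pderiv p) t) (at t)"
  unfolding gauss_poly_def gauss_pderiv_def
  by (auto intro!: derivative_eq_intros poly_DERIV simp: algebra_simps)

lemma gauss_poly_add: "gauss_poly (p + q) t = gauss_poly p t + gauss_poly q t"
  and gauss_poly_diff: "gauss_poly (p - q) t = gauss_poly p t - gauss_poly q t"
  and gauss_poly_smult: "gauss_poly (smult c p) t = c * gauss_poly p t"
  and gauss_poly_mult: "gauss_poly (p * q) t = poly p t * gauss_poly q t"
  by (simp_all add: gauss_poly_def algebra_simps)

lemma power_le_exp:
  assumes "(x::real) \<ge> 0" shows "x ^ n \<le> real n ^ n * exp x"
proof (cases "n = 0")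
  case False
  have "x / real n \<le> exp (x / real n)"
    using exp_ge_add_one_self[of "x / real n"] by linarith
  then have "(x / real n) ^ n \<le> exp (x / real n) ^ n"
    using assms by (intro power_mono) auto
  also have "\<dots> = exp x" using False by (simp flip: exp_of_nat_mult)
  finally show ?thesis using False by (simp add: power_divide field_simps)
qed (use assms in simp)

lemma gauss_monom_bounded: "\<exists>M. \<forall>t. \<bar>t ^ n\<bar> * exp (- t\<^sup>2 / 4) \<le> (M::real)"
proof (intro exI allI)
  fix t :: real
  have 1: "\<bar>t ^ n\<bar> \<le> 1 + (t\<^sup>2) ^ n"
  proof -
    have "2 * \<bar>t ^ n\<bar> * 1 \<le> \<bar>t ^ n\<bar>\<^sup>2 + 1\<^sup>2" using sum_squares_bound[of "\<bar>t ^ n\<bar>" 1] by simp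
    then show ?thesis using abs_ge_zero[of "t ^ n"] by (simp add: power_mult[symmetric] mult.commute)
  qed
  have "(t\<^sup>2 / 4) ^ n \<le> real n ^ n * exp (t\<^sup>2 / 4)" by (rule power_le_exp) simp
  then have "(t\<^sup>2) ^ n \<le> 4 ^ n * (real n ^ n * exp (t\<^sup>2 / 4))"
    by (simp add: power_divide field_simps)
  moreover have "1 \<le> exp (t\<^sup>2 / 4)" by simp
  ultimately have "\<bar>t ^ n\<bar> \<le> (1 + 4 ^ n * real n ^ n) * exp (t\<^sup>2 / 4)"
    unfolding distrib_right mult_1 mult.assoc using 1 by linarith
  then have "\<bar>t ^ n\<bar> * exp (- t\<^sup>2 / 4) \<le> (1 + 4 ^ n * real n ^ n) * exp (t\<^sup>2 / 4) * exp (- t\<^sup>2 / 4)"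
    by (rule mult_right_mono) simp
  also have "\<dots> = 1 + 4 ^ n * real n ^ n" by (simp add: mult.assoc flip: exp_add)
  finally show "\<bar>t ^ n\<bar> * exp (- t\<^sup>2 / 4) \<le> 1 + 4 ^ n * real n ^ n" .
qed

lemma gauss_poly_bounded: "\<exists>M. \<forall>t. \<bar>gauss_poly p t\<bar> \<le> M"
proof -
  obtain M where M: "\<And>n t. \<bar>t ^ n\<bar> * exp (- t\<^sup>2 / 4) \<le> (M n :: real)"
    using gauss_monom_bounded by metis
  have "\<bar>gauss_poly p t\<bar> \<le> (\<Sum>i\<le>degree p. \<bar>coeff p i\<bar> * M i)" for t
  proof -
    have "gauss_poly p t = (\<Sum>i\<le>degree p. coeff p i * (t ^ i * exp (- t\<^sup>2 / 4)))"
      by (simp add: gauss_poly_def poly_altdef sum_distrib_right mult.assoc)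
    also have "\<bar>\<dots>\<bar> \<le> (\<Sum>i\<le>degree p. \<bar>coeff p i * (t ^ i * exp (- t\<^sup>2 / 4))\<bar>)" by (rule sum_abs)
    also have "\<dots> \<le> (\<Sum>i\<le>degree p. \<bar>coeff p i\<bar> * M i)"
      using M by (intro sum_mono) (simp add: abs_mult mult_left_mono power_abs)
    finally show ?thesis .
  qed
  then show ?thesis by blast
qed

lemma continuous_on_gauss_tvar [continuous_intros]:
  "r \<noteq> 0 \<Longrightarrow> continuous_on S (\<lambda>s. gauss_poly p (tvar r s))"
  unfolding gauss_poly_def tvar_def by (intro continuous_intros) auto

definition moment :: "real \<Rightarrow> (real \<Rightarrow> real) \<Rightarrow> real poly \<Rightarrow> real" where
  "moment r u p = integral {0..r * pi / 2} (\<lambda>s. gauss_poly p (tvar r s) * u s)"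

text \<open>A polynomial \<open>p\<close> stands for \<open>W = p exp (- t\<^sup>2 / 4)\<close>; below, \<open>oscillator\<close> is
  \<open>W'' - t\<^sup>2 W / 4\<close> and \<open>perturbation\<close> is \<open>(t\<^sup>2 W'' + t W') / 4\<close>, which enters with the factor \<open>1 / h\<close>.\<close>

definition oscillator :: "real poly \<Rightarrow> real poly" where
  "oscillator p = gauss_pderiv (gauss_pderiv p) - [:0, 0, 1 / 4:] * p"

definition perturbation :: "real poly \<Rightarrow> real poly" where
  "perturbation p = smult (1 / 4) ([:0, 0, 1:] * gauss_pderiv (gauss_pderiv p) + [:0, 1:] * gauss_pderiv p)"

text \<open>Complements the parity data: whichever of \<open>u\<close>, \<open>u'\<close> is
  non-zero at the centre is multiplied by 0 in the boundary term.\<close>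

definition vanishing_at_0 :: "nat \<Rightarrow> real poly \<Rightarrow> bool" where
  "vanishing_at_0 m p \<longleftrightarrow> (if even m then poly (pderiv p) 0 = 0 else poly p 0 = 0)"

text \<open>The quadratic potential cancels against the Gaussian, so the operator does not raise
  degrees and is triangular on monomials.\<close>

lemma oscillator_eq: "oscillator p = pderiv (pderiv p) - [:0, 1:] * pderiv p - smult (1 / 2) p"
proof (rule poly_ext)
  fix x
  have "pderiv [:0, 1 / 2:] = ([:1 / 2:] :: real poly)" by (simp add: pderiv_pCons)
  then show "poly (oscillator p) x = poly (pderiv (pderiv p) - [:0, 1:] * pderiv p - smult (1 / 2) p) x"
    by (simp add: oscillator_def gauss_pderiv_def pderiv_diff pderiv_mult pderiv_pCons pderiv_smult
        algebra_simps power2_eq_square)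
qed

context eigenmode
begin

lemma r_nz: "r \<noteq> 0" using r_pos by simp

lemma moment_integrable:
  "(\<lambda>s. gauss_poly p (tvar r s) * u s) integrable_on {a..b}"
  using r_nz
  by (intro integrable_continuous_real continuous_intros ode2_continuous_on[OF ode]) auto

lemma moment_add: "moment r u (p + p') = moment r u p + moment r u p'"
  unfolding moment_def gauss_poly_add distrib_right by (intro integral_add moment_integrable)

lemma moment_diff: "moment r u (p - p') = moment r u p - moment r u p'"
  unfolding moment_def gauss_poly_diff left_diff_distrib by (intro integral_diff moment_integrable)

lemma moment_smult: "moment r u (smult c p) = c * moment r u p"
  unfolding moment_def gauss_poly_smult mult.assoc by (rule integral_mult_right)

lemma moment_zero: "moment r u 0 = 0"
  by (simp add: moment_def gauss_poly_def)

lemma moment_sum: "moment r u (\<Sum>i\<in>A. f i) = (\<Sum>i\<in>A. moment r u (f i))"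
  by (induction A rule: infinite_finite_induct) (simp_all add: moment_zero moment_add)

text \<open>Since \<open>t \<ge> s\<close>, decay in \<open>t\<close> gives the integrable majorant
  \<open>1 / (1 + s\<^sup>2)\<close>, so the bound does not grow with \<open>L\<close>.\<close>

lemma moment_bound:
  assumes M: "\<And>t. \<bar>gauss_poly p t\<bar> * (1 + t\<^sup>2) \<le> M"
  shows "\<bar>moment r u p\<bar> \<le> 2 * M * mode_bound m"
proof -
  have M0: "M \<ge> 0" using M[of 0] abs_ge_zero[of "gauss_poly p 0"] by simp
  have at: "((\<lambda>s. 1 / (1 + s\<^sup>2)) has_integral arctan L - arctan 0) {0..L}"
    using L_pos
    by (intro fundamental_theorem_of_calculus)
      (auto intro!: derivative_eq_intros simp: divide_inverse
         simp flip: has_real_derivative_iff_has_vector_derivative)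
  have int: "((\<lambda>s. M * mode_bound m * (1 / (1 + s\<^sup>2))) has_integral M * mode_bound m * (arctan L - arctan 0)) {0..L}"
    by (rule has_integral_mult_right[OF at])
  have "norm (moment r u p) \<le> integral {0..L} (\<lambda>s. M * mode_bound m * (1 / (1 + s\<^sup>2)))"
    unfolding moment_def L_def[symmetric]
  proof (rule integral_norm_bound_integral[OF moment_integrable])
    fix s assume s: "s \<in> {0..L}"
    define t where "t = tvar r s"
    have t: "s \<le> t" using tvar_ge'[OF s] by (simp add: t_def)
    have "\<bar>gauss_poly p t\<bar> \<le> M / (1 + t\<^sup>2)"
      using M[of t] by (simp add: field_simps add_pos_nonneg)
    also have "\<dots> \<le> M / (1 + s\<^sup>2)"
      using s t M0 by (intro divide_left_mono add_left_mono power_mono mult_pos_pos add_pos_nonneg) auto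
    finally have "\<bar>gauss_poly p t\<bar> * \<bar>u s\<bar> \<le> M / (1 + s\<^sup>2) * mode_bound m"
      using abs_le_mode_bound(1)[OF s] M0 by (intro mult_mono) auto
    then show "norm (gauss_poly p (tvar r s) * u s) \<le> M * mode_bound m * (1 / (1 + s\<^sup>2))"
      by (simp add: abs_mult t_def)
  qed (use int in \<open>auto simp: integrable_on_def\<close>)
  also have "\<dots> = M * mode_bound m * arctan L" using integral_unique[OF int] by simp
  also have "\<dots> \<le> M * mode_bound m * 2"
    using arctan_ubound[of L] pi_less_4 M0 mode_bound_ge[of m] by (intro mult_left_mono) auto
  finally show ?thesis by (simp add: mult_ac)
qed

text \<open>Lagrange's identity for \<open>u\<close> and \<open>W(t(s))\<close>. As
  \<open>(dt / ds)\<^sup>2 = 4 - t\<^sup>2 / h\<close> and the second derivative of \<open>t\<close>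
  is \<open>- t / h\<close>, the chain rule splits into four times the oscillator part and a
  remainder carrying the factor \<open>1 / h\<close>.\<close>

lemma pairing:
  assumes "vanishing_at_0 m p"
  shows "moment r u (oscillator p) + e / 4 * moment r u p =
     moment r u (perturbation p) / r\<^sup>2 - gauss_poly p (2 * r) * u' L / 4"
proof -
  define g1 where "g1 = gauss_poly (gauss_pderiv p)"
  define g2 where "g2 = gauss_poly (gauss_pderiv (gauss_pderiv p))"
  define t where "t = tvar r"
  have dt: "(t has_real_derivative 2 * cos (s / r)) (at s)" for s
    unfolding t_def by (rule DERIV_tvar[OF r_nz])
  have dg: "((\<lambda>s. gauss_poly p (t s)) has_real_derivative g1 (t s) * (2 * cos (s / r))) (at s)"
    "((\<lambda>s. g1 (t s)) has_real_derivative g2 (t s) * (2 * cos (s / r))) (at s)" for s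
    unfolding g1_def g2_def by (rule DERIV_chain2[OF DERIV_gauss_poly dt])+
  define \<Phi> where "\<Phi> s = 2 * cos (s / r) * g1 (t s) * u s - gauss_poly p (t s) * u' s" for s
  define F where "F s = gauss_poly (oscillator p) (t s) * u s + e / 4 * (gauss_poly p (t s) * u s)
      - gauss_poly (perturbation p) (t s) * u s / r\<^sup>2" for s
  have d\<Phi>: "(\<Phi> has_real_derivative 4 * F s) (at s)" for s
  proof -
    have "(\<Phi> has_real_derivative
        (- (2 / r * sin (s / r)) * g1 (t s) + (2 * cos (s / r))\<^sup>2 * g2 (t s) - gauss_poly p (t s) * q s) * u s) (at s)"
      unfolding \<Phi>_def
      by (auto intro!: derivative_eq_intros dg du simp: algebra_simps power2_eq_square r_nz)
    moreover have "2 / r * sin (s / r) = t s / r\<^sup>2"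
      using r_nz by (simp add: t_def tvar_def power2_eq_square)
    moreover have "(2 * cos (s / r))\<^sup>2 = 4 - (t s)\<^sup>2 / r\<^sup>2"
      using r_nz by (simp add: t_def tvar_def power_mult_distrib cos_squared_eq)
    moreover have "(- (t s / r\<^sup>2) * g1 (t s) + (4 - (t s)\<^sup>2 / r\<^sup>2) * g2 (t s) - gauss_poly p (t s) * q s) * u s = 4 * F s"
      using r_nz by (simp add: F_def oscillator_def perturbation_def gauss_poly_def
          g1_def g2_def q_def t_def field_simps power2_eq_square)
    ultimately show ?thesis by (simp only:)
  qed
  have "((\<lambda>s. 4 * F s) has_integral \<Phi> L - \<Phi> 0) {0..L}"
    using L_pos d\<Phi> by (intro fundamental_theorem_of_calculus)
      (auto intro: has_field_derivative_at_within simp flip: has_real_derivative_iff_has_vector_derivative)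
  then have "4 * integral {0..L} F = \<Phi> L - \<Phi> 0"
    by (simp add: integral_unique flip: integral_mult_right)
  moreover have "integral {0..L} F = moment r u (oscillator p) + e / 4 * moment r u p - moment r u (perturbation p) / r\<^sup>2"
    unfolding F_def moment_def L_def[symmetric] t_def
    using moment_integrable[of _ 0 L]
    by (simp add: integral_diff integral_add integrable_add integrable_on_mult_right integrable_on_divide)
  moreover have "\<Phi> 0 = 0"
  proof (cases "even m")
    case True
    then have "poly (gauss_pderiv p) 0 = 0" "u' 0 = 0"
      using assms par by (auto simp: vanishing_at_0_def gauss_pderiv_def parity_data_def)
    then show ?thesis by (simp add: \<Phi>_def g1_def t_def tvar_def gauss_poly_def)
  next
    case False
    then have "poly p 0 = 0" "u 0 = 0"
      using assms par by (auto simp: vanishing_at_0_def parity_data_def)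
    then show ?thesis by (simp add: \<Phi>_def t_def tvar_def gauss_poly_def)
  qed
  \<comment> \<open>Here \<open>cos (L / r) = 0\<close> removes the term with \<open>u L\<close>, so
    both boundary conditions are treated alike.\<close>
  moreover have "\<Phi> L = - (gauss_poly p (2 * r) * u' L)"
  proof -
    have "L / r = pi / 2" using r_nz by (simp add: L_def)
    then have "cos (L / r) = 0" "sin (L / r) = 1" by (simp_all only: cos_pi_half sin_pi_half)
    then show ?thesis by (simp add: \<Phi>_def t_def tvar_def)
  qed
  ultimately show ?thesis by simp
qed

definition node_poly :: "real poly" where
  "node_poly = monom 1 (m mod 2) * (\<Prod>z\<in>Z. [:- (tvar r z)\<^sup>2, 0, 1:])"

text \<open>Minimum of the integrand on \<open>[\<delta> / 8, \<delta> / 4]\<close> times the length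
  \<open>\<delta> / 8\<close>. There \<open>t \<le> \<delta> / 2\<close>, so the Gaussian exceeds
  \<open>exp (- 1)\<close>, \<open>near_zero\<close> gives \<open>\<delta>\<^sup>2 / 128\<close>,
  and each node, having \<open>t \<ge> \<delta>\<close>, contributes a factor of at least
  \<open>\<delta>\<^sup>2 / 2\<close>.\<close>

definition moment_low :: real where
  "moment_low = exp (- 1) * (\<delta>\<^sup>2 / 128) * (\<delta>\<^sup>2 / 2) ^ (m div 2) * (\<delta> / 8)"

lemma moment_low_pos: "moment_low > 0"
  using \<delta>(1) by (simp add: moment_low_def)

lemma node_poly_moment: "moment_low \<le> \<bar>moment r u node_poly\<bar>"
proof -
  define \<sigma> :: real where "\<sigma> = (- 1) ^ card Z"
  define F where "F s = \<sigma> * (gauss_poly node_poly (tvar r s) * u s)" for s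
  have F: "F s = exp (- (tvar r s)\<^sup>2 / 4) * (tvar r s ^ (m mod 2) * u s) * (\<Prod>z\<in>Z. (tvar r z)\<^sup>2 - (tvar r s)\<^sup>2)" for s
  proof -
    have "(\<Prod>z\<in>Z. (tvar r z)\<^sup>2 - (tvar r s)\<^sup>2) = (\<Prod>z\<in>Z. (- 1) * ((tvar r s)\<^sup>2 - (tvar r z)\<^sup>2))"
      by (intro prod.cong) auto
    also have "\<dots> = \<sigma> * (\<Prod>z\<in>Z. (tvar r s)\<^sup>2 - (tvar r z)\<^sup>2)"
      by (simp only: prod.distrib prod_constant \<sigma>_def)
    finally show ?thesis
      by (simp add: F_def node_poly_def gauss_poly_def poly_prod poly_monom power2_eq_square mult_ac)
  qed
  have cont: "continuous_on S F" for S
    unfolding F_def using r_nz by (intro continuous_intros ode2_continuous_on[OF ode]) auto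
  have contF: "isCont F s" for s using cont[of UNIV] by (simp add: continuous_on_eq_continuous_at)
  have nonneg: "F s \<ge> 0" if s: "s \<in> {0<..<L}" for s
  proof (cases "s \<in> Z")
    case True
    then show ?thesis by (auto simp: F_def Z_def zeros_def)
  next
    case False
    have pos: "tvar r x > 0" if "x \<in> {0<..<L}" for x using tvar_ge'[of x] that by auto
    \<comment> \<open>As \<open>t\<close> is positive and increasing, these quotients are positive;
      they exchange the factors in \<open>t\<^sup>2\<close> for the factors \<open>z - s\<close> of
      \<open>sign_pattern\<close>.\<close>
    define \<rho> where "\<rho> z = ((tvar r z)\<^sup>2 - (tvar r s)\<^sup>2) / (z - s)" for z
    have \<rho>: "\<rho> z > 0" if "z \<in> Z" for z
    proof (cases "z < s")
      case True
      then have "tvar r z < tvar r s" using tvar_less[of r z s] r_pos that s Z_less_turn[OF that] by (auto simp: L_def)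
      then have "(tvar r z)\<^sup>2 < (tvar r s)\<^sup>2"
        using pos[of z] Z_less_turn[OF that] by (intro power_strict_mono) auto
      then show ?thesis using True by (auto simp: \<rho>_def intro: divide_neg_neg)
    next
      case False
      then have "s < z" using that \<open>s \<notin> Z\<close> by (metis linorder_neqE_linordered_idom)
      then have "tvar r s < tvar r z" using tvar_less[of r s z] r_pos that s Z_less_turn[OF that] by (auto simp: L_def)
      then have "(tvar r s)\<^sup>2 < (tvar r z)\<^sup>2"
        using pos[of s] s by (intro power_strict_mono) auto
      then show ?thesis using \<open>s < z\<close> by (auto simp: \<rho>_def)
    qed
    have "(\<Prod>z\<in>Z. (tvar r z)\<^sup>2 - (tvar r s)\<^sup>2) = (\<Prod>z\<in>Z. (z - s) * \<rho> z)"
      using False by (intro prod.cong) (auto simp: \<rho>_def)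
    then have "F s = (exp (- (tvar r s)\<^sup>2 / 4) * tvar r s ^ (m mod 2) * (\<Prod>z\<in>Z. \<rho> z)) * (u s * (\<Prod>z\<in>Z. z - s))"
      unfolding F by (simp add: prod.distrib mult_ac)
    moreover have "(\<Prod>z\<in>Z. \<rho> z) \<ge> 0" using \<rho> by (intro prod_nonneg) (auto intro: less_imp_le)
    ultimately show ?thesis using sign_pattern[OF s] pos[OF s] by simp
  qed
  have nonneg': "F s \<ge> 0" if "s \<in> {0..L}" for s
    using nonneg left_endpoint_nonneg[OF contF[of 0] nonneg L_pos] right_endpoint_nonneg[OF contF[of L] nonneg L_pos]
      that by (cases "s = 0 \<or> s = L") auto
  define c where "c = exp (- 1) * (\<delta>\<^sup>2 / 128) * (\<delta>\<^sup>2 / 2) ^ (m div 2)"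
  have low: "c \<le> F s" if s: "s \<in> {\<delta> / 8..\<delta> / 4}" for s
  proof -
    have sL: "s \<in> {0..L}" "0 < s" using s \<delta> by auto
    define t where "t = tvar r s"
    have ts: "s \<le> t" "t \<le> 2 * s" using tvar_ge'[OF sL(1)] tvar_bound[of r s] r_pos sL by (auto simp: t_def)
    have t: "0 \<le> t" "t \<le> \<delta> / 2" using ts s sL by auto
    have t2: "t\<^sup>2 \<le> (\<delta> / 2)\<^sup>2" using t by (intro power_mono) auto
    have "(\<delta> / 2)\<^sup>2 \<le> 1\<^sup>2" using \<delta> by (intro power_mono) auto
    then have ex: "exp (- 1) \<le> exp (- t\<^sup>2 / 4)" using t2 by simp
    have "\<delta>\<^sup>2 / 128 \<le> s\<^sup>2 / 2" using power_mono[of "\<delta> / 8" s 2] s \<delta> by (simp add: power_divide)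
    also have "\<dots> \<le> s ^ (m mod 2) * u s" using near_zero(1)[of s] s \<delta> by auto
    also have "\<dots> \<le> t ^ (m mod 2) * u s"
      using ts sL near_zero(2)[of s] s \<delta> by (intro mult_right_mono power_mono) auto
    finally have tu: "\<delta>\<^sup>2 / 128 \<le> t ^ (m mod 2) * u s" .
    have "(\<delta>\<^sup>2 / 2) ^ card Z = (\<Prod>z\<in>Z. \<delta>\<^sup>2 / 2)" by simp
    also have "\<dots> \<le> (\<Prod>z\<in>Z. (tvar r z)\<^sup>2 - t\<^sup>2)"
    proof (intro prod_mono conjI)
      fix z assume z: "z \<in> Z"
      have "\<delta> \<le> tvar r z" using Z_gt_\<delta>[OF z] tvar_ge'[of z] Z_less_turn[OF z] by auto
      then have "\<delta>\<^sup>2 \<le> (tvar r z)\<^sup>2" using \<delta> by (intro power_mono) auto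
      moreover have "(\<delta> / 2)\<^sup>2 = \<delta>\<^sup>2 / 4" by (simp add: power_divide)
      ultimately show "\<delta>\<^sup>2 / 2 \<le> (tvar r z)\<^sup>2 - t\<^sup>2" using t2 zero_le_power2[of \<delta>] by linarith
    qed auto
    finally have pr: "(\<delta>\<^sup>2 / 2) ^ (m div 2) \<le> (\<Prod>z\<in>Z. (tvar r z)\<^sup>2 - t\<^sup>2)" by (simp add: cardZ)
    have "0 \<le> \<delta>\<^sup>2 / 128" by simp
    then have "0 \<le> t ^ (m mod 2) * u s" using tu by linarith
    then have tu0: "0 \<le> exp (- t\<^sup>2 / 4) * (t ^ (m mod 2) * u s)" by (rule mult_nonneg_nonneg[OF exp_ge_zero])
    show ?thesis
      unfolding c_def F t_def[symmetric] 
      by (rule mult_mono[OF mult_mono[OF ex tu] pr]) (use tu0 in \<open>assumption | simp\<close>)+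
  qed
  have "c * (\<delta> / 8) = integral {\<delta> / 8..\<delta> / 4} (\<lambda>s. c)" using \<delta> by (simp add: mult.commute)
  also have "\<dots> \<le> integral {\<delta> / 8..\<delta> / 4} F"
    by (intro integral_le integrable_continuous_real cont low) auto
  also have "\<dots> \<le> integral {0..L} F"
    using \<delta> nonneg' by (intro integral_subset_le integrable_continuous_real cont) auto
  also have "\<dots> = \<sigma> * moment r u node_poly"
    unfolding F_def moment_def L_def[symmetric] by (rule integral_mult_right)
  also have "\<dots> \<le> \<bar>\<sigma> * moment r u node_poly\<bar>" by (rule abs_ge_self)
  also have "\<dots> = \<bar>moment r u node_poly\<bar>" by (simp add: \<sigma>_def abs_mult power_abs)
  finally show ?thesis by (simp add: moment_low_def c_def)
qed

end

subsection \<open>Spectral gap between modes of equal parity\<close>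

lemma turn_mono: "turn m \<le> turn (m + 2)"
  unfolding turn_def by (intro add_left_mono power_mono mult_left_mono) auto

text \<open>Beyond the turning points \<open>u1 * u2 \<le> 0\<close> and
  \<open>u1' * u2' \<le> 0\<close>, so the phase vectors are at least as far apart as the second is
  long. By \<open>parameter_dependence\<close>, their distance is at most a constant times the
  parameter difference; Sturm comparison fixes the order.\<close>

lemma mode_gap:
  "\<exists>c>0. \<forall>dir r e1 u1 u1' e2 u2 u2'. eigenmode dir m r e1 u1 u1' \<longrightarrow>
     eigenmode dir (m + 2) r e2 u2 u2' \<longrightarrow> e1 + c \<le> e2"
proof -
  define T where "T = turn (m + 2)"
  define E where "E = mode_bound m * exp ((2 + pot_bound (m + 2)) * T)"
  \<comment> \<open>Solves \<open>c\<^sup>2 * E = 1 / mode_bound (m + 2)\<close>, the balance of the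
    upper and lower bounds at \<open>T\<close>.\<close>
  define c where "c = 1 / sqrt (mode_bound (m + 2) * E)"
  have E: "E > 0" using mode_bound_ge[of m] by (simp add: E_def)
  have c: "c > 0" using E mode_bound_ge[of "m + 2"] by (simp add: c_def)
  have "e1 + c \<le> e2"
    if 1: "eigenmode dir m r e1 u1 u1'" and 2: "eigenmode dir (m + 2) r e2 u2 u2'"
    for dir r e1 u1 u1' e2 u2 u2'
  proof -
    interpret A: eigenmode dir m r e1 u1 u1' by (rule 1)
    interpret B: eigenmode dir "m + 2" r e2 u2 u2' by (rule 2)
    have T: "turn m \<le> T" "T < A.L" "0 \<le> T"
      using turn_mono B.turn_less_L turn_ge[of "m + 2"] by (auto simp: T_def)
    have init: "u1 0 = u2 0" "u1' 0 = u2' 0"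
      using A.par B.par by (auto simp: parity_data_def split: if_splits)
    have ord: "e1 \<le> e2"
    proof (rule ccontr)
      assume "\<not> e1 \<le> e2"
      then have "card {x\<in>{0<..<A.L}. u2 x = 0} < card {x\<in>{0<..<A.L}. u1 x = 0}"
        using A.bc B.bc A.finZ B.finZ init
        by (intro sturm_count[OF B.ode A.ode A.L_pos])
          (auto simp: A.q_def B.q_def A.Z_def B.Z_def zeros_def split: if_splits)
      then show False using A.cardZ B.cardZ by (simp add: A.Z_def B.Z_def zeros_def)
    qed
    have "(u2 T - u1 T)\<^sup>2 + (u2' T - u1' T)\<^sup>2 \<le> (e1 - e2)\<^sup>2 * mode_bound m * exp ((2 + pot_bound (m + 2)) * T)"
    proof (rule parameter_dependence[OF A.ode B.ode])
      show "\<bar>B.q s\<bar> \<le> pot_bound (m + 2)" if "0 \<le> s" "s \<le> T" for s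
        using B.q_bound that by (simp add: T_def)
      show "(u1 s)\<^sup>2 \<le> mode_bound m" if "0 \<le> s" "s \<le> T" for s
        using A.sq_le_mode_bound(1)[of s] that T by auto
    qed (use init T in \<open>auto simp: A.q_def B.q_def\<close>)
    then have up: "(u2 T - u1 T)\<^sup>2 + (u2' T - u1' T)\<^sup>2 \<le> (e1 - e2)\<^sup>2 * E" by (simp add: E_def mult.assoc)
    define \<sigma> :: real where "\<sigma> = (- 1) ^ (m div 2)"
    have \<sigma>: "\<sigma> * \<sigma> = 1" by (simp add: \<sigma>_def flip: power_mult_distrib)
    have s1: "\<sigma> * u1 T > 0" using A.sign_beyond_turn[of T] T by (simp add: \<sigma>_def)
    have s2: "\<sigma> * u2 T < 0" using B.sign_beyond_turn[of T] T by (simp add: \<sigma>_def T_def)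
    have d1: "u1 T * u1' T \<le> 0" using A.decaying[of T] T by auto
    have d2: "u2 T * u2' T \<le> 0" using B.decaying[of T] T by (auto simp: T_def)
    have \<sigma>2: "(\<sigma> * x) * (\<sigma> * y) = x * y" for x y
      using \<sigma> by (metis mult.assoc mult.commute mult_1)
    have s1': "\<sigma> * u1' T \<le> 0" using d1 s1 mult_pos_pos by (metis \<sigma>2 not_le)
    have s2': "\<sigma> * u2' T \<ge> 0" using d2 s2 mult_neg_neg by (metis \<sigma>2 not_le)
    have p1: "u1 T * u2 T \<le> 0" using mult_nonneg_nonpos[OF less_imp_le[OF s1] less_imp_le[OF s2]] by (simp only: \<sigma>2)
    have p2: "u1' T * u2' T \<le> 0" using mult_nonpos_nonneg[OF s1' s2'] by (simp only: \<sigma>2)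
    have "1 / mode_bound (m + 2) \<le> (u2 T)\<^sup>2 + (u2' T)\<^sup>2" using B.energy(2)[of T] T by (simp add: T_def)
    also have "\<dots> \<le> (u2 T - u1 T)\<^sup>2 + (u2' T - u1' T)\<^sup>2"
      using p1 p2 zero_le_power2[of "u1 T"] zero_le_power2[of "u1' T"]
      by (simp add: power2_diff mult.commute)
    finally have "1 / mode_bound (m + 2) \<le> (e1 - e2)\<^sup>2 * E" using up by linarith
    then have "1 / mode_bound (m + 2) / E \<le> (e1 - e2)\<^sup>2" by (simp only: pos_divide_le_eq[OF E])
    moreover have "c\<^sup>2 = 1 / mode_bound (m + 2) / E"
      using E mode_bound_ge[of "m + 2"] by (simp add: c_def power_divide)
    ultimately have "c\<^sup>2 \<le> (e2 - e1)\<^sup>2" by (simp only: power2_commute[of e2 e1])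
    then have "c \<le> e2 - e1" by (rule power2_le_imp_le) (use ord in simp)
    then show ?thesis by simp
  qed
  then show ?thesis using c by blast
qed

subsection \<open>Hermite polynomials\<close>

text \<open>The polynomials He_m by the raising operator: with the Gaussian factor it reads D_(m+1)
  = t D_m / 2 - D_m'.\<close>

fun hermite :: "nat \<Rightarrow> real poly" where
  "hermite 0 = 1"
| "hermite (Suc m) = [:0, 1:] * hermite m - pderiv (hermite m)"

lemma hermite_ode:
  "pderiv (pderiv (hermite m)) = [:0, 1:] * pderiv (hermite m) - smult (real m) (hermite m)"
proof (induction m)
  case (Suc m)
  have X: "pderiv [:0, 1:] = (1 :: real poly)" by (simp add: pderiv_pCons)
  \<comment> \<open>The equation at \<open>m\<close> turns the raising rule into the lowering
    rule.\<close>
  have d: "pderiv (hermite (Suc m)) = smult (real (Suc m)) (hermite m)"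
    using Suc by (simp add: pderiv_diff pderiv_mult X smult_add_left del: mult_pCons_left)
  have "pderiv (pderiv (hermite (Suc m))) = smult (real (Suc m)) (pderiv (hermite m))"
    unfolding d by (rule pderiv_smult)
  also have "\<dots> = [:0, 1:] * smult (real (Suc m)) (hermite m) - smult (real (Suc m)) (hermite (Suc m))"
    by (simp add: smult_diff_right)
  finally show ?case unfolding d by simp
qed simp

text \<open>D_m is an eigenfunction of the harmonic oscillator; the eigenvalue is the origin of
  \<mu>_0.\<close>

lemma oscillator_hermite: "oscillator (hermite m) = - smult (real m + 1 / 2) (hermite m)"
  unfolding oscillator_eq hermite_ode by (simp add: smult_add_left)

lemma hermite_coeff: "coeff (hermite m) m = 1 \<and> (\<forall>i>m. coeff (hermite m) i = 0) \<and>
    (\<forall>i. even i \<noteq> even m \<longrightarrow> coeff (hermite m) i = 0)"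
proof (induction m)
  case 0 then show ?case by (auto simp: coeff_1 intro: odd_pos)
next
  case (Suc m)
  have c: "coeff (hermite (Suc m)) i = (case i of 0 \<Rightarrow> 0 | Suc j \<Rightarrow> coeff (hermite m) j)
      - real (Suc i) * coeff (hermite m) (Suc i)" for i
    by (cases i) (simp_all add: coeff_pderiv)
  have "coeff (hermite (Suc m)) i = 0" if "even i \<noteq> even (Suc m)" for i
    unfolding c using Suc that by (cases i) auto
  moreover have "coeff (hermite (Suc m)) i = 0" if "i > Suc m" for i
    unfolding c using Suc that by (cases i) auto
  moreover have "coeff (hermite (Suc m)) (Suc m) = 1" unfolding c using Suc by auto
  ultimately show ?case by blast
qed

lemma vanishing_at_0_iff_coeff: "vanishing_at_0 m p \<longleftrightarrow> (if even m then coeff p 1 = 0 else coeff p 0 = 0)"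
  by (auto simp: vanishing_at_0_def poly_0_coeff_0 coeff_pderiv)

subsection \<open>Moments of modes\<close>

lemma moment_bounded:
  "\<exists>C\<ge>0. \<forall>dir r e u u'. eigenmode dir m r e u u' \<longrightarrow> \<bar>moment r u p\<bar> \<le> C"
proof -
  obtain M where M: "\<And>t. \<bar>gauss_poly ([:1, 0, 1:] * p) t\<bar> \<le> M" using gauss_poly_bounded by blast
  have M': "\<bar>gauss_poly p t\<bar> * (1 + t\<^sup>2) \<le> M" for t
  proof -
    have "\<bar>gauss_poly ([:1, 0, 1:] * p) t\<bar> = \<bar>poly [:1, 0, 1:] t\<bar> * \<bar>gauss_poly p t\<bar>"
      by (simp only: gauss_poly_mult abs_mult)
    also have "poly [:1, 0, 1:] t = 1 + t\<^sup>2" by (simp add: power2_eq_square)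
    also have "\<bar>1 + t\<^sup>2\<bar> = 1 + t\<^sup>2" by (simp add: add_nonneg_nonneg)
    finally show ?thesis using M[of t] by (simp only: mult.commute)
  qed
  have "0 \<le> M" using M[of 0] by linarith
  then have "0 \<le> 2 * M * mode_bound m" using mode_bound_ge[of m] by simp
  then show ?thesis using eigenmode.moment_bound[OF _ M'] by blast
qed

text \<open>The Gaussian at \<open>t = 2 * r\<close> beats every power of \<open>h\<close>;
  multiplying by \<open>t ^ (2 * N)\<close> before bounding makes the chosen power explicit.\<close>

lemma boundary_bounded:
  "\<exists>C\<ge>0. \<forall>dir r e u u'. eigenmode dir m r e u u' \<longrightarrow>
     \<bar>gauss_poly p (2 * r) * u' (r * pi / 2) / 4\<bar> \<le> C * (1 / r\<^sup>2) ^ N"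
proof -
  obtain M where M: "\<And>t. \<bar>gauss_poly (monom 1 (2 * N) * p) t\<bar> \<le> M" using gauss_poly_bounded by blast
  have M0: "0 \<le> M" using M[of 0] by linarith
  have "\<bar>gauss_poly p (2 * r) * u' (r * pi / 2) / 4\<bar> \<le> (M * mode_bound m) * (1 / r\<^sup>2) ^ N"
    if "eigenmode dir m r e u u'" for dir r e u u'
  proof -
    interpret eigenmode dir m r e u u' by (rule that)
    have rN: "(r\<^sup>2) ^ N > 0" using r_pos by simp
    have "(r\<^sup>2) ^ N \<le> (2 * r) ^ (2 * N)" using r_pos by (simp add: power_mult power_mono)
    then have "(r\<^sup>2) ^ N * \<bar>gauss_poly p (2 * r)\<bar> \<le> (2 * r) ^ (2 * N) * \<bar>gauss_poly p (2 * r)\<bar>"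
      by (rule mult_right_mono) simp
    also have "\<dots> = \<bar>gauss_poly (monom 1 (2 * N) * p) (2 * r)\<bar>"
      using r_pos by (simp add: gauss_poly_mult poly_monom abs_mult)
    also have "\<dots> \<le> M" by (rule M)
    finally have 1: "\<bar>gauss_poly p (2 * r)\<bar> \<le> M * (1 / r\<^sup>2) ^ N"
      using rN by (simp add: field_simps)
    have 2: "\<bar>u' (r * pi / 2)\<bar> \<le> mode_bound m"
      using abs_le_mode_bound(2)[of L] L_pos by (simp add: L_def)
    have "\<bar>gauss_poly p (2 * r)\<bar> * \<bar>u' (r * pi / 2)\<bar> \<le> (M * (1 / r\<^sup>2) ^ N) * mode_bound m"
      using 1 2 M0 by (intro mult_mono) auto
    moreover have "\<bar>gauss_poly p (2 * r) * u' (r * pi / 2) / 4\<bar> \<le> \<bar>gauss_poly p (2 * r)\<bar> * \<bar>u' (r * pi / 2)\<bar>"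
      by (simp add: abs_mult)
    ultimately show ?thesis by (simp add: mult_ac)
  qed
  moreover have "0 \<le> M * mode_bound m" using M0 mode_bound_ge[of m] by simp
  ultimately show ?thesis by blast
qed

lemma pairing_bounded:
  assumes "vanishing_at_0 m p"
  shows "\<exists>C\<ge>0. \<forall>dir r e u u'. eigenmode dir m r e u u' \<longrightarrow>
     \<bar>moment r u (oscillator p) + e / 4 * moment r u p\<bar> \<le> C / r\<^sup>2"
proof -
  obtain C1 where C1: "C1 \<ge> 0"
    "\<And>dir r e u u'. eigenmode dir m r e u u' \<Longrightarrow> \<bar>moment r u (perturbation p)\<bar> \<le> C1"
    using moment_bounded by blast
  obtain C2 where C2: "C2 \<ge> 0"
    "\<And>dir r e u u'. eigenmode dir m r e u u' \<Longrightarrow>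
      \<bar>gauss_poly p (2 * r) * u' (r * pi / 2) / 4\<bar> \<le> C2 * (1 / r\<^sup>2) ^ 1"
    using boundary_bounded by blast
  have "\<bar>moment r u (oscillator p) + e / 4 * moment r u p\<bar> \<le> (C1 + C2) / r\<^sup>2"
    if E: "eigenmode dir m r e u u'" for dir r e u u'
  proof -
    interpret eigenmode dir m r e u u' by (rule E)
    have "\<bar>moment r u (perturbation p) / r\<^sup>2\<bar> \<le> C1 / r\<^sup>2"
      using C1(2)[OF E] by (simp add: divide_right_mono)
    moreover have "\<bar>gauss_poly p (2 * r) * u' (r * pi / 2) / 4\<bar> \<le> C2 / r\<^sup>2"
      using C2(2)[OF E] by simp
    ultimately show ?thesis
      unfolding pairing[OF assms, unfolded L_def] add_divide_distrib by linarith
  qed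
  then show ?thesis using C1 C2 by (intro exI[of _ "C1 + C2"]) auto
qed

text \<open>Truncated subtraction is harmless: the coefficient \<open>a * (a - 1)\<close> is 0 for
  \<open>a < 2\<close>.\<close>

lemma oscillator_monom:
  "oscillator (monom 1 a) = smult (real a * real (a - 1)) (monom 1 (a - 2)) - smult (real a + 1 / 2) (monom 1 a)"
proof (rule poly_ext)
  fix x :: real
  consider "a = 0" | "a = 1" | b where "a = Suc (Suc b)" by (metis One_nat_def not0_implies_Suc)
  then show "poly (oscillator (monom 1 a)) x =
      poly (smult (real a * real (a - 1)) (monom 1 (a - 2)) - smult (real a + 1 / 2) (monom 1 a)) x"
    by cases (simp_all add: oscillator_eq pderiv_monom poly_monom algebra_simps)
qed

definition separated :: "nat \<Rightarrow> real \<Rightarrow> real \<Rightarrow> bool" where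
  "separated m g e \<longleftrightarrow> (\<forall>a<m. even a = even m \<longrightarrow> g \<le> e / 4 - 1 / 2 - real a)"

text \<open>Pairing with \<open>t ^ a\<close> gives a triangular system: the moment of degree
  \<open>a\<close> times \<open>e / 4 - 1 / 2 - a\<close> equals O(1 / h) minus a multiple of the
  moment of degree \<open>a - 2\<close>. Separation allows division by the diagonal entry.\<close>

lemma low_moments_small:
  assumes g: "g > 0" and a: "a < m" "even a = even m"
  shows "\<exists>C\<ge>0. \<forall>dir r e u u'. eigenmode dir m r e u u' \<longrightarrow> separated m g e \<longrightarrow>
     \<bar>moment r u (monom 1 a)\<bar> \<le> C / r\<^sup>2"
  using a
proof (induction a rule: less_induct)
  case (less a)
  have "vanishing_at_0 m (monom 1 a)"
    using less.prems by (auto simp: vanishing_at_0_iff_coeff)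
  then obtain C1 where C1: "C1 \<ge> 0" "\<And>dir r e u u'. eigenmode dir m r e u u' \<Longrightarrow>
     \<bar>moment r u (oscillator (monom 1 a)) + e / 4 * moment r u (monom 1 a)\<bar> \<le> C1 / r\<^sup>2"
    using pairing_bounded by blast
  have "\<exists>C\<ge>0. \<forall>dir r e u u'. eigenmode dir m r e u u' \<longrightarrow> separated m g e \<longrightarrow>
     \<bar>real a * real (a - 1) * moment r u (monom 1 (a - 2))\<bar> \<le> C / r\<^sup>2"
  proof (cases "a < 2")
    case True
    then have "real a * real (a - 1) = 0" by (cases a) auto
    then show ?thesis by (intro exI[of _ 0]) auto
  next
    case False
    then obtain C where C: "C \<ge> 0" "\<And>dir r e u u'. eigenmode dir m r e u u' \<Longrightarrow> separated m g e \<Longrightarrow>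
       \<bar>moment r u (monom 1 (a - 2))\<bar> \<le> C / r\<^sup>2"
    proof -
      have "a - 2 < a" "a - 2 < m" "even (a - 2) = even m" using False less.prems by auto
      from less.IH[OF this] show thesis using that by blast
    qed
    show ?thesis
    proof (intro exI[of _ "real a * real (a - 1) * C"] conjI allI impI)
      fix dir r e u u' assume "eigenmode dir m r e u u'" "separated m g e"
      from C(2)[OF this]
      have "real a * real (a - 1) * \<bar>moment r u (monom 1 (a - 2))\<bar> \<le> real a * real (a - 1) * (C / r\<^sup>2)"
        by (rule mult_left_mono) simp
      then show "\<bar>real a * real (a - 1) * moment r u (monom 1 (a - 2))\<bar> \<le> real a * real (a - 1) * C / r\<^sup>2"
        by (simp add: abs_mult)
    qed (use C in auto)
  qed
  then obtain C2 where C2: "C2 \<ge> 0" "\<And>dir r e u u'. eigenmode dir m r e u u' \<Longrightarrow> separated m g e \<Longrightarrow>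
     \<bar>real a * real (a - 1) * moment r u (monom 1 (a - 2))\<bar> \<le> C2 / r\<^sup>2" by blast
  show ?case
  proof (intro exI[of _ "(C1 + C2) / g"] conjI allI impI)
    fix dir r e u u' assume E: "eigenmode dir m r e u u'" and S: "separated m g e"
    interpret eigenmode dir m r e u u' by (rule E)
    define F where "F = moment r u (monom 1 a)"
    have ge: "g \<le> e / 4 - 1 / 2 - real a" using S less.prems by (simp add: separated_def)
    have "moment r u (oscillator (monom 1 a)) + e / 4 * F =
        real a * real (a - 1) * moment r u (monom 1 (a - 2)) + (e / 4 - 1 / 2 - real a) * F"
      unfolding oscillator_monom moment_diff moment_smult F_def by (simp add: algebra_simps)
    moreover have "\<bar>x\<bar> \<le> A + B" if "y = z + x" "\<bar>y\<bar> \<le> A" "\<bar>z\<bar> \<le> B" for x y z A B :: real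
      using that by linarith
    ultimately have "\<bar>(e / 4 - 1 / 2 - real a) * F\<bar> \<le> C1 / r\<^sup>2 + C2 / r\<^sup>2"
      using C1(2)[OF E] C2(2)[OF E S] unfolding F_def[symmetric] by blast
    moreover have "g * \<bar>F\<bar> \<le> \<bar>(e / 4 - 1 / 2 - real a) * F\<bar>"
      using ge g unfolding abs_mult by (intro mult_right_mono) auto
    ultimately have "g * \<bar>F\<bar> \<le> (C1 + C2) / r\<^sup>2" by (simp add: add_divide_distrib)
    then show "\<bar>moment r u (monom 1 a)\<bar> \<le> (C1 + C2) / g / r\<^sup>2"
      using g r_pos by (simp add: F_def field_simps)
  qed (use C1 C2 g in auto)
qed

text \<open>Expanding the product leaves the leading monomial plus monomials of the same parity and
  lower degree. \<open>(1 + B) ^ card S\<close> dominates the sum of the absolute values of their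
  coefficients.\<close>

lemma linear_functional_product:
  fixes J :: "real poly \<Rightarrow> real"
  assumes "finite S"
    and diff: "\<And>p q. J (p - q) = J p - J q" and smult: "\<And>c p. J (smult c p) = c * J p"
    and x: "\<And>z. z \<in> S \<Longrightarrow> \<bar>x z\<bar> \<le> B" and B: "B \<ge> 0"
    and small: "\<And>a. a < m \<Longrightarrow> even a = even m \<Longrightarrow> \<bar>J (monom 1 a)\<bar> \<le> \<epsilon>" and \<epsilon>: "\<epsilon> \<ge> 0"
    and a: "even a = even m"
  shows "(a + 2 * card S < m \<longrightarrow> \<bar>J (monom 1 a * (\<Prod>z\<in>S. [:- x z, 0, 1:]))\<bar> \<le> (1 + B) ^ card S * \<epsilon>) \<and>
    (a + 2 * card S = m \<longrightarrow>
      \<bar>J (monom 1 a * (\<Prod>z\<in>S. [:- x z, 0, 1:])) - J (monom 1 m)\<bar> \<le> (1 + B) ^ card S * \<epsilon>)"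
  using assms(1) x a
proof (induction S arbitrary: a rule: finite_induct)
  case empty
  then show ?case using small[of a] \<epsilon> by auto
next
  case (insert c S)
  let ?P = "\<lambda>a. J (monom 1 a * (\<Prod>z\<in>S. [:- x z, 0, 1:]))"
  have split: "monom 1 a * [:- x c, 0, 1:] = monom 1 (a + 2) - smult (x c) (monom 1 a)"
    by (rule poly_ext) (simp add: poly_monom algebra_simps power2_eq_square)
  have "monom 1 a * (\<Prod>z\<in>insert c S. [:- x z, 0, 1:]) =
      (monom 1 a * [:- x c, 0, 1:]) * (\<Prod>z\<in>S. [:- x z, 0, 1:])"
    using insert.hyps by (simp add: mult.assoc del: mult_pCons_left mult_pCons_right)
  also have "\<dots> = monom 1 (a + 2) * (\<Prod>z\<in>S. [:- x z, 0, 1:]) - smult (x c) (monom 1 a * (\<Prod>z\<in>S. [:- x z, 0, 1:]))"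
    unfolding split by (simp only: left_diff_distrib mult_smult_left)
  finally have J: "J (monom 1 a * (\<Prod>z\<in>insert c S. [:- x z, 0, 1:])) = ?P (a + 2) - x c * ?P a"
    by (simp only: diff smult)
  have card: "card (insert c S) = Suc (card S)" using insert.hyps by simp
  have ev: "even (a + 2) = even m" "even a = even m" using insert.prems by auto
  have xS: "\<And>z. z \<in> S \<Longrightarrow> \<bar>x z\<bar> \<le> B" and xc: "\<bar>x c\<bar> \<le> B" using insert.prems by auto
  note IH1 = insert.IH[OF xS ev(1)] and IH2 = insert.IH[OF xS ev(2)]
  have prod: "\<bar>x c * ?P a\<bar> \<le> B * ((1 + B) ^ card S * \<epsilon>)" if "a + 2 * card S < m"
    unfolding abs_mult using IH2 that xc B by (intro mult_mono) auto
  have sum: "(1 + B) ^ card (insert c S) * \<epsilon> = (1 + B) ^ card S * \<epsilon> + B * ((1 + B) ^ card S * \<epsilon>)"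
    unfolding card by (simp add: algebra_simps)
  show ?case
  proof (intro conjI impI)
    assume "a + 2 * card (insert c S) < m"
    then have "a + 2 + 2 * card S < m" "a + 2 * card S < m" unfolding card by auto
    then have "\<bar>?P (a + 2)\<bar> \<le> (1 + B) ^ card S * \<epsilon>" "\<bar>x c * ?P a\<bar> \<le> B * ((1 + B) ^ card S * \<epsilon>)"
      using IH1 prod by blast+
    then show "\<bar>J (monom 1 a * (\<Prod>z\<in>insert c S. [:- x z, 0, 1:]))\<bar> \<le> (1 + B) ^ card (insert c S) * \<epsilon>"
      unfolding J sum by (intro order_trans[OF abs_triangle_ineq4] add_mono)
  next
    assume "a + 2 * card (insert c S) = m"
    then have "a + 2 + 2 * card S = m" "a + 2 * card S < m" unfolding card by auto
    then have 1: "\<bar>?P (a + 2) - J (monom 1 m)\<bar> \<le> (1 + B) ^ card S * \<epsilon>"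
      and 2: "\<bar>x c * ?P a\<bar> \<le> B * ((1 + B) ^ card S * \<epsilon>)"
      using IH1 prod by blast+
    have "?P (a + 2) - x c * ?P a - J (monom 1 m) = (?P (a + 2) - J (monom 1 m)) - x c * ?P a" by simp
    then show "\<bar>J (monom 1 a * (\<Prod>z\<in>insert c S. [:- x z, 0, 1:])) - J (monom 1 m)\<bar> \<le> (1 + B) ^ card (insert c S) * \<epsilon>"
      unfolding J sum using order_trans[OF abs_triangle_ineq4 add_mono[OF 1 2]] by (simp only:)
  qed
qed

text \<open>The node polynomial and He_m are both monic of degree \<open>m\<close> and of its
  parity, so their moments differ only by small lower moments.\<close>

lemma hermite_moment_lower_bound:
  assumes g: "g > 0"
  shows "\<exists>c>0. \<exists>R. \<forall>dir r e u u'. eigenmode dir m r e u u' \<longrightarrow> separated m g e \<longrightarrow> r \<ge> R \<longrightarrow>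
     c \<le> \<bar>moment r u (hermite m)\<bar>"
proof -
  have "\<forall>a. \<exists>C\<ge>0. a < m \<longrightarrow> even a = even m \<longrightarrow> (\<forall>dir r e u u'. eigenmode dir m r e u u' \<longrightarrow> separated m g e \<longrightarrow>
     \<bar>moment r u (monom 1 a)\<bar> \<le> C / r\<^sup>2)"
    using low_moments_small[OF g] by (metis order_refl)
  then obtain C where C: "\<And>a. C a \<ge> 0" "\<And>a dir r e u u'. a < m \<Longrightarrow> even a = even m \<Longrightarrow> eigenmode dir m r e u u' \<Longrightarrow>
     separated m g e \<Longrightarrow> \<bar>moment r u (monom 1 a)\<bar> \<le> C a / r\<^sup>2" by metis
  define C0 where "C0 = (\<Sum>a<m. C a)"
  define B where "B = (2 * turn m)\<^sup>2"
  define D where "D = (1 + B) ^ (m div 2) * C0 + (\<Sum>a<m. \<bar>coeff (hermite m) a\<bar> * C0)"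
  define c where "c = eigenmode.moment_low m"
  have C0: "C0 \<ge> 0" "\<And>a. a < m \<Longrightarrow> C a \<le> C0"
    unfolding C0_def using C(1) by (auto intro!: sum_nonneg member_le_sum)
  have B: "B \<ge> 0" by (simp add: B_def)
  have D: "D \<ge> 0" unfolding D_def using C0 B by (intro add_nonneg_nonneg sum_nonneg) auto
  have bound: "c - D / r\<^sup>2 \<le> \<bar>moment r u (hermite m)\<bar>" and cpos: "c > 0"
    if E: "eigenmode dir m r e u u'" and S: "separated m g e" for dir r e u u'
  proof -
    interpret eigenmode dir m r e u u' by (rule E)
    show "c > 0" using moment_low_pos by (simp add: c_def)
    define \<epsilon> where "\<epsilon> = C0 / r\<^sup>2"
    have small: "\<bar>moment r u (monom 1 a)\<bar> \<le> \<epsilon>" if "a < m" "even a = even m" for a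
      using C(2)[OF that E S] divide_right_mono[OF C0(2)[OF that(1)], of "r\<^sup>2"] by (simp add: \<epsilon>_def)
    have \<epsilon>: "\<epsilon> \<ge> 0" using C0 by (simp add: \<epsilon>_def)
    have "\<bar>moment r u node_poly - moment r u (monom 1 m)\<bar> \<le> (1 + B) ^ card Z * \<epsilon>"
      unfolding node_poly_def
    proof (rule linear_functional_product[THEN conjunct2, rule_format,
          where x = "\<lambda>z. (tvar r z)\<^sup>2", OF finZ moment_diff moment_smult _ B small \<epsilon>])
      show "\<bar>(tvar r z)\<^sup>2\<bar> \<le> B" if "z \<in> Z" for z
      proof -
        have "(tvar r z)\<^sup>2 \<le> 4 * z\<^sup>2" using tvar_sq_bound r_pos by simp
        also have "4 * z\<^sup>2 \<le> 4 * (turn m)\<^sup>2" using Z_less_turn[OF that] by (simp add: power_mono)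
        finally show ?thesis by (simp add: B_def power_mult_distrib)
      qed
      show "even (m mod 2) = even m" by (simp add: even_iff_mod_2_eq_zero)
      show "m mod 2 + 2 * card Z = m" unfolding cardZ by simp
    qed auto
    moreover have "\<bar>moment r u (hermite m) - moment r u (monom 1 m)\<bar> \<le> (\<Sum>a<m. \<bar>coeff (hermite m) a\<bar> * \<epsilon>)"
    proof -
      have "degree (hermite m) = m"
        using hermite_coeff[of m] by (intro antisym degree_le le_degree) auto
      then have "hermite m = (\<Sum>a\<le>m. monom (coeff (hermite m) a) a)"
        using poly_as_sum_of_monoms[of "hermite m"] by simp
      also have "\<dots> = (\<Sum>a\<le>m. smult (coeff (hermite m) a) (monom 1 a))" by (simp add: smult_monom)
      finally have "moment r u (hermite m) = (\<Sum>a\<le>m. coeff (hermite m) a * moment r u (monom 1 a))"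
        by (metis (no_types, lifting) moment_sum moment_smult sum.cong)
      also have "\<dots> = (\<Sum>a<m. coeff (hermite m) a * moment r u (monom 1 a)) + moment r u (monom 1 m)"
        using hermite_coeff[of m] by (simp add: lessThan_Suc_atMost[symmetric])
      finally have "moment r u (hermite m) - moment r u (monom 1 m) = (\<Sum>a<m. coeff (hermite m) a * moment r u (monom 1 a))"
        by simp
      also have "\<bar>\<dots>\<bar> \<le> (\<Sum>a<m. \<bar>coeff (hermite m) a * moment r u (monom 1 a)\<bar>)" by (rule sum_abs)
      also have "\<dots> \<le> (\<Sum>a<m. \<bar>coeff (hermite m) a\<bar> * \<epsilon>)"
      proof (rule sum_mono)
        fix a assume "a \<in> {..<m}"
        then show "\<bar>coeff (hermite m) a * moment r u (monom 1 a)\<bar> \<le> \<bar>coeff (hermite m) a\<bar> * \<epsilon>"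
          using hermite_coeff[of m] small[of a] by (cases "even a = even m") (auto simp: abs_mult mult_left_mono)
      qed
      finally show ?thesis .
    qed
    moreover have "c \<le> \<bar>moment r u node_poly\<bar>" using node_poly_moment by (simp add: c_def)
    moreover have "D / r\<^sup>2 = (1 + B) ^ card Z * \<epsilon> + (\<Sum>a<m. \<bar>coeff (hermite m) a\<bar> * \<epsilon>)"
      by (simp add: D_def \<epsilon>_def cardZ add_divide_distrib sum_divide_distrib)
    moreover have "c - (A + B) \<le> \<bar>y\<bar>" if "\<bar>x - z\<bar> \<le> A" "\<bar>y - z\<bar> \<le> B" "c \<le> \<bar>x\<bar>" for x y z A B :: real
      using that by linarith
    ultimately show "c - D / r\<^sup>2 \<le> \<bar>moment r u (hermite m)\<bar>" by simp
  qed
  \<comment> \<open>\<open>c > 0\<close> is known only in the presence of a mode; the value 1 covers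
    the vacuous case.\<close>
  define c' where "c' = (if c > 0 then c / 2 else 1)"
  show ?thesis
  proof (rule exI[of _ c'], intro conjI exI[of _ "1 + D / (c / 2)"] allI impI)
    fix dir r e u u'
    assume E: "eigenmode dir m r e u u'" and S: "separated m g e" and r: "1 + D / (c / 2) \<le> r"
    have c: "c > 0" by (rule cpos[OF E S])
    have "D / r\<^sup>2 \<le> c / 2" using D c r by (intro divide_square_le) auto
    then show "c' \<le> \<bar>moment r u (hermite m)\<bar>" using bound[OF E S] c by (simp add: c'_def)
  qed (simp add: c'_def)
qed

subsection \<open>Asymptotic expansion of the mode parameter\<close>

text \<open>A Cauchy product: the low orders match the recursion, and every term of the remainder
  carries a power of \<eta> above \<open>n\<close>.\<close>

lemma truncated_product:
  fixes \<mu> x :: "nat \<Rightarrow> real"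
  shows "(\<Sum>j\<le>n. \<mu> j * \<eta> ^ j) * (\<Sum>i\<le>n. x i * \<eta> ^ i) =
    (\<Sum>s\<le>n. \<eta> ^ s * (\<Sum>j\<le>s. \<mu> j * x (s - j))) +
    (\<Sum>(j, i)\<in>{(j, i). j \<le> n \<and> i \<le> n \<and> n < j + i}. \<eta> ^ (j + i) * (\<mu> j * x i))"
proof -
  let ?f = "\<lambda>(j, i). \<eta> ^ (j + i) * (\<mu> j * x i)"
  have fin: "finite {(j, i). j + i \<le> n}" "finite {(j, i). j \<le> n \<and> i \<le> n \<and> n < j + i}"
    by (rule finite_subset[of _ "{..n} \<times> {..n}"]; auto)+
  have "(\<Sum>j\<le>n. \<mu> j * \<eta> ^ j) * (\<Sum>i\<le>n. x i * \<eta> ^ i) = sum ?f ({..n} \<times> {..n})"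
    by (simp add: sum_product sum.cartesian_product power_add mult_ac)
  also have "{..n} \<times> {..n} = {(j, i). j + i \<le> n} \<union> {(j, i). j \<le> n \<and> i \<le> n \<and> n < j + i}" by auto
  also have "sum ?f \<dots> = sum ?f {(j, i). j + i \<le> n} + sum ?f {(j, i). j \<le> n \<and> i \<le> n \<and> n < j + i}"
    by (intro sum.union_disjoint fin) auto
  also have "sum ?f {(j, i). j + i \<le> n} = (\<Sum>s\<le>n. \<Sum>j\<le>s. \<eta> ^ (j + (s - j)) * (\<mu> j * x (s - j)))"
    by (rule sum.triangle_reindex_eq)
  finally show ?thesis by (simp add: sum_distrib_left)
qed

text \<open>Separation stays a hypothesis because its own proof applies the case
  \<open>n = 0\<close> at \<open>m - 2\<close>.\<close>

lemma expansion_bound: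
  fixes P :: "nat \<Rightarrow> real poly" and \<mu> :: "nat \<Rightarrow> real"
  assumes P0: "P 0 = hermite m" and van: "\<And>s. s \<le> n \<Longrightarrow> vanishing_at_0 m (P s)"
    and rec: "\<And>s. s \<le> n \<Longrightarrow> oscillator (P s) + (\<Sum>j\<le>s. smult (\<mu> j) (P (s - j))) =
        (if s = 0 then 0 else perturbation (P (s - 1)))"
    and g: "g > 0"
  shows "\<exists>C\<ge>0. \<exists>R. \<forall>dir r e u u'. eigenmode dir m r e u u' \<longrightarrow> separated m g e \<longrightarrow> r \<ge> R \<longrightarrow>
    \<bar>e / 4 - (\<Sum>s\<le>n. \<mu> s * (1 / r\<^sup>2) ^ s)\<bar> \<le> C * (1 / r\<^sup>2) ^ Suc n"
proof -
  obtain c R where c: "c > 0" and low: "\<And>dir r e u u'. eigenmode dir m r e u u' \<Longrightarrow> separated m g e \<Longrightarrow> r \<ge> R \<Longrightarrow>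
     c \<le> \<bar>moment r u (hermite m)\<bar>"
    using hermite_moment_lower_bound[OF g] by metis
  obtain X where X: "\<And>s. X s \<ge> 0" "\<And>s dir r e u u'. eigenmode dir m r e u u' \<Longrightarrow> \<bar>moment r u (P s)\<bar> \<le> X s"
    using moment_bounded[of m "P _"] by metis
  obtain K where K: "K \<ge> 0" "\<And>dir r e u u'. eigenmode dir m r e u u' \<Longrightarrow> \<bar>moment r u (perturbation (P n))\<bar> \<le> K"
    using moment_bounded by metis
  obtain B where B: "\<And>s. B s \<ge> 0" "\<And>s dir r e u u'. eigenmode dir m r e u u' \<Longrightarrow>
      \<bar>gauss_poly (P s) (2 * r) * u' (r * pi / 2) / 4\<bar> \<le> B s * (1 / r\<^sup>2) ^ Suc n"
    using boundary_bounded[of m "P _" "Suc n"] by metis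
  define I where "I = {(j, i). j \<le> n \<and> i \<le> n \<and> n < j + i}"
  have finI: "finite I" unfolding I_def by (rule finite_subset[of _ "{..n} \<times> {..n}"]) auto
  define D where "D = K + (\<Sum>(j, i)\<in>I. \<bar>\<mu> j\<bar> * X i) + (\<Sum>s\<le>n. B s)"
  define Y where "Y = (\<Sum>i\<in>{1..n}. X i)"
  have D: "D \<ge> 0" unfolding D_def using K X B by (intro add_nonneg_nonneg sum_nonneg) auto
  have Y: "Y \<ge> 0" unfolding Y_def using X by (intro sum_nonneg) auto
  have "\<bar>e / 4 - (\<Sum>s\<le>n. \<mu> s * (1 / r\<^sup>2) ^ s)\<bar> \<le> (2 * D / c) * (1 / r\<^sup>2) ^ Suc n"
    if E: "eigenmode dir m r e u u'" and S: "separated m g e" and r: "r \<ge> max R (1 + Y / (c / 2))"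
    for dir r e u u'
  proof -
    interpret eigenmode dir m r e u u' by (rule E)
    define \<eta> where "\<eta> = 1 / r\<^sup>2"
    have "1 \<le> r\<^sup>2" using r_pos by (simp add: self_le_power)
    then have \<eta>: "0 < \<eta>" "\<eta> \<le> 1" using r_pos by (auto simp: \<eta>_def)
    have \<eta>le: "\<eta> ^ a \<le> \<eta> ^ b" if "b \<le> a" for a b using \<eta> that by (intro power_decreasing) auto
    define x where "x s = moment r u (P s)" for s
    define k where "k s = moment r u (perturbation (P s))" for s
    define b where "b s = gauss_poly (P s) (2 * r) * u' (r * pi / 2) / 4" for s
    define M where "M = (\<Sum>s\<le>n. \<mu> s * \<eta> ^ s)"
    define A where "A = (\<Sum>s\<le>n. x s * \<eta> ^ s)"
    have osc: "moment r u (oscillator (P s)) = (if s = 0 then 0 else k (s - 1)) - (\<Sum>j\<le>s. \<mu> j * x (s - j))"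
      if "s \<le> n" for s
    proof -
      have "oscillator (P s) = (if s = 0 then 0 else perturbation (P (s - 1))) - (\<Sum>j\<le>s. smult (\<mu> j) (P (s - j)))"
        using rec[OF that] by (simp add: eq_diff_eq)
      then show ?thesis
        by (simp add: moment_diff moment_sum moment_smult moment_zero k_def x_def)
    qed
    \<comment> \<open>The pairing identity for \<open>P s\<close>, weighted by
      \<open>\<eta> ^ s\<close>. The recursion replaces the oscillator moment by the previous
      perturbation moment.\<close>
    have row: "e / 4 * (x s * \<eta> ^ s) = \<eta> * (\<eta> ^ s * k s) - (if s = 0 then 0 else \<eta> ^ s * k (s - 1))
        + \<eta> ^ s * (\<Sum>j\<le>s. \<mu> j * x (s - j)) - \<eta> ^ s * b s" if "s \<le> n" for s
    proof -
      have "(if s = 0 then 0 else k (s - 1)) - (\<Sum>j\<le>s. \<mu> j * x (s - j)) + e / 4 * x s = \<eta> * k s - b s"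
        using pairing[OF van[OF that]] unfolding osc[OF that] L_def
        by (simp add: x_def k_def b_def \<eta>_def)
      then have "e / 4 * x s = \<eta> * k s - b s - (if s = 0 then 0 else k (s - 1)) + (\<Sum>j\<le>s. \<mu> j * x (s - j))"
        by linarith
      then have "\<eta> ^ s * (e / 4 * x s) = \<eta> ^ s * (\<eta> * k s - b s - (if s = 0 then 0 else k (s - 1)) + (\<Sum>j\<le>s. \<mu> j * x (s - j)))"
        by (simp only:)
      then show ?thesis by (cases "s = 0") (simp_all add: algebra_simps)
    qed
    \<comment> \<open>The perturbation of row \<open>s\<close> cancels that of row
      \<open>s + 1\<close>, so only the last one, of order \<open>\<eta> ^ Suc n\<close>,
      remains.\<close>
    have tele: "(\<Sum>s\<le>N. \<eta> * (\<eta> ^ s * k s) - (if s = 0 then 0 else \<eta> ^ s * k (s - 1))) = \<eta> ^ Suc N * k N" for N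
      by (induction N) (simp_all add: algebra_simps)
    have "e / 4 * A = (\<Sum>s\<le>n. e / 4 * (x s * \<eta> ^ s))" by (simp add: A_def sum_distrib_left)
    also have "\<dots> = (\<Sum>s\<le>n. \<eta> * (\<eta> ^ s * k s) - (if s = 0 then 0 else \<eta> ^ s * k (s - 1))
        + \<eta> ^ s * (\<Sum>j\<le>s. \<mu> j * x (s - j)) - \<eta> ^ s * b s)"
      by (intro sum.cong refl row) simp
    also have "\<dots> = \<eta> ^ Suc n * k n + (\<Sum>s\<le>n. \<eta> ^ s * (\<Sum>j\<le>s. \<mu> j * x (s - j))) - (\<Sum>s\<le>n. \<eta> ^ s * b s)"
      using tele[of n] by (simp only: sum.distrib sum_subtractf)
    finally have eA: "e / 4 * A = \<eta> ^ Suc n * k n + (\<Sum>s\<le>n. \<eta> ^ s * (\<Sum>j\<le>s. \<mu> j * x (s - j)))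
        - (\<Sum>s\<le>n. \<eta> ^ s * b s)" .
    have MA: "M * A = (\<Sum>s\<le>n. \<eta> ^ s * (\<Sum>j\<le>s. \<mu> j * x (s - j)))
        + (\<Sum>(j, i)\<in>I. \<eta> ^ (j + i) * (\<mu> j * x i))"
      unfolding M_def A_def I_def by (rule truncated_product)
    have 1: "(e / 4 - M) * A = \<eta> ^ Suc n * k n - (\<Sum>(j, i)\<in>I. \<eta> ^ (j + i) * (\<mu> j * x i)) - (\<Sum>s\<le>n. \<eta> ^ s * b s)"
      unfolding left_diff_distrib eA MA by simp
    have t1: "\<bar>\<eta> ^ Suc n * k n\<bar> \<le> \<eta> ^ Suc n * K"
      using K(2)[OF E] \<eta> by (simp add: k_def abs_mult mult_left_mono)
    have t2: "\<bar>\<Sum>(j, i)\<in>I. \<eta> ^ (j + i) * (\<mu> j * x i)\<bar> \<le> \<eta> ^ Suc n * (\<Sum>(j, i)\<in>I. \<bar>\<mu> j\<bar> * X i)"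
    proof -
      have "\<bar>\<Sum>p\<in>I. \<eta> ^ (fst p + snd p) * (\<mu> (fst p) * x (snd p))\<bar> \<le>
          (\<Sum>p\<in>I. \<bar>\<eta> ^ (fst p + snd p) * (\<mu> (fst p) * x (snd p))\<bar>)" by (rule sum_abs)
      also have "\<dots> \<le> (\<Sum>p\<in>I. \<eta> ^ Suc n * (\<bar>\<mu> (fst p)\<bar> * X (snd p)))"
      proof (rule sum_mono)
        fix p assume "p \<in> I"
        then have "\<eta> ^ (fst p + snd p) \<le> \<eta> ^ Suc n" by (intro \<eta>le) (auto simp: I_def)
        moreover have "\<bar>\<mu> (fst p)\<bar> * \<bar>x (snd p)\<bar> \<le> \<bar>\<mu> (fst p)\<bar> * X (snd p)"
          using X(2)[OF E] by (intro mult_left_mono) (auto simp: x_def)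
        ultimately have "\<eta> ^ (fst p + snd p) * (\<bar>\<mu> (fst p)\<bar> * \<bar>x (snd p)\<bar>)
            \<le> \<eta> ^ Suc n * (\<bar>\<mu> (fst p)\<bar> * X (snd p))"
          by (rule mult_mono) (use \<eta> in auto)
        then show "\<bar>\<eta> ^ (fst p + snd p) * (\<mu> (fst p) * x (snd p))\<bar> \<le> \<eta> ^ Suc n * (\<bar>\<mu> (fst p)\<bar> * X (snd p))"
          using \<eta> by (simp add: abs_mult)
      qed
      finally show ?thesis by (simp add: sum_distrib_left case_prod_beta)
    qed
    have t3: "\<bar>\<Sum>s\<le>n. \<eta> ^ s * b s\<bar> \<le> \<eta> ^ Suc n * (\<Sum>s\<le>n. B s)"
    proof -
      have "\<bar>\<Sum>s\<le>n. \<eta> ^ s * b s\<bar> \<le> (\<Sum>s\<le>n. \<bar>\<eta> ^ s * b s\<bar>)" by (rule sum_abs)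
      also have "\<dots> \<le> (\<Sum>s\<le>n. \<eta> ^ Suc n * B s)"
      proof (rule sum_mono)
        fix s
        have "\<bar>b s\<bar> \<le> \<eta> ^ Suc n * B s" using B(2)[OF E, of s] by (simp add: b_def \<eta>_def mult.commute)
        moreover have "\<bar>\<eta> ^ s\<bar> \<le> 1" using \<eta> by (simp add: power_le_one)
        ultimately have "\<bar>\<eta> ^ s\<bar> * \<bar>b s\<bar> \<le> 1 * (\<eta> ^ Suc n * B s)" by (intro mult_mono) auto
        then show "\<bar>\<eta> ^ s * b s\<bar> \<le> \<eta> ^ Suc n * B s" by (simp add: abs_mult)
      qed
      finally show ?thesis by (simp add: sum_distrib_left)
    qed
    have "\<bar>a - b - c\<bar> \<le> A + B + C" if "\<bar>a\<bar> \<le> A" "\<bar>b\<bar> \<le> B" "\<bar>c\<bar> \<le> C" for a b c A B C :: real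
      using that by linarith
    from this[OF t1 t2 t3] have up: "\<bar>e / 4 - M\<bar> * \<bar>A\<bar> \<le> \<eta> ^ Suc n * D"
      unfolding 1[symmetric] by (simp only: abs_mult D_def distrib_left)
    \<comment> \<open>The leading moment is that of He_m, at least \<open>c\<close>; all corrections
      together are at most \<open>c / 2\<close> for large \<open>r\<close>.\<close>
    have "A = x 0 + (\<Sum>s\<in>{1..n}. x s * \<eta> ^ s)"
      unfolding A_def by (simp add: atMost_atLeast0 sum.atLeast_Suc_atMost)
    moreover have "\<bar>\<Sum>s\<in>{1..n}. x s * \<eta> ^ s\<bar> \<le> \<eta> * Y"
    proof -
      have "\<bar>\<Sum>s\<in>{1..n}. x s * \<eta> ^ s\<bar> \<le> (\<Sum>s\<in>{1..n}. \<bar>x s * \<eta> ^ s\<bar>)" by (rule sum_abs)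
      also have "\<dots> \<le> (\<Sum>s\<in>{1..n}. X s * \<eta> ^ 1)"
      proof (rule sum_mono)
        fix s assume "s \<in> {1..n}"
        then have "\<eta> ^ s \<le> \<eta> ^ 1" by (intro \<eta>le) auto
        then show "\<bar>x s * \<eta> ^ s\<bar> \<le> X s * \<eta> ^ 1"
          using X(1)[of s] X(2)[OF E, of s] \<eta> unfolding abs_mult by (intro mult_mono) (auto simp: x_def)
      qed
      finally show ?thesis by (simp only: Y_def power_one_right sum_distrib_right[symmetric] mult.commute[of \<eta>])
    qed
    moreover have "\<eta> * Y \<le> c / 2" using divide_square_le[OF Y, of "c / 2" r] c r by (simp add: \<eta>_def)
    moreover have "c \<le> \<bar>x 0\<bar>" using low[OF E S] r by (simp add: x_def P0)
    ultimately have "c / 2 \<le> \<bar>A\<bar>" by linarith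
    then have "\<bar>e / 4 - M\<bar> * (c / 2) \<le> \<bar>e / 4 - M\<bar> * \<bar>A\<bar>" by (intro mult_left_mono) auto
    then have "\<bar>e / 4 - M\<bar> * (c / 2) \<le> \<eta> ^ Suc n * D" using up by linarith
    then show ?thesis using c unfolding M_def[symmetric] \<eta>_def[symmetric] by (simp add: field_simps)
  qed
  moreover have "2 * D / c \<ge> 0" using D c by simp
  ultimately show ?thesis by blast
qed

lemma vanishing_hermite: "vanishing_at_0 m (hermite m)"
  using hermite_coeff[of m] by (simp add: vanishing_at_0_iff_coeff)

lemma separated_eventually:
  "\<exists>g>0. \<exists>R. \<forall>dir r e u u'. eigenmode dir m r e u u' \<longrightarrow> r \<ge> R \<longrightarrow> separated m g e"
proof (induction m rule: nat_less_induct)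
  case (1 m)
  show ?case
  proof (cases "m < 2")
    case True
    then have "separated m 1 e" for e by (auto simp: separated_def less_2_cases_iff less_Suc_eq)
    then show ?thesis by (intro exI[of _ 1]) auto
  next
    case False
    define k where "k = m - 2"
    have m: "m = k + 2" using False by (simp add: k_def)
    obtain g R1 where g: "g > 0" and R1: "\<And>dir r e u u'. eigenmode dir k r e u u' \<Longrightarrow> r \<ge> R1 \<Longrightarrow> separated k g e"
      using 1 m by (metis less_add_same_cancel1 zero_less_numeral)
    obtain C R2 where C: "C \<ge> 0" and R2: "\<And>dir r e u u'. eigenmode dir k r e u u' \<Longrightarrow> separated k g e \<Longrightarrow> r \<ge> R2 \<Longrightarrow>
      \<bar>e / 4 - (\<Sum>s\<le>0. (real k + 1 / 2) * (1 / r\<^sup>2) ^ s)\<bar> \<le> C * (1 / r\<^sup>2) ^ Suc 0"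
    proof -
      have "\<exists>C\<ge>0. \<exists>R. \<forall>dir r e u u'. eigenmode dir k r e u u' \<longrightarrow> separated k g e \<longrightarrow> r \<ge> R \<longrightarrow>
        \<bar>e / 4 - (\<Sum>s\<le>0. (real k + 1 / 2) * (1 / r\<^sup>2) ^ s)\<bar> \<le> C * (1 / r\<^sup>2) ^ Suc 0"
        by (rule expansion_bound[of "\<lambda>_. hermite k" k 0 "\<lambda>_. real k + 1 / 2"])
          (simp_all add: vanishing_hermite oscillator_hermite g)
      then show thesis using that by blast
    qed
    obtain c where c: "c > 0" and gap: "\<And>dir r e1 u1 u1' e2 u2 u2'. eigenmode dir k r e1 u1 u1' \<Longrightarrow>
      eigenmode dir m r e2 u2 u2' \<Longrightarrow> e1 + c \<le> e2"
      using mode_gap[of k] unfolding m by blast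
    \<comment> \<open>The gap contributes \<open>c / 4\<close> to \<open>e / 4\<close>; the
      zeroth-order error for the lower mode consumes at most \<open>c / 8\<close>.\<close>
    have "separated m (c / 8) e" if E: "eigenmode dir m r e u u'" and r: "r \<ge> max (max R1 R2) (1 + C / (c / 8))"
      for dir r e u u'
    proof -
      interpret eigenmode dir m r e u u' by (rule E)
      \<comment> \<open>A lower mode for the same \<open>r\<close> and the same boundary condition
        must exist for \<open>mode_gap\<close> to apply.\<close>
      obtain e1 u1 u1' where "mode dir k r e1 u1 u1'" using mode_exists[of r dir k] r_pos by auto
      moreover have "r \<ge> turn k" using r_ge turn_mono[of k] by (simp add: m)
      ultimately have E1: "eigenmode dir k r e1 u1 u1'" by unfold_locales
      have "\<bar>e1 / 4 - (real k + 1 / 2)\<bar> \<le> C / r\<^sup>2" using R2[OF E1 R1[OF E1]] r by simp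
      moreover have "C / r\<^sup>2 \<le> c / 8" using C c r by (intro divide_square_le) auto
      ultimately have k: "c / 8 \<le> e / 4 - 1 / 2 - real k" using gap[OF E1 E] by linarith
      show ?thesis unfolding separated_def
      proof (intro allI impI)
        fix a assume "a < m" "even a = even m"
        then have "a \<noteq> k + 1" "a < k + 2" by (auto simp: m)
        then have "a \<le> k" by linarith
        then show "c / 8 \<le> e / 4 - 1 / 2 - real a" using k by linarith
      qed
    qed
    moreover have "c / 8 > 0" using c by simp
    ultimately show ?thesis by blast
  qed
qed

theorem mode_expansion:
  fixes P :: "nat \<Rightarrow> real poly" and \<mu> :: "nat \<Rightarrow> real"
  assumes P0: "P 0 = hermite m" and van: "\<And>s. s \<le> n \<Longrightarrow> vanishing_at_0 m (P s)"
    and rec: "\<And>s. s \<le> n \<Longrightarrow> oscillator (P s) + (\<Sum>j\<le>s. smult (\<mu> j) (P (s - j))) =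
        (if s = 0 then 0 else perturbation (P (s - 1)))"
  shows "\<exists>C R. \<forall>dir r e u u'. mode dir m r e u u' \<longrightarrow> r \<ge> R \<longrightarrow>
    \<bar>e / 4 - (\<Sum>s\<le>n. \<mu> s * (1 / r\<^sup>2) ^ s)\<bar> \<le> C * (1 / r\<^sup>2) ^ Suc n"
proof -
  obtain g R1 where g: "g > 0" and R1: "\<And>dir r e u u'. eigenmode dir m r e u u' \<Longrightarrow> r \<ge> R1 \<Longrightarrow> separated m g e"
    using separated_eventually by metis
  obtain C R2 where R2: "\<And>dir r e u u'. eigenmode dir m r e u u' \<Longrightarrow> separated m g e \<Longrightarrow> r \<ge> R2 \<Longrightarrow>
      \<bar>e / 4 - (\<Sum>s\<le>n. \<mu> s * (1 / r\<^sup>2) ^ s)\<bar> \<le> C * (1 / r\<^sup>2) ^ Suc n"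
    using expansion_bound[where P = P and n = n and \<mu> = \<mu>, OF P0 van rec g] by blast
  show ?thesis
  proof (rule exI[of _ C], rule exI[of _ "max (turn m) (max R1 R2)"], intro allI impI)
    fix dir r e u u' assume "mode dir m r e u u'" and r: "max (turn m) (max R1 R2) \<le> r"
    then have E: "eigenmode dir m r e u u'" by (simp add: eigenmode_def)
    show "\<bar>e / 4 - (\<Sum>s\<le>n. \<mu> s * (1 / r\<^sup>2) ^ s)\<bar> \<le> C * (1 / r\<^sup>2) ^ Suc n"
      using R2[OF E R1[OF E]] r by simp
  qed
qed

subsection \<open>The recursion for the coefficients\<close>

definition even_poly :: "real poly \<Rightarrow> bool" where
  "even_poly p \<longleftrightarrow> (\<forall>t. poly p (- t) = poly p t)"

definition odd_poly :: "real poly \<Rightarrow> bool" where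
  "odd_poly p \<longleftrightarrow> (\<forall>t. poly p (- t) = - poly p t)"

lemma even_poly_coeff: assumes "even_poly p" "odd i" shows "coeff p i = 0"
proof -
  have "p \<circ>\<^sub>p [:0, -1:] = p"
    by (rule poly_ext) (use assms in \<open>simp add: even_poly_def poly_pcompose\<close>)
  then have "(-1) ^ i * coeff p i = coeff p i" using coeff_pcompose_linear[of p "-1" i] by simp
  then show ?thesis using assms by simp
qed

lemma pderiv_even_poly: assumes "even_poly p" shows "odd_poly (pderiv p)"
proof -
  have "p \<circ>\<^sub>p [:0, -1:] = p"
    by (rule poly_ext) (use assms in \<open>simp add: even_poly_def poly_pcompose\<close>)
  then have 1: "pderiv p = pderiv p \<circ>\<^sub>p [:0, -1:] * pderiv [:0, -1:]" by (metis pderiv_pcompose)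
  have 2: "pderiv [:0, -1:] = [:-1 :: real:]" by (simp add: pderiv_pCons)
  have "poly (pderiv p) t = - poly (pderiv p) (- t)" for t
    using arg_cong[OF 1[unfolded 2], of "\<lambda>p. poly p t"] by (simp add: poly_pcompose)
  then show ?thesis unfolding odd_poly_def by (metis minus_minus)
qed

lemma pderiv_odd_poly: assumes "odd_poly p" shows "even_poly (pderiv p)"
proof -
  have "even_poly ([:0, 1:] * p)" using assms by (auto simp: even_poly_def odd_poly_def)
  then have 1: "odd_poly (pderiv ([:0, 1:] * p))" by (rule pderiv_even_poly)
  have "pderiv [:0, 1:] = (1 :: real poly)" by (simp add: pderiv_pCons)
  then have 2: "poly (pderiv ([:0, 1:] * p)) t = poly p t + t * poly (pderiv p) t" for t
    by (simp only: pderiv_mult) simp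
  have "poly (pderiv p) (- t) = poly (pderiv p) t" for t
  proof (cases "t = 0")
    case False
    have "poly p (- t) + - t * poly (pderiv p) (- t) = - (poly p t + t * poly (pderiv p) t)"
      using 1 unfolding odd_poly_def 2[symmetric] by (metis)
    then show ?thesis using assms False by (simp add: odd_poly_def)
  qed simp
  then show ?thesis by (simp add: even_poly_def)
qed

lemma poly_antiderivative:
  fixes p :: "real poly"
  shows "\<exists>q. pderiv q = p \<and> poly q 0 = 0"
proof (intro exI conjI)
  let ?q = "\<Sum>i\<le>degree p. monom (coeff p i / real (Suc i)) (Suc i)"
  have "pderiv ?q = (\<Sum>i\<le>degree p. monom (coeff p i) i)"
    using higher_pderiv_sum[of 1 "\<lambda>i. monom (coeff p i / real (Suc i)) (Suc i)" "{..degree p}"]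
    by (simp add: pderiv_monom del: of_nat_Suc)
  then show "pderiv ?q = p" by (simp add: poly_as_sum_of_monoms)
  show "poly ?q 0 = 0" by (simp add: poly_sum poly_monom)
qed

definition ttilde_poly :: "nat \<Rightarrow> real poly" where
  "ttilde_poly m = [:- real m - 1 / 2, 0, 1 / 4:]"

lemma poly_ttilde: "poly (ttilde_poly m) t = ttilde m t"
  by (simp add: ttilde_poly_def ttilde_def power2_eq_square)

text \<open>Eliminating \<open>A\<^sub>s\<close> from the two identities leaves \<open>reduced_operator m B\<^sub>s + G + \<mu>\<^sub>s = 0\<close> with \<open>G\<close> even.\<close>

definition reduced_operator :: "nat \<Rightarrow> real poly \<Rightarrow> real poly" where
  "reduced_operator m b = smult (- 1 / 2) (pderiv (pderiv (pderiv b))) + smult 2 (ttilde_poly m * pderiv b) + [:0, 1 / 2:] * b"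

text \<open>Solvability up to a constant, which becomes the new coefficient. The property is linear
  in \<open>G\<close>, so monomials suffice.\<close>

definition reducible :: "nat \<Rightarrow> real poly \<Rightarrow> bool" where
  "reducible m G \<longleftrightarrow> (\<exists>b c. odd_poly b \<and> reduced_operator m b + G + [:c:] = 0)"

lemma reduced_operator_add: "reduced_operator m (a + b) = reduced_operator m a + reduced_operator m b"
  and reduced_operator_smult: "reduced_operator m (smult c b) = smult c (reduced_operator m b)"
  by (rule poly_ext, simp add: reduced_operator_def pderiv_add pderiv_smult algebra_simps)+

lemma reducible_add: assumes "reducible m G" "reducible m H" shows "reducible m (G + H)"
proof -
  obtain b1 c1 b2 c2 where "odd_poly b1" "reduced_operator m b1 + G + [:c1:] = 0"
    "odd_poly b2" "reduced_operator m b2 + H + [:c2:] = 0"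
    using assms by (auto simp: reducible_def)
  moreover have "reduced_operator m (b1 + b2) + (G + H) + [:c1 + c2:] =
      (reduced_operator m b1 + G + [:c1:]) + (reduced_operator m b2 + H + [:c2:])"
    unfolding reduced_operator_add by (simp add: algebra_simps)
  ultimately show ?thesis unfolding reducible_def
    by (intro exI[of _ "b1 + b2"] exI[of _ "c1 + c2"]) (auto simp: odd_poly_def)
qed

lemma reducible_smult: assumes "reducible m G" shows "reducible m (smult k G)"
proof -
  obtain b c where "odd_poly b" "reduced_operator m b + G + [:c:] = 0"
    using assms by (auto simp: reducible_def)
  moreover have "reduced_operator m (smult k b) + smult k G + [:k * c:] = smult k (reduced_operator m b + G + [:c:])"
    unfolding reduced_operator_smult by (simp add: smult_add_right)
  ultimately show ?thesis unfolding reducible_def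
    by (intro exI[of _ "smult k b"] exI[of _ "k * c"]) (auto simp: odd_poly_def)
qed

lemma reducible_const: "reducible m [:k:]"
  unfolding reducible_def by (intro exI[of _ 0] exI[of _ "- k"]) (auto simp: odd_poly_def reduced_operator_def)

lemma reducible_range: assumes "odd_poly b" shows "reducible m (reduced_operator m b)"
  unfolding reducible_def
proof (intro exI conjI)
  show "odd_poly (smult (- 1) b)" using assms by (simp add: odd_poly_def)
  show "reduced_operator m (smult (- 1) b) + reduced_operator m b + [:0:] = 0"
    unfolding reduced_operator_smult by simp
qed

lemma reducible_sum: "(\<And>i. i \<in> I \<Longrightarrow> reducible m (f i)) \<Longrightarrow> reducible m (\<Sum>i\<in>I. f i)"
proof (induction I rule: infinite_finite_induct)
  case (insert i I) then show ?case by (simp add: reducible_add)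
qed (use reducible_const[of m 0] in simp_all)

text \<open>The operator sends \<open>t ^ k\<close> to \<open>(k + 1) / 2 * t ^ (k + 1)\<close> plus
  lower even powers, and this leading coefficient is never 0.\<close>

lemma reducible_monom: "even n \<Longrightarrow> reducible m (monom 1 n)"
proof (induction n rule: less_induct)
  case (less n)
  show ?case
  proof (cases "n = 0")
    case True
    then show ?thesis using reducible_const[of m 1] by (simp add: monom_0)
  next
    case False
    define k where "k = n - 1"
    have n: "n = Suc k" "odd k" using less.prems False by (auto simp: k_def)
    define \<alpha> where "\<alpha> = real k * real (k - 1) * real (k - 2) / 2"
    define \<beta> where "\<beta> = (2 * real m + 1) * real k"
    have "smult ((real k + 1) / 2) (monom 1 n) =
        reduced_operator m (monom 1 k) + smult \<alpha> (monom 1 (k - 3)) + smult \<beta> (monom 1 (k - 1))"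
    proof (rule poly_ext)
      fix x :: real
      consider "k = 1" | j where "k = Suc (Suc (Suc j))"
        using n(2) by (metis One_nat_def even_Suc even_zero not0_implies_Suc)
      then show "poly (smult ((real k + 1) / 2) (monom 1 n)) x =
          poly (reduced_operator m (monom 1 k) + smult \<alpha> (monom 1 (k - 3)) + smult \<beta> (monom 1 (k - 1))) x"
        by cases (simp_all add: n reduced_operator_def \<alpha>_def \<beta>_def ttilde_poly_def pderiv_monom poly_monom field_simps)
    qed
    moreover have "reducible m (reduced_operator m (monom 1 k))"
      using n(2) by (intro reducible_range) (simp add: odd_poly_def poly_monom)
    moreover have "reducible m (smult \<alpha> (monom 1 (k - 3)))"
    \<comment> \<open>For \<open>k = 1\<close> the truncated exponent \<open>k - 3\<close> comes
      with the coefficient 0.\<close>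
    proof (cases "k = 1")
      case True then show ?thesis using reducible_const[of m 0] by (simp add: \<alpha>_def)
    next
      case False
      then have "k - 3 < n" "even (k - 3)" using n by (auto simp: odd_iff_mod_2_eq_one elim!: oddE)
      then show ?thesis by (intro reducible_smult less.IH)
    qed
    moreover have "reducible m (smult \<beta> (monom 1 (k - 1)))" using n by (intro reducible_smult less.IH) auto
    ultimately have "reducible m (smult ((real k + 1) / 2) (monom 1 n))" by (simp add: reducible_add)
    from reducible_smult[OF this, of "2 / (real k + 1)"]
    have "reducible m (smult (2 / (real k + 1) * ((real k + 1) / 2)) (monom 1 n))" by (simp only: smult_smult)
    moreover have "2 / (real k + 1) * ((real k + 1) / 2) = 1" by simp
    ultimately show ?thesis by (simp only: smult_1_left)
  qed
qed

lemma reducible_even_poly: assumes "even_poly G" shows "reducible m G"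
proof -
  have "reducible m (\<Sum>i\<le>degree G. monom (coeff G i) i)"
  proof (rule reducible_sum)
    fix i
    show "reducible m (monom (coeff G i) i)"
    proof (cases "even i")
      case True
      then show ?thesis using reducible_smult[OF reducible_monom, of i m "coeff G i"] by (simp add: smult_monom)
    next
      case False
      then show ?thesis using even_poly_coeff[OF assms False] reducible_const[of m 0] by simp
    qed
  qed
  then show ?thesis by (simp add: poly_as_sum_of_monoms)
qed

text \<open>\<open>source1\<close> and \<open>source2\<close> are the coefficients of D' and D in
  the perturbation of \<open>a D + b D'\<close>.\<close>

definition source1 :: "nat \<Rightarrow> real poly \<Rightarrow> real poly \<Rightarrow> real \<Rightarrow> real" where
  "source1 m a b t = t / 4 * (2 * t * poly (pderiv a) t + poly a t + t * poly (pderiv (pderiv b)) t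
     + poly (pderiv b) t + ttilde m t * t * poly b t)"

definition source2 :: "nat \<Rightarrow> real poly \<Rightarrow> real poly \<Rightarrow> real \<Rightarrow> real" where
  "source2 m a b t = t / 4 * (t * poly (pderiv (pderiv a)) t + poly (pderiv a) t + t\<^sup>2 / 2 * poly b t
     + ttilde m t * (t * poly a t + 2 * t * poly (pderiv b) t + poly b t))"

definition recursion_step ::
    "nat \<Rightarrow> (nat \<Rightarrow> real poly) \<Rightarrow> (nat \<Rightarrow> real poly) \<Rightarrow> (nat \<Rightarrow> real) \<Rightarrow> nat \<Rightarrow> bool" where
  "recursion_step m A B \<mu> s \<longleftrightarrow>
        (\<forall>t. poly (A s) (- t) = poly (A s) t) \<and>
        poly (A s) 0 = 0 \<and>
        (\<forall>t. poly (B s) (- t) = - poly (B s) t) \<and>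
        (\<forall>t. 2 * poly (pderiv (A s)) t + poly (pderiv (pderiv (B s))) t
           - source1 m (A (s - 1)) (B (s - 1)) t
           + (\<Sum>j=1..s. \<mu> j * poly (B (s - j)) t) = 0) \<and>
        (\<forall>t. poly (pderiv (pderiv (A s))) t + 2 * ttilde m t * poly (pderiv (B s)) t
           + t / 2 * poly (B s) t
           + (\<Sum>j=1..s. \<mu> j * poly (A (s - j)) t)
           - source2 m (A (s - 1)) (B (s - 1)) t = 0)"

lemma mathieu_recursion_iff:
  "mathieu_recursion m A B \<mu> \<longleftrightarrow>
     A 0 = 1 \<and> B 0 = 0 \<and> \<mu> 0 = real m + 1 / 2 \<and> (\<forall>s\<ge>1. recursion_step m A B \<mu> s)"
  unfolding mathieu_recursion_def recursion_step_def source1_def source2_def ..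

text \<open>A step looks only at indices up to \<open>s\<close>, which permits a construction by
  well-founded choice.\<close>

lemma recursion_step_cong:
  assumes "\<And>j. j \<le> s \<Longrightarrow> A j = A' j" "\<And>j. j \<le> s \<Longrightarrow> B j = B' j" "\<And>j. j \<le> s \<Longrightarrow> \<mu> j = \<mu>' j"
  shows "recursion_step m A B \<mu> s \<longleftrightarrow> recursion_step m A' B' \<mu>' s"
proof -
  have "(\<Sum>j=1..s. \<mu> j * poly (B (s - j)) t) = (\<Sum>j=1..s. \<mu>' j * poly (B' (s - j)) t)"
    "(\<Sum>j=1..s. \<mu> j * poly (A (s - j)) t) = (\<Sum>j=1..s. \<mu>' j * poly (A' (s - j)) t)" for t
    using assms by (auto intro!: sum.cong)
  moreover have "A s = A' s" "B s = B' s" "A (s - 1) = A' (s - 1)" "B (s - 1) = B' (s - 1)"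
    using assms by auto
  ultimately show ?thesis unfolding recursion_step_def by simp
qed

text \<open>The first identity determines the derivative of \<open>A s\<close> from
  \<open>B s\<close>. Inserting its derivative into the second leaves one equation for an odd
  polynomial and a constant, with an even right-hand side.\<close>

lemma recursion_step_exists:
  assumes s: "s \<ge> 1" and 0: "A 0 = 1" "B 0 = 0"
    and AB: "\<And>j. j < s \<Longrightarrow> even_poly (A j)" "\<And>j. j < s \<Longrightarrow> odd_poly (B j)"
  shows "\<exists>a b c. recursion_step m (A(s := a)) (B(s := b)) (\<mu>(s := c)) s"
proof -
  define X :: "real poly" where "X = [:0, 1:]"
  define A1 B1 where "A1 = A (s - 1)" and "B1 = B (s - 1)"
  have s1: "s - 1 < s" using s by simp
  have ev: "even_poly A1" "odd_poly B1" "odd_poly (pderiv A1)" "even_poly (pderiv B1)"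
    "even_poly (pderiv (pderiv A1))" "odd_poly (pderiv (pderiv B1))"
    unfolding A1_def B1_def using AB[OF s1] by (auto intro!: pderiv_even_poly pderiv_odd_poly)
  define f where "f = (\<Sum>j\<in>{1..<s}. smult (\<mu> j) (B (s - j))) - smult (1 / 4) (X * (smult 2 (X * pderiv A1)
      + A1 + X * pderiv (pderiv B1) + pderiv B1 + ttilde_poly m * X * B1))"
  define g where "g = (\<Sum>j\<in>{1..<s}. smult (\<mu> j) (A (s - j))) - smult (1 / 4) (X * (X * pderiv (pderiv A1)
      + pderiv A1 + smult (1 / 2) (X * X * B1) + ttilde_poly m * (X * A1 + smult 2 (X * pderiv B1) + B1)))"
  have sumf: "odd_poly (\<Sum>j\<in>{1..<s}. smult (\<mu> j) (B (s - j)))"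
    using AB(2) by (simp add: odd_poly_def poly_sum sum_negf)
  have sumg: "even_poly (\<Sum>j\<in>{1..<s}. smult (\<mu> j) (A (s - j)))"
    using AB(1) by (simp add: even_poly_def poly_sum)
  have tt: "poly (ttilde_poly m) (- t) = poly (ttilde_poly m) t" for t by (simp add: ttilde_poly_def)
  have f: "odd_poly f"
    using ev sumf unfolding f_def odd_poly_def even_poly_def
    by (simp add: X_def tt algebra_simps)
  have g: "even_poly g"
    using ev sumg unfolding g_def odd_poly_def even_poly_def
    by (simp add: X_def tt algebra_simps)
  have "even_poly (g - smult (1 / 2) (pderiv f))"
    using g pderiv_odd_poly[OF f] by (simp add: even_poly_def)
  then obtain b c where b: "odd_poly b" and bc: "reduced_operator m b + (g - smult (1 / 2) (pderiv f)) + [:c:] = 0"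
    using reducible_even_poly unfolding reducible_def by blast
  obtain a where a: "pderiv a = smult (- 1 / 2) (pderiv (pderiv b) + f)" "poly a 0 = 0"
    using poly_antiderivative by blast
  have "odd_poly (pderiv a)"
    unfolding a(1) using f pderiv_even_poly[OF pderiv_odd_poly[OF b]] by (simp add: odd_poly_def algebra_simps)
  have aeven: "even_poly a"
  proof -
    have "((\<lambda>t. poly a (- t) - poly a t) has_real_derivative 0) (at t)" for t
    proof -
      have "((\<lambda>t. poly a (- t)) has_real_derivative - poly (pderiv a) (- t)) (at t)"
        using poly_DERIV[of a "- t"] by (simp add: DERIV_mirror)
      then have "((\<lambda>t. poly a (- t) - poly a t) has_real_derivative - poly (pderiv a) (- t) - poly (pderiv a) t) (at t)"
        by (intro DERIV_diff poly_DERIV)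
      then show ?thesis using \<open>odd_poly (pderiv a)\<close> by (simp add: odd_poly_def)
    qed
    then have "poly a (- t) - poly a t = poly a (- 0) - poly a 0" for t
      using DERIV_isconst_all by blast
    then show ?thesis by (simp add: even_poly_def)
  qed
  have dda: "pderiv (pderiv a) = smult (- 1 / 2) (pderiv (pderiv (pderiv b)) + pderiv f)"
    unfolding a(1) by (simp only: pderiv_smult pderiv_add)
  have split: "(\<Sum>j=1..s. h j) = (\<Sum>j\<in>{1..<s}. h j) + h s" for h :: "nat \<Rightarrow> real"
    using s by (metis sum.atLeastLessThan_Suc atLeastLessThanSuc_atLeastAtMost)
  show ?thesis
  proof (rule exI[of _ a], rule exI[of _ b], rule exI[of _ c])
    have A': "(A(s := a)) s = a" "(B(s := b)) s = b" "(A(s := a)) (s - 1) = A1" "(B(s := b)) (s - 1) = B1"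
      using s by (auto simp: A1_def B1_def)
    \<comment> \<open>The term \<open>j = s\<close> meets \<open>B 0 = 0\<close> here and
      \<open>A 0 = 1\<close> in the other sum, so the new coefficient appears only as a constant in
      the second identity.\<close>
    have sB: "(\<Sum>j=1..s. (\<mu>(s := c)) j * poly ((B(s := b)) (s - j)) t) = (\<Sum>j\<in>{1..<s}. \<mu> j * poly (B (s - j)) t)" for t
      unfolding split using s 0 by (auto intro!: sum.cong)
    have sA: "(\<Sum>j=1..s. (\<mu>(s := c)) j * poly ((A(s := a)) (s - j)) t) = (\<Sum>j\<in>{1..<s}. \<mu> j * poly (A (s - j)) t) + c" for t
      unfolding split using s 0 by (auto intro!: sum.cong)
    show "recursion_step m (A(s := a)) (B(s := b)) (\<mu>(s := c)) s"
      unfolding recursion_step_def A' sA sB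
    proof (intro conjI allI)
      fix t
      have fv: "poly f t = (\<Sum>j\<in>{1..<s}. \<mu> j * poly (B (s - j)) t) - source1 m A1 B1 t"
        by (simp add: source1_def f_def X_def poly_sum poly_ttilde algebra_simps)
      have gv: "poly g t = (\<Sum>j\<in>{1..<s}. \<mu> j * poly (A (s - j)) t) - source2 m A1 B1 t"
        by (simp add: source2_def g_def X_def poly_sum poly_ttilde power2_eq_square algebra_simps)
      have pa: "2 * poly (pderiv a) t = - (poly (pderiv (pderiv b)) t + poly f t)"
        unfolding a(1) by (simp add: field_simps)
      have pda: "poly (pderiv (pderiv a)) t = - (poly (pderiv (pderiv (pderiv b))) t + poly (pderiv f) t) / 2"
        unfolding dda by (simp add: field_simps)
      show "2 * poly (pderiv a) t + poly (pderiv (pderiv b)) t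
           - source1 m A1 B1 t
           + (\<Sum>j\<in>{1..<s}. \<mu> j * poly (B (s - j)) t) = 0"
        using fv pa by linarith
      have "poly (reduced_operator m b + (g - smult (1 / 2) (pderiv f)) + [:c:]) t = 0" unfolding bc by simp
      then have "- (poly (pderiv (pderiv (pderiv b))) t) / 2 + 2 * ttilde m t * poly (pderiv b) t + t / 2 * poly b t
          + poly g t - poly (pderiv f) t / 2 + c = 0"
        by (simp add: reduced_operator_def poly_ttilde algebra_simps)
      then show "poly (pderiv (pderiv a)) t + 2 * ttilde m t * poly (pderiv b) t
           + t / 2 * poly b t + ((\<Sum>j\<in>{1..<s}. \<mu> j * poly (A (s - j)) t) + c)
           - source2 m A1 B1 t = 0"
        unfolding pda gv by (simp add: field_simps)
    qed (use aeven b a in \<open>auto simp: even_poly_def odd_poly_def\<close>)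
  qed
qed

lemma mathieu_recursion_exists: "\<exists>A B \<mu>. mathieu_recursion m A B \<mu>"
proof -
  \<comment> \<open>The candidate \<open>r\<close> overwrites the value at \<open>s\<close>, so the
    condition depends on \<open>f\<close> only below \<open>s\<close>.\<close>
  define P where "P f s r \<longleftrightarrow> (if s = 0 then r = (1, 0, real m + 1 / 2) else
      recursion_step m ((fst \<circ> f)(s := fst r)) ((fst \<circ> snd \<circ> f)(s := fst (snd r)))
        ((snd \<circ> snd \<circ> f)(s := snd (snd r))) s)"
    for f :: "nat \<Rightarrow> real poly \<times> real poly \<times> real" and s r
  have "\<exists>f. \<forall>s. P f s (f s)"
  proof (rule dependent_wellorder_choice)
    fix r and f g :: "nat \<Rightarrow> real poly \<times> real poly \<times> real" and s
    assume "\<And>y. y < s \<Longrightarrow> f y = g y"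
    then have "recursion_step m ((fst \<circ> f)(s := fst r)) ((fst \<circ> snd \<circ> f)(s := fst (snd r))) ((snd \<circ> snd \<circ> f)(s := snd (snd r))) s
        = recursion_step m ((fst \<circ> g)(s := fst r)) ((fst \<circ> snd \<circ> g)(s := fst (snd r))) ((snd \<circ> snd \<circ> g)(s := snd (snd r))) s"
      by (intro recursion_step_cong) auto
    then show "P f s r = P g s r" by (simp add: P_def)
  next
    fix s and f :: "nat \<Rightarrow> real poly \<times> real poly \<times> real"
    assume IH: "\<And>y. y < s \<Longrightarrow> P f y (f y)"
    show "\<exists>r. P f s r"
    proof (cases "s = 0")
      case False
      have f0: "f 0 = (1, 0, real m + 1 / 2)" using IH[of 0] False by (simp add: P_def)
      have "even_poly (fst (f j)) \<and> odd_poly (fst (snd (f j)))" if "j < s" for j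
        using IH[OF that] f0
        by (cases "j = 0") (auto simp: P_def recursion_step_def even_poly_def odd_poly_def)
      then obtain a b c where "recursion_step m ((fst \<circ> f)(s := a)) ((fst \<circ> snd \<circ> f)(s := b)) ((snd \<circ> snd \<circ> f)(s := c)) s"
        using recursion_step_exists[of s "fst \<circ> f" "fst \<circ> snd \<circ> f" m "snd \<circ> snd \<circ> f"] False f0 by auto
      then show ?thesis using False by (intro exI[of _ "(a, b, c)"]) (simp add: P_def)
    qed (simp add: P_def)
  qed
  then obtain f where f: "\<And>s. P f s (f s)" by blast
  have "mathieu_recursion m (fst \<circ> f) (fst \<circ> snd \<circ> f) (snd \<circ> snd \<circ> f)"
    unfolding mathieu_recursion_iff
  proof (intro conjI allI impI)
    fix s :: nat assume "1 \<le> s"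
    then have "recursion_step m ((fst \<circ> f)(s := fst (f s))) ((fst \<circ> snd \<circ> f)(s := fst (snd (f s))))
        ((snd \<circ> snd \<circ> f)(s := snd (snd (f s)))) s"
      using f[of s] by (simp add: P_def)
    moreover have "(fst \<circ> f)(s := fst (f s)) = fst \<circ> f" "(fst \<circ> snd \<circ> f)(s := fst (snd (f s))) = fst \<circ> snd \<circ> f"
      "(snd \<circ> snd \<circ> f)(s := snd (snd (f s))) = snd \<circ> snd \<circ> f" by auto
    ultimately show "recursion_step m (fst \<circ> f) (fst \<circ> snd \<circ> f) (snd \<circ> snd \<circ> f) s" by (simp only:)
  qed (use f[of 0] in \<open>simp_all add: P_def\<close>)
  then show ?thesis by blast
qed

section \<open>The formal series as Gaussian-weighted polynomials\<close>

lemma gauss_pderiv_mult: "gauss_pderiv (a * p) = pderiv a * p + a * gauss_pderiv p"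
  by (rule poly_ext) (simp add: gauss_pderiv_def pderiv_mult algebra_simps)

lemma gauss_pderiv_add: "gauss_pderiv (a + b) = gauss_pderiv a + gauss_pderiv b"
  by (rule poly_ext) (simp add: gauss_pderiv_def pderiv_add algebra_simps)

lemma gauss_pderiv2_hermite: "gauss_pderiv (gauss_pderiv (hermite m)) = ttilde_poly m * hermite m"
proof -
  have "gauss_pderiv (gauss_pderiv (hermite m)) = oscillator (hermite m) + [:0, 0, 1 / 4:] * hermite m"
    by (simp add: oscillator_def)
  also have "\<dots> = ttilde_poly m * hermite m"
    unfolding oscillator_hermite by (rule poly_ext) (simp add: ttilde_poly_def algebra_simps)
  finally show ?thesis .
qed

definition formal_mode :: "nat \<Rightarrow> real poly \<Rightarrow> real poly \<Rightarrow> real poly" where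
  "formal_mode m a b = a * hermite m + b * gauss_pderiv (hermite m)"

text \<open>The combinations of D and D' are closed under differentiation because
  \<open>D'' = ttilde D\<close>.\<close>

lemma gauss_pderiv_formal_mode:
  "gauss_pderiv (formal_mode m a b) = formal_mode m (pderiv a + ttilde_poly m * b) (a + pderiv b)"
  unfolding formal_mode_def gauss_pderiv_add gauss_pderiv_mult gauss_pderiv2_hermite
  by (simp add: algebra_simps)

lemma pderiv_ttilde_poly: "pderiv (ttilde_poly m) = [:0, 1 / 2:]"
  by (simp add: ttilde_poly_def pderiv_pCons)

text \<open>The two identities of the recursion are the coefficients of D and D' in this one
  equation.\<close>

lemma formal_mode_recursion:
  assumes A0: "A 0 = 1" and B0: "B 0 = 0" and \<mu>0: "\<mu> 0 = real m + 1 / 2"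
    and st: "s > 0 \<Longrightarrow> recursion_step m A B \<mu> s"
  shows "oscillator (formal_mode m (A s) (B s)) + (\<Sum>j\<le>s. smult (\<mu> j) (formal_mode m (A (s - j)) (B (s - j)))) =
        (if s = 0 then 0 else perturbation (formal_mode m (A (s - 1)) (B (s - 1))))"
proof (cases "s = 0")
  case True
  then show ?thesis by (simp add: A0 B0 \<mu>0 formal_mode_def oscillator_hermite)
next
  case False
  show ?thesis
  proof (rule poly_ext)
    fix t
    define h h1 where "h = poly (hermite m) t" and "h1 = poly (gauss_pderiv (hermite m)) t"
    have fm: "poly (formal_mode m a b) t = poly a t * h + poly b t * h1" for a b
      by (simp add: formal_mode_def h_def h1_def)
    define sA sB where "sA = (\<Sum>j=1..s. \<mu> j * poly (A (s - j)) t)" and "sB = (\<Sum>j=1..s. \<mu> j * poly (B (s - j)) t)"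
    \<comment> \<open>The term \<open>j = 0\<close> cancels the part without derivatives of the
      coefficients, since \<open>ttilde m t - t\<^sup>2 / 4 + m + 1 / 2 = 0\<close>.\<close>
    have "(\<Sum>j\<le>s. \<mu> j * (poly (A (s - j)) t * h + poly (B (s - j)) t * h1)) =
        (real m + 1 / 2) * (poly (A s) t * h + poly (B s) t * h1) + (sA * h + sB * h1)"
      unfolding sA_def sB_def sum_distrib_right sum.distrib[symmetric] atMost_atLeast0
      by (subst sum.atLeast_Suc_atMost) (auto simp: \<mu>0 algebra_simps intro!: sum.cong)
    then have L: "poly (oscillator (formal_mode m (A s) (B s)) + (\<Sum>j\<le>s. smult (\<mu> j) (formal_mode m (A (s - j)) (B (s - j))))) t
       = (poly (pderiv (pderiv (A s))) t + 2 * ttilde m t * poly (pderiv (B s)) t + t / 2 * poly (B s) t + sA) * h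
         + (2 * poly (pderiv (A s)) t + poly (pderiv (pderiv (B s))) t + sB) * h1"
      by (simp add: oscillator_def gauss_pderiv_formal_mode fm poly_sum pderiv_add pderiv_mult pderiv_ttilde_poly
          poly_ttilde)
        (simp add: ttilde_def algebra_simps power2_eq_square)
    have R: "poly (perturbation (formal_mode m (A (s - 1)) (B (s - 1)))) t =
       (source2 m (A (s - 1)) (B (s - 1)) t) * h
       + (source1 m (A (s - 1)) (B (s - 1)) t) * h1"
      by (simp add: source1_def source2_def perturbation_def gauss_pderiv_formal_mode fm pderiv_add pderiv_mult pderiv_ttilde_poly
          poly_ttilde algebra_simps power2_eq_square)
    have id1: "2 * poly (pderiv (A s)) t + poly (pderiv (pderiv (B s))) t + sB
           = source1 m (A (s - 1)) (B (s - 1)) t"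
      using st False unfolding recursion_step_def sB_def by (simp add: algebra_simps)
    have id2: "poly (pderiv (pderiv (A s))) t + 2 * ttilde m t * poly (pderiv (B s)) t + t / 2 * poly (B s) t + sA
           = source2 m (A (s - 1)) (B (s - 1)) t"
      using st False unfolding recursion_step_def sA_def by (simp add: algebra_simps)
    show "poly (oscillator (formal_mode m (A s) (B s)) + (\<Sum>j\<le>s. smult (\<mu> j) (formal_mode m (A (s - j)) (B (s - j))))) t =
      poly (if s = 0 then 0 else perturbation (formal_mode m (A (s - 1)) (B (s - 1)))) t"
      unfolding L id1 id2 using False R by simp
  qed
qed

lemma vanishing_formal_mode:
  assumes a: "even_poly a" and b: "odd_poly b"
  shows "vanishing_at_0 m (formal_mode m a b)"
proof -
  have b0: "poly b 0 = 0" using b unfolding odd_poly_def by (metis add.inverse_neutral equal_neg_zero)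
  have a0: "poly (pderiv a) 0 = 0"
    using pderiv_even_poly[OF a] unfolding odd_poly_def by (metis add.inverse_neutral equal_neg_zero)
  show ?thesis
  proof (cases "even m")
    case True
    have "poly (pderiv (hermite m)) 0 = 0" using vanishing_hermite[of m] True by (simp add: vanishing_at_0_def)
    then show ?thesis using True a0 b0
      by (simp add: vanishing_at_0_def formal_mode_def pderiv_add pderiv_mult gauss_pderiv_def)
  next
    case False
    then show ?thesis using vanishing_hermite[of m] b0
      by (simp add: vanishing_at_0_def formal_mode_def)
  qed
qed

section \<open>Uniqueness and first values of the coefficients\<close>

lemma recursion_expansion:
  assumes A0: "A 0 = 1" and B0: "B 0 = 0" and \<mu>0: "\<mu> 0 = real m + 1 / 2"
    and st: "\<And>s. 1 \<le> s \<Longrightarrow> s \<le> n \<Longrightarrow> recursion_step m A B \<mu> s"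
  shows "\<exists>C R. \<forall>dir r e u u'. mode dir m r e u u' \<longrightarrow> r \<ge> R \<longrightarrow>
    \<bar>e / 4 - (\<Sum>s\<le>n. \<mu> s * (1 / r\<^sup>2) ^ s)\<bar> \<le> C * (1 / r\<^sup>2) ^ Suc n"
proof (rule mode_expansion[where P = "\<lambda>s. formal_mode m (A s) (B s)"])
  show "formal_mode m (A 0) (B 0) = hermite m" by (simp add: A0 B0 formal_mode_def)
  show "vanishing_at_0 m (formal_mode m (A s) (B s))" if "s \<le> n" for s
  proof (cases "s = 0")
    case True
    then show ?thesis using A0 B0 vanishing_hermite by (simp add: formal_mode_def)
  next
    case False
    then show ?thesis using st[of s] that
      by (intro vanishing_formal_mode) (auto simp: recursion_step_def even_poly_def odd_poly_def)
  qed
  show "oscillator (formal_mode m (A s) (B s)) + (\<Sum>j\<le>s. smult (\<mu> j) (formal_mode m (A (s - j)) (B (s - j)))) =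
        (if s = 0 then 0 else perturbation (formal_mode m (A (s - 1)) (B (s - 1))))" if "s \<le> n" for s
    
    by (rule formal_mode_recursion[where A = A and B = B and \<mu> = \<mu>, OF A0 B0 \<mu>0]) (use st[of s] that in auto)
qed

text \<open>Both systems expand the parameter of one and the same mode. Once lower coefficients
  agree, the difference at index \<open>k\<close> is O(1 / h), hence 0. Validity is asked only up to
  \<open>n\<close>, so finitely many explicit steps can be compared with the full recursion.\<close>

lemma recursion_coefficients_unique:
  assumes 1: "A 0 = 1" "B 0 = 0" "\<mu> 0 = real m + 1 / 2" "\<And>s. 1 \<le> s \<Longrightarrow> s \<le> n \<Longrightarrow> recursion_step m A B \<mu> s"
    and 2: "A' 0 = 1" "B' 0 = 0" "\<mu>' 0 = real m + 1 / 2" "\<And>s. 1 \<le> s \<Longrightarrow> s \<le> n \<Longrightarrow> recursion_step m A' B' \<mu>' s"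
    and k: "k \<le> n"
  shows "\<mu> k = \<mu>' k"
  using k
proof (induction k rule: less_induct)
  case (less k)
  obtain C1 R1 where 11: "\<And>dir r e u u'. mode dir m r e u u' \<Longrightarrow> r \<ge> R1 \<Longrightarrow>
      \<bar>e / 4 - (\<Sum>s\<le>k. \<mu> s * (1 / r\<^sup>2) ^ s)\<bar> \<le> C1 * (1 / r\<^sup>2) ^ Suc k"
    using recursion_expansion[where A = A and B = B and \<mu> = \<mu> and n = k, OF 1(1-3)] 1(4) less.prems
    by (meson order_trans)
  obtain C2 R2 where 22: "\<And>dir r e u u'. mode dir m r e u u' \<Longrightarrow> r \<ge> R2 \<Longrightarrow>
      \<bar>e / 4 - (\<Sum>s\<le>k. \<mu>' s * (1 / r\<^sup>2) ^ s)\<bar> \<le> C2 * (1 / r\<^sup>2) ^ Suc k"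
    using recursion_expansion[where A = A' and B = B' and \<mu> = \<mu>' and n = k, OF 2(1-3)] 2(4) less.prems
    by (meson order_trans)
  have bound: "\<bar>\<mu> k - \<mu>' k\<bar> \<le> (C1 + C2) / r\<^sup>2" if r: "r \<ge> 1" "r \<ge> R1" "r \<ge> R2" for r
  proof -
    define \<eta> where "\<eta> = 1 / r\<^sup>2"
    have \<eta>: "\<eta> > 0" using r by (simp add: \<eta>_def)
    obtain e u u' where "mode False m r e u u'" using mode_exists[OF r(1)] by blast
    from 11[OF this r(2)] 22[OF this r(3)]
    have "\<bar>(\<Sum>s\<le>k. \<mu> s * \<eta> ^ s) - (\<Sum>s\<le>k. \<mu>' s * \<eta> ^ s)\<bar> \<le> C1 * \<eta> ^ Suc k + C2 * \<eta> ^ Suc k"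
      unfolding \<eta>_def by linarith
    also have "(\<Sum>s\<le>k. \<mu> s * \<eta> ^ s) - (\<Sum>s\<le>k. \<mu>' s * \<eta> ^ s) = (\<mu> k - \<mu>' k) * \<eta> ^ k"
    proof -
      have "(\<Sum>s<k. \<mu> s * \<eta> ^ s) = (\<Sum>s<k. \<mu>' s * \<eta> ^ s)"
        using less by (intro sum.cong) auto
      then show ?thesis by (simp add: lessThan_Suc_atMost[symmetric] algebra_simps)
    qed
    finally have "\<bar>\<mu> k - \<mu>' k\<bar> * \<eta> ^ k \<le> ((C1 + C2) * \<eta>) * \<eta> ^ k"
      using \<eta> unfolding abs_mult by (simp add: algebra_simps)
    then have "\<bar>\<mu> k - \<mu>' k\<bar> \<le> (C1 + C2) * \<eta>" using \<eta> by (simp add: mult_le_cancel_right)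
    then show ?thesis by (simp add: \<eta>_def)
  qed
  show ?case
  proof (rule ccontr)
    assume neq: "\<mu> k \<noteq> \<mu>' k"
    define d where "d = \<bar>\<mu> k - \<mu>' k\<bar>"
    have d: "d > 0" using neq by (simp add: d_def)
    define r where "r = max (max R1 R2) (1 + \<bar>C1 + C2\<bar> / (d / 2))"
    have "\<bar>C1 + C2\<bar> / (d / 2) \<ge> 0" using d by simp
    then have r: "r \<ge> 1" "r \<ge> R1" "r \<ge> R2" by (auto simp: r_def)
    have "\<bar>C1 + C2\<bar> / r\<^sup>2 \<le> d / 2" using d by (intro divide_square_le) (auto simp: r_def)
    moreover have "(C1 + C2) / r\<^sup>2 \<le> \<bar>C1 + C2\<bar> / r\<^sup>2" by (intro divide_right_mono) auto
    ultimately have "d \<le> d / 2" using bound[OF r] unfolding d_def[symmetric] by (meson order_trans)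
    then show False using d by simp
  qed
qed

lemma mathieu_mu_recursion: "\<exists>A B. mathieu_recursion m A B (mathieu_mu m)"
proof -
  obtain A B \<mu> where r: "mathieu_recursion m A B \<mu>" using mathieu_recursion_exists by blast
  have "\<exists>!\<mu>. \<exists>A B. mathieu_recursion m A B \<mu>"
  proof (rule ex1I[of _ \<mu>])
    fix \<mu>' assume "\<exists>A B. mathieu_recursion m A B \<mu>'"
    then obtain A' B' where r': "mathieu_recursion m A' B' \<mu>'" by blast
    show "\<mu>' = \<mu>"
    proof
      fix k
      show "\<mu>' k = \<mu> k"
        by (rule recursion_coefficients_unique[of A' B' \<mu>' m k A B \<mu> k])
          (use r r' in \<open>auto simp: mathieu_recursion_iff\<close>)
    qed
  qed (use r in blast)
  then show ?thesis unfolding mathieu_mu_def by (rule theI')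
qed

lemma mathieu_mu_values:
  shows "mathieu_mu m 0 = real m + 1 / 2"
    and "mathieu_mu m 1 = - (1 / 16) * (1 + 2 * real m + 2 * real m ^ 2)"
    and "mathieu_mu m 2 = - (1 / 128) * (1 + 3 * real m + 3 * real m ^ 2 + 2 * real m ^ 3)"
proof -
  obtain A B where r: "mathieu_recursion m A B (mathieu_mu m)" using mathieu_mu_recursion by blast
  then show "mathieu_mu m 0 = real m + 1 / 2" by (simp add: mathieu_recursion_iff)
  define M where "M = real m"
  \<comment> \<open>Explicit solutions of steps 1 and 2; verifying them is polynomial arithmetic,
    and uniqueness with \<open>n = 2\<close> transfers the values.\<close>
  define A' :: "nat \<Rightarrow> real poly" where "A' s = (if s = 0 then 1 else if s = 1 then [:0, 0, 1 / 64:] else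
     [:0, 0, (5 + 6 * M - 12 * M ^ 2 - 8 * M ^ 3) / 4096, 0, (9 + 10 * M + 10 * M ^ 2) / 4096, 0,
       (-1 - 2 * M) / 2048, 0, 1 / 8192:])" for s
  define B' :: "nat \<Rightarrow> real poly" where "B' s = (if s = 0 then 0 else if s = 1 then [:0, (-1 - 2 * M) / 32, 0, 1 / 32:] else
     [:0, (-11 - 20 * M - 20 * M ^ 2) / 2048, 0, (-5 - 10 * M) / 2048, 0, 1 / 256:])" for s
  define \<mu>' where "\<mu>' s = (if s = 0 then M + 1 / 2 else if s = 1 then - (1 / 16) * (1 + 2 * M + 2 * M ^ 2) else
     - (1 / 128) * (1 + 3 * M + 3 * M ^ 2 + 2 * M ^ 3))" for s :: nat
  have s1: "recursion_step m A' B' \<mu>' 1"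
    unfolding recursion_step_def source1_def source2_def A'_def B'_def \<mu>'_def ttilde_def M_def[symmetric]
    by (simp add: pderiv_pCons) (simp add: field_simps power2_eq_square)
  have sum2: "(\<Sum>j=1..2. h j) = h 1 + h 2" for h :: "nat \<Rightarrow> real"
    by (simp add: numeral_2_eq_2)
  have s2: "recursion_step m A' B' \<mu>' 2"
    unfolding recursion_step_def source1_def source2_def A'_def B'_def \<mu>'_def ttilde_def M_def[symmetric] sum2
    by (simp add: pderiv_pCons) (simp add: field_simps power2_eq_square power3_eq_cube)
  have "mathieu_mu m k = \<mu>' k" if "k \<le> 2" for k
  proof (rule recursion_coefficients_unique[of A B _ m 2 A' B', OF _ _ _ _ _ _ _ _ that])
    fix s :: nat assume "1 \<le> s" "s \<le> 2"
    then have "s = 1 \<or> s = 2" by linarith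
    then show "recursion_step m A' B' \<mu>' s" using s1 s2 by auto
  qed (use r in \<open>auto simp: mathieu_recursion_iff A'_def B'_def \<mu>'_def M_def\<close>)
  from this[of 1] this[of 2]
  show "mathieu_mu m 1 = - (1 / 16) * (1 + 2 * real m + 2 * real m ^ 2)"
    "mathieu_mu m 2 = - (1 / 128) * (1 + 3 * real m + 3 * real m ^ 2 + 2 * real m ^ 3)"
    by (simp_all add: \<mu>'_def M_def)
qed

subsection \<open>Back to Mathieu's equation\<close>

lemma mathieu_solution_ode2:
  "mathieu_solution l h w w' w'' \<Longrightarrow> ode2 (\<lambda>z. 2 * h\<^sup>2 * cos (2 * z) - l) w w'"
proof -
  assume "mathieu_solution l h w w' w''"
  moreover from this have "w'' z = (2 * h\<^sup>2 * cos (2 * z) - l) * w z" for z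
    unfolding mathieu_solution_def by (metis add_eq_0_iff2 minus_diff_eq mult_minus_left)
  ultimately show ?thesis unfolding mathieu_solution_def ode2_def by simp
qed

definition boundary_condition :: "bool \<Rightarrow> (real \<Rightarrow> real) \<Rightarrow> (real \<Rightarrow> real) \<Rightarrow> bool" where
  "boundary_condition dir w w' \<longleftrightarrow> (if dir then w 0 = 0 \<and> w pi = 0 else w' 0 = 0 \<and> w' pi = 0)"

definition mathieu_eigenvalue :: "bool \<Rightarrow> nat \<Rightarrow> real \<Rightarrow> real \<Rightarrow> bool" where
  "mathieu_eigenvalue dir m h l \<longleftrightarrow> (\<exists>w w' w''. mathieu_solution l h w w' w'' \<and> (\<exists>z. w z \<noteq> 0) \<and>
     boundary_condition dir w w' \<and> has_exactly_zeros m w)"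

text \<open>The larger eigenvalue would have strictly more zeros. Dirichlet ends use the first
  alternative in \<open>sturm_count\<close>, Neumann ends the second.\<close>

lemma mathieu_eigenvalue_less_False:
  assumes "mathieu_eigenvalue dir m h l1" "mathieu_eigenvalue dir m h l2" "l1 < l2"
  shows False
proof -
  obtain w1 w1' w1'' where 1: "mathieu_solution l1 h w1 w1' w1''" "boundary_condition dir w1 w1'" "has_exactly_zeros m w1"
    using assms(1) unfolding mathieu_eigenvalue_def by blast
  obtain w2 w2' w2'' where 2: "mathieu_solution l2 h w2 w2' w2''" "boundary_condition dir w2 w2'" "has_exactly_zeros m w2"
    using assms(2) unfolding mathieu_eigenvalue_def by blast
  have "card {x\<in>{0<..<pi}. w1 x = 0} < card {x\<in>{0<..<pi}. w2 x = 0}"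
    by (rule sturm_count[OF mathieu_solution_ode2[OF 1(1)] mathieu_solution_ode2[OF 2(1)]])
      (use 1 2 assms(3) in \<open>auto simp: boundary_condition_def has_exactly_zeros_def split: if_splits\<close>)
  then show False using 1(3) 2(3) by (simp add: has_exactly_zeros_def)
qed

lemma mathieu_eigenvalue_unique:
  "mathieu_eigenvalue dir m h l1 \<Longrightarrow> mathieu_eigenvalue dir m h l2 \<Longrightarrow> l1 = l2"
  using mathieu_eigenvalue_less_False by (metis linorder_neqE_linordered_idom)

lemma mathieu_a_eq:
  assumes "mathieu_eigenvalue False m h l" shows "mathieu_a m h = l"
proof -
  have "mathieu_a m h = (THE l. mathieu_eigenvalue False m h l)"
    by (simp add: mathieu_a_def mathieu_eigenvalue_def boundary_condition_def)
  also have "\<dots> = l" using assms mathieu_eigenvalue_unique[OF _ assms] by (rule the_equality)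
  finally show ?thesis .
qed

lemma mathieu_b_eq:
  assumes "mathieu_eigenvalue True m h l" shows "mathieu_b (m + 1) h = l"
proof -
  have "mathieu_b (m + 1) h = (THE l. mathieu_eigenvalue True m h l)"
    by (simp add: mathieu_b_def mathieu_eigenvalue_def boundary_condition_def)
  also have "\<dots> = l" using assms mathieu_eigenvalue_unique[OF _ assms] by (rule the_equality)
  finally show ?thesis .
qed

text \<open>At \<open>z = pi / 2 + s / r\<close> one has
  \<open>t\<^sup>2 = 4 * h * (cos z)\<^sup>2\<close>, and the double-angle formula turns the
  coefficient of \<open>w\<close> into \<open>h * (t\<^sup>2 - e)\<close>. Parity supplies the
  boundary condition at \<open>z = 0\<close> and the zeros left of the centre.\<close>

lemma mode_imp_mathieu_eigenvalue:
  assumes mode: "mode dir m r e u u'" and r: "r > 0"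
  shows "mathieu_eigenvalue dir m (r\<^sup>2) (- 2 * (r\<^sup>2)\<^sup>2 + r\<^sup>2 * e)"
proof -
  define L where "L = r * pi / 2"
  define q where "q s = (tvar r s)\<^sup>2 - e" for s
  define Z where "Z = zeros L u"
  have ode: "ode2 q u u'" and par: "parity_data m u u'" and bc: "if dir then u L = 0 else u' L = 0"
    and Z: "finite Z" "card Z = m div 2"
    using mode unfolding mode_def L_def Z_def q_def[abs_def] by auto
  have L: "L > 0" using r by (simp add: L_def)
  have du: "(u has_real_derivative u' s) (at s)" "(u' has_real_derivative q s * u s) (at s)" for s
    using ode by (auto simp: ode2_def)
  have parity: "u (- s) = (- 1) ^ m * u s" for s
    by (rule ode2_parity[OF ode _ _ par, of "4 * r\<^sup>2 + \<bar>e\<bar>"]) (simp_all add: q_def potential_bound tvar_minus)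
  have parity': "u' (- s) = - ((- 1) ^ m * u' s)" for s
  proof -
    have "((\<lambda>s. u (- s)) has_real_derivative - u' (- s)) (at s)"
      using du(1)[of "- s"] by (simp add: DERIV_mirror)
    moreover have "((\<lambda>s. u (- s)) has_real_derivative (- 1) ^ m * u' s) (at s)"
      unfolding parity by (rule DERIV_cmult[OF du(1)])
    ultimately have "- u' (- s) = (- 1) ^ m * u' s" by (rule DERIV_unique)
    then show ?thesis by linarith
  qed
  define x where "x z = r * (z - pi / 2)" for z
  have dx: "(x has_real_derivative r) (at z)" for z
    unfolding x_def by (auto intro!: derivative_eq_intros)
  define w where "w z = u (x z)" for z
  define w' where "w' z = r * u' (x z)" for z
  define w'' where "w'' z = r * (q (x z) * u (x z) * r)" for z
  have "mathieu_solution (- 2 * (r\<^sup>2)\<^sup>2 + r\<^sup>2 * e) (r\<^sup>2) w w' w''"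
    unfolding mathieu_solution_def
  proof (intro conjI allI)
    fix z
    show "(w has_real_derivative w' z) (at z)"
      using DERIV_chain2[OF du(1) dx] by (simp add: w_def[abs_def] w'_def mult.commute)
    show "(w' has_real_derivative w'' z) (at z)"
      unfolding w'_def[abs_def] w''_def by (rule DERIV_cmult[OF DERIV_chain2[OF du(2) dx]])
    have "tvar r (x z) = - (2 * r * cos z)"
    proof -
      have "x z / r = - (pi / 2 - z)" using r by (simp add: x_def)
      then have "sin (x z / r) = - cos z" by (simp only: sin_minus cos_sin_eq of_real_eq_id id_apply)
      then show ?thesis by (simp add: tvar_def)
    qed
    then have qx: "q (x z) = 4 * r\<^sup>2 * (cos z)\<^sup>2 - e" by (simp add: q_def power_mult_distrib)
    have c2: "cos (2 * z) = 2 * (cos z)\<^sup>2 - 1" by (rule cos_double_cos)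
    show "w'' z + (- 2 * (r\<^sup>2)\<^sup>2 + r\<^sup>2 * e - 2 * (r\<^sup>2)\<^sup>2 * cos (2 * z)) * w z = 0"
      unfolding w''_def w_def qx c2 by (simp add: algebra_simps power2_eq_square)
  qed
  moreover have "boundary_condition dir w w'"
  proof -
    have "x 0 = - L" "x pi = L" by (auto simp: x_def L_def)
    then show ?thesis using bc parity[of L] parity'[of L]
      by (auto simp: boundary_condition_def w_def w'_def split: if_splits)
  qed
  moreover have "has_exactly_zeros m w"
  proof -
    define N where "N = {s\<in>{- L<..<L}. u s = 0}"
    \<comment> \<open>The central zero, present exactly for odd \<open>m\<close>, supplies the
      remainder in \<open>m = 2 * (m div 2) + m mod 2\<close>.\<close>
    define O0 :: "real set" where "O0 = (if odd m then {0} else {})"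
    have u0: "u 0 = 0 \<longleftrightarrow> odd m" using par by (auto simp: parity_data_def)
    have N: "N = Z \<union> uminus ` Z \<union> O0"
    proof (intro equalityI subsetI)
      fix s assume s: "s \<in> N"
      consider "s > 0" | "s = 0" | "s < 0" by linarith
      then show "s \<in> Z \<union> uminus ` Z \<union> O0"
      proof cases
        case 3
        then have "- s \<in> Z" using s parity[of s] by (auto simp: N_def Z_def zeros_def)
        then show ?thesis by (auto intro: image_eqI[of _ _ "- s"])
      qed (use s u0 in \<open>auto simp: N_def Z_def zeros_def O0_def\<close>)
    next
      fix s assume "s \<in> Z \<union> uminus ` Z \<union> O0"
      then show "s \<in> N" using L u0 parity
        by (auto simp: N_def Z_def zeros_def O0_def split: if_splits)
    qed
    have disj: "Z \<inter> uminus ` Z = {}" "(Z \<union> uminus ` Z) \<inter> O0 = {}"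
      by (auto simp: Z_def zeros_def O0_def)
    have fin: "finite (uminus ` Z)" "finite O0" using Z by (auto simp: O0_def)
    have "card N = card Z + card (uminus ` Z) + card O0"
      unfolding N using Z fin disj by (simp add: card_Un_disjoint)
    also have "card (uminus ` Z) = card Z" by (intro card_image) auto
    also have "card O0 = m mod 2" by (auto simp: O0_def odd_iff_mod_2_eq_one)
    finally have cardN: "card N = m" using Z div_mult_mod_eq[of m 2] by linarith
    have finN: "finite N" using N Z fin by simp
    have "bij_betw x {z\<in>{0<..<pi}. w z = 0} N"
    proof (rule bij_betwI[where g = "\<lambda>s. s / r + pi / 2"])
      show "x \<in> {z\<in>{0<..<pi}. w z = 0} \<rightarrow> N"
      proof
        fix z assume "z \<in> {z\<in>{0<..<pi}. w z = 0}"
        then have z: "0 < z" "z < pi" "u (x z) = 0" by (auto simp: w_def)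
        have "r * (- (pi / 2)) < r * (z - pi / 2)" "r * (z - pi / 2) < r * (pi / 2)"
          using z r by (intro mult_strict_left_mono; simp)+
        then show "x z \<in> N" using z by (simp add: N_def x_def L_def)
      qed
      show "(\<lambda>s. s / r + pi / 2) \<in> N \<rightarrow> {z\<in>{0<..<pi}. w z = 0}"
      proof
        fix s assume s: "s \<in> N"
        then have "- (pi / 2) < s / r" "s / r < pi / 2" using r by (auto simp: N_def L_def field_simps)
        then have "0 < s / r + pi / 2" "s / r + pi / 2 < pi" by linarith+
        moreover have "x (s / r + pi / 2) = s" using r by (simp add: x_def)
        ultimately show "s / r + pi / 2 \<in> {z\<in>{0<..<pi}. w z = 0}"
          using s by (simp add: w_def N_def)
      qed
    qed (use r in \<open>auto simp: x_def field_simps\<close>)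
    from bij_betw_finite[OF this] bij_betw_same_card[OF this] finN cardN
    show ?thesis unfolding has_exactly_zeros_def by simp
  qed
  moreover have "\<exists>z. w z \<noteq> 0"
  proof -
    have "infinite ({0<..<L} - Z)" using Z L by (simp add: infinite_Ioo)
    then have "{0<..<L} - Z \<noteq> {}" by (rule infinite_imp_nonempty)
    then obtain s where "s \<in> {0<..<L}" "s \<notin> Z" by blast
    then have "u s \<noteq> 0" by (simp add: Z_def zeros_def)
    moreover have "x (s / r + pi / 2) = s" using r by (simp add: x_def)
    ultimately show ?thesis by (intro exI[of _ "s / r + pi / 2"]) (simp add: w_def)
  qed
  ultimately show ?thesis unfolding mathieu_eigenvalue_def by blast
qed

text \<open>Abstracting the eigenvalue function as \<open>f\<close> lets one argument serve both
  families.\<close>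

lemma mathieu_eigenvalue_expansion:
  assumes f: "\<And>h l. mathieu_eigenvalue dir m h l \<Longrightarrow> f h = l"
  shows "(\<lambda>h. f h - (- 2 * h\<^sup>2 + 4 * h * (\<Sum>s=0..n. mathieu_mu m s / h ^ s))) \<in> O[at_top](\<lambda>h. 1 / h ^ n)"
proof -
  obtain A B where rec: "mathieu_recursion m A B (mathieu_mu m)" using mathieu_mu_recursion by blast
  have "\<exists>C R. \<forall>dir r e u u'. mode dir m r e u u' \<longrightarrow> r \<ge> R \<longrightarrow>
    \<bar>e / 4 - (\<Sum>s\<le>n. mathieu_mu m s * (1 / r\<^sup>2) ^ s)\<bar> \<le> C * (1 / r\<^sup>2) ^ Suc n"
    by (rule recursion_expansion[of A B]) (use rec in \<open>auto simp: mathieu_recursion_iff\<close>)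
  then obtain C R where CR: "\<And>dir r e u u'. mode dir m r e u u' \<Longrightarrow> r \<ge> R \<Longrightarrow>
    \<bar>e / 4 - (\<Sum>s\<le>n. mathieu_mu m s * (1 / r\<^sup>2) ^ s)\<bar> \<le> C * (1 / r\<^sup>2) ^ Suc n"
    by blast
  show ?thesis
  proof (rule bigoI[of _ "4 * C"])
    show "\<forall>\<^sub>F h in at_top. norm (f h - (- 2 * h\<^sup>2 + 4 * h * (\<Sum>s=0..n. mathieu_mu m s / h ^ s)))
        \<le> 4 * C * norm (1 / h ^ n)"
      using eventually_ge_at_top[of "max 1 (R\<^sup>2)"]
    proof eventually_elim
      case (elim h)
      then have h: "h \<ge> 1" "R\<^sup>2 \<le> h" by auto
      define r where "r = sqrt h"
      have r: "r \<ge> 1" "r\<^sup>2 = h" "R \<le> r" using h by (auto simp: r_def real_le_rsqrt)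
      obtain e u u' where mode: "mode dir m r e u u'" using mode_exists[OF r(1)] by blast
      have "f h = - 2 * h\<^sup>2 + h * e"
        using f[OF mode_imp_mathieu_eigenvalue[OF mode]] r by simp
      then have "f h - (- 2 * h\<^sup>2 + 4 * h * (\<Sum>s=0..n. mathieu_mu m s / h ^ s)) =
          4 * h * (e / 4 - (\<Sum>s\<le>n. mathieu_mu m s * (1 / h) ^ s))"
        by (simp add: atMost_atLeast0 power_divide algebra_simps)
      also have "norm \<dots> = 4 * h * \<bar>e / 4 - (\<Sum>s\<le>n. mathieu_mu m s * (1 / h) ^ s)\<bar>"
        using h by (simp add: abs_mult)
      \<comment> \<open>The factor \<open>4 * h\<close> costs one power: order n + 1 for
        \<open>e / 4\<close> gives order n for the eigenvalue.\<close>
      also have "\<dots> \<le> 4 * h * (C * (1 / h) ^ Suc n)"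
        using CR[OF mode r(3)] h unfolding r(2) by (intro mult_left_mono) auto
      also have "\<dots> = 4 * C * norm (1 / h ^ n)" using h by (simp add: power_divide)
      finally show ?case .
    qed
  qed
qed

theorem mainTheorem5:
  fixes m :: nat
  shows "(\<forall>n\<ge>1.
            (\<lambda>h. mathieu_a m h - (- 2 * h\<^sup>2 + 4 * h * (\<Sum>s=0..n. mathieu_mu m s / h ^ s)))
              \<in> O[at_top](\<lambda>h. 1 / h ^ n) \<and>
            (\<lambda>h. mathieu_b (m + 1) h - (- 2 * h\<^sup>2 + 4 * h * (\<Sum>s=0..n. mathieu_mu m s / h ^ s)))
              \<in> O[at_top](\<lambda>h. 1 / h ^ n)) \<and>
         mathieu_mu m 0 = real m + 1 / 2 \<and>
         mathieu_mu m 1 = - (1 / 16) * (1 + 2 * real m + 2 * real m ^ 2) \<and>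
         mathieu_mu m 2 = - (1 / 128) * (1 + 3 * real m + 3 * real m ^ 2 + 2 * real m ^ 3)"
  by (intro conjI allI impI mathieu_mu_values
      mathieu_eigenvalue_expansion[of False, OF mathieu_a_eq] mathieu_eigenvalue_expansion[of True, OF mathieu_b_eq])

end
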